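(* Let $f$ be a function of bounded variation on $\mathbb{R}_+=[0,\infty)$ with $\lim_{t\to\infty}f(t)=0$, and let $\gamma=0$ or $\gamma=\frac14$. If $f\in V_p^*$, i.e. $\|f\|_{V_p^*}<\infty$, for some $p$ with $1<p\le\infty$, then for $x>0$ $$\widehat f_\gamma(x)=\frac{1}{2\pi x}\,f\!\left(\frac1x\right)\sin 2\pi\gamma+\Gamma(x),$$ where $\|\Gamma\|_{L^1(\mathbb{R}_+)}\lesssim\|f\|_{V_p^*}$.
   Context: $\widehat f_\gamma(x)=\int_0^\infty f(t)\cos 2\pi(xt-\gamma)\,dt$ (so $\gamma=0$ gives the cosine Fourier transform and $\gamma=\frac14$ the sine Fourier transform). The notation $\varphi\lesssim\psi$ means $\varphi\le C\psi$ with $C$ an absolute constant. For functions on $\mathbb{R}$, $\widehat g(y)=\int_{\mathbb{R}} g(x)e^{-2\pi i xy}\,dx$ (extended to $L^p(\mathbb{R})$, in the distributional sense when necessary); $p'$ is the conjugate exponent of $p$, with $\frac1\infty=0$, and $\|\cdot\|_p$ the norm of $L^p(\mathbb{R},dx)$. For $p\in[1,\infty]$, $\widehat L^p(\mathbb{R})=\{h\in L^p(\mathbb{R}): h=\widehat g \text{ for some } g\in L^{p'}(\mathbb{R})\}$ with norm $\|h\|_{\widehat L^p}=\|\widehat h\|_{p'}$. For a sigma-finite Borel measure $\mu$ on $\mathbb{R}$ (not assumed positive or real-valued), $\|\mu\|_p^*=\sup\left\{\left|\int_{\mathbb{R}}h\,d\mu\right| : h\in\widehat L^{p'}(\mathbb{R}),\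 \|h\|_{\widehat L^{p'}}\le1\right\}$. For $f$ of bounded variation on $\mathbb{R}_+$, $\mu_f$ denotes the (Lebesgue–Stieltjes) measure generated by $f$, with $df$ written for $d\mu_f$; $\chi_E$ is the characteristic function of $E$, and $\chi_E\mu$ is the measure $G\mapsto\int_G\chi_E\,d\mu$. Then $$\|f\|_{V_p^*}=\int_0^\infty x^{-\frac1p}\,\|\chi_{(x,2x)}\mu_f\|_p^*\,dx .$$
   Formalization: The constant in the bound of the L^1 norm of Γ by the V_p^* norm of f may depend on p (not on f or γ); a constant independent of p is impossible as p tends to 1, e.g. for γ=0 and f' = -(1/ε)χ_{[1,1+ε]}. *)

theory Defs
  imports "HOL-Analysis.Analysis" "HOL-Probability.Essential_Supremum"
begin

text \<open>Exponents are extended nonnegative reals. In \<^typ>\<open>ennreal\<close> one has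
  \<open>inverse 0 = \<infinity>\<close> and \<open>inverse \<infinity> = 0\<close>, so the formula below also covers the endpoint
  pairs \<open>(1, \<infinity>)\<close> and \<open>(\<infinity>, 1)\<close>.\<close>

definition conj_exp :: "ennreal \<Rightarrow> ennreal" where
  "conj_exp p = inverse (1 - inverse p)"

definition Lp_norm :: "ennreal \<Rightarrow> (real \<Rightarrow> complex) \<Rightarrow> ennreal" where
  "Lp_norm p g =
     (if p = \<infinity> then esssup lborel (\<lambda>x. ennreal (cmod (g x)))
      else let I = (\<integral>\<^sup>+x. ennreal (cmod (g x) powr enn2real p) \<partial>lborel)
           in if I = \<infinity> then \<infinity> else ennreal (enn2real I powr (1 / enn2real p)))"

definition Lp_space :: "ennreal \<Rightarrow> (real \<Rightarrow> complex) set" where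
  "Lp_space p = {g \<in> borel_measurable borel. Lp_norm p g < \<infinity>}"

definition fourier_integral :: "(real \<Rightarrow> complex) \<Rightarrow> real \<Rightarrow> complex" where
  "fourier_integral g y = (LINT x|lborel. g x * cis (- (2 * pi * x * y)))"

text \<open>\<open>D n\<close> is the \<open>n\<close>-th derivative of \<open>\<phi>\<close>.\<close>

definition schwartz :: "(real \<Rightarrow> complex) \<Rightarrow> bool" where
  "schwartz \<phi> \<longleftrightarrow>
     (\<exists>D :: nat \<Rightarrow> real \<Rightarrow> complex.
        D 0 = \<phi> \<and>
        (\<forall>n x. (D n has_vector_derivative D (Suc n) x) (at x)) \<and>
        (\<forall>n m. bounded (range (\<lambda>x. x ^ m *\<^sub>R D n x))))"

text \<open>\<open>h\<close> is the Fourier transform of \<open>g\<close> as a tempered distribution. For integrable \<open>g\<close>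
  this says that \<open>h\<close> equals \<open>fourier_integral g\<close> almost everywhere.\<close>

definition is_fourier_of :: "(real \<Rightarrow> complex) \<Rightarrow> (real \<Rightarrow> complex) \<Rightarrow> bool" where
  "is_fourier_of h g \<longleftrightarrow>
     (\<forall>\<phi>. schwartz \<phi> \<longrightarrow>
        integrable lborel (\<lambda>x. h x * \<phi> x) \<and>
        integrable lborel (\<lambda>x. g x * fourier_integral \<phi> x) \<and>
        (LINT x|lborel. h x * \<phi> x) = (LINT x|lborel. g x * fourier_integral \<phi> x))"

text \<open>The transform is determined up to a null set, which its norms do not see.\<close>

definition fourier :: "(real \<Rightarrow> complex) \<Rightarrow> real \<Rightarrow> complex" where
  "fourier g = (SOME h. h \<in> borel_measurable borel \<and> is_fourier_of h g)"

definition Lhat_space :: "ennreal \<Rightarrow> (real \<Rightarrow> complex) set" where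
  "Lhat_space p = {h \<in> Lp_space p. \<exists>g \<in> Lp_space (conj_exp p). is_fourier_of h g}"

definition Lhat_norm :: "ennreal \<Rightarrow> (real \<Rightarrow> complex) \<Rightarrow> ennreal" where
  "Lhat_norm p h = Lp_norm (conj_exp p) (fourier h)"

text \<open>A complex Borel measure \<open>\<mu>\<close> is given in the form \<open>d\<mu> = \<theta> d\<nu>\<close> with a positive
  sigma-finite Borel measure \<open>\<nu>\<close> and a Borel function \<open>\<theta>\<close>, so that \<open>d|\<mu>| = |\<theta>| d\<nu>\<close>,
  the integral of \<open>h\<close> with respect to \<open>\<mu>\<close> is \<open>LINT t|\<nu>. h t * \<theta> t\<close>, and \<open>|\<mu>|\<close>-almost
  everywhere means \<open>\<nu>\<close>-almost everywhere where \<open>\<theta> \<noteq> 0\<close>.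

  Elements of \<open>Lhat_space\<close> are only determined up to Lebesgue null sets, which \<open>\<mu>\<close> may
  charge. They are integrated through their precise representative, i.e. the limit of
  the means over shrinking intervals. By Lebesgue's differentiation theorem this is no
  restriction if \<open>\<mu>\<close> is absolutely continuous; without it, every \<open>\<mu>\<close> with a nonzero
  singular part would have infinite norm, since a test function can be
  changed at will on a Lebesgue null set carrying the singular part.\<close>

definition precise_at :: "(real \<Rightarrow> complex) \<Rightarrow> real \<Rightarrow> bool" where
  "precise_at h t \<longleftrightarrow>
     ((\<lambda>r. (LINT s:{t - r..t + r}|lborel. h s) / of_real (2 * r)) \<longlongrightarrow> h t) (at_right 0)"

definition star_norm :: "ennreal \<Rightarrow> real measure \<Rightarrow> (real \<Rightarrow> complex) \<Rightarrow> ennreal" where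
  "star_norm p \<nu> \<theta> =
     (SUP h \<in> {h \<in> Lhat_space (conj_exp p).
                 Lhat_norm (conj_exp p) h \<le> 1 \<and>
                 (AE t in \<nu>. \<theta> t \<noteq> 0 \<longrightarrow> precise_at h t) \<and>
                 integrable \<nu> (\<lambda>t. h t * \<theta> t)}.
        ennreal (cmod (LINT t|\<nu>. h t * \<theta> t)))"

definition bounded_variation_on :: "real set \<Rightarrow> (real \<Rightarrow> complex) \<Rightarrow> bool" where
  "bounded_variation_on S f \<longleftrightarrow>
     (\<exists>B. \<forall>(n::nat) t. (\<forall>i\<le>n. t i \<in> S) \<and> (\<forall>i<n. t i \<le> t (Suc i)) \<longrightarrow>
            (\<Sum>i<n. cmod (f (t (Suc i)) - f (t i))) \<le> B)"

text \<open>\<open>\<theta> d\<nu>\<close> is the Lebesgue-Stieltjes measure of \<open>f\<close> on the half-line: it vanishes on the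
  negative axis and assigns \<open>f(b+) - f(0)\<close> to \<open>[0,b]\<close>, hence \<open>f(b+) - f(a+)\<close> to \<open>(a,b]\<close>.\<close>

definition is_stieltjes :: "(real \<Rightarrow> complex) \<Rightarrow> real measure \<Rightarrow> (real \<Rightarrow> complex) \<Rightarrow> bool" where
  "is_stieltjes f \<nu> \<theta> \<longleftrightarrow>
     sigma_finite_measure \<nu> \<and> sets \<nu> = sets borel \<and> integrable \<nu> \<theta> \<and>
     (\<forall>t<0. \<theta> t = 0) \<and>
     (\<forall>b\<ge>0. (LINT t:{0..b}|\<nu>. \<theta> t) = Lim (at_right b) f - f 0)"

text \<open>The pair is not unique, but the complex measure it represents is, and \<open>star_norm\<close>
  depends only on the latter.\<close>

definition stieltjes :: "(real \<Rightarrow> complex) \<Rightarrow> real measure \<times> (real \<Rightarrow> complex)" where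
  "stieltjes f = (SOME m. is_stieltjes f (fst m) (snd m))"

definition Vstar_norm :: "ennreal \<Rightarrow> (real \<Rightarrow> complex) \<Rightarrow> ennreal" where
  "Vstar_norm p f =
     (\<integral>\<^sup>+x\<in>{0<..}. ennreal (x powr (- enn2real (inverse p))) *
        star_norm p (fst (stieltjes f))
          (\<lambda>t. indicator {x<..<2*x} t *\<^sub>R snd (stieltjes f) t) \<partial>lborel)"

text \<open>The integral over the half-line is an improper one: \<open>f\<close> need not be integrable.\<close>

definition has_trig_transform :: "real \<Rightarrow> (real \<Rightarrow> complex) \<Rightarrow> real \<Rightarrow> complex \<Rightarrow> bool" where
  "has_trig_transform \<gamma> f x v \<longleftrightarrow>
     ((\<lambda>A. LINT t:{0..A}|lborel. f t * of_real (cos (2 * pi * (x * t - \<gamma>)))) \<longlongrightarrow> v) at_top"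

end

theory Submission
  imports Defs "HOL-Probability.Probability" "HOL-Real_Asymp.Real_Asymp"
begin

text \<open>
  Integrating by parts against the measure \<open>\<mu> = \<theta> d\<nu>\<close> generated by \<open>f\<close>, the remainder \<open>\<Gamma>(x)\<close> becomes
  \<open>1/(2 \<pi> x)\<close> times the integral against \<open>\<mu>\<close> of the even or the odd part in \<open>x\<close> of
  \<open>k\<^sub>x(t) = e\<^bsup>2 \<pi> i x t\<^esup> - \<chi>(t \<le> 1/|x|)\<close>. After averaging over dyadic intervals \<open>(a, 2a)\<close> with respect to
  \<open>da/a\<close>, it remains to bound \<open>\<integral> |\<integral> k\<^sub>x d\<mu>\<^sub>a| dx/|x|\<close> by a multiple of \<open>a\<^bsup>1-1/p\<^esup>\<close> times the dual norm of
  \<open>\<mu>\<^sub>a\<close>, the restriction of \<open>\<mu>\<close> to \<open>(a, 2a)\<close>. All test functions used for this have a Fourier transform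
  bounded by a multiple of \<open>1/(1/a + |y|)\<close>, whose \<open>L\<^sup>p\<close> norm is of order \<open>a\<^bsup>1-1/p\<^esup>\<close> because \<open>p > 1\<close>.
  For \<open>|x| > 1/(2a)\<close> one dualizes: the integral of \<open>1/|x|\<close> times the modulus of the transform of \<open>\<mu>\<^sub>a\<close>
  is the pairing of \<open>\<mu>\<^sub>a\<close> with the transform of a function bounded by \<open>1/|x|\<close>, made integrable by a wide
  Gaussian factor. For \<open>|x| \<le> 1/(2a)\<close> the kernel is \<open>e\<^bsup>2 \<pi> i x t\<^esup> - 1\<close>, and a further integration by parts
  reduces the claim to the masses \<open>\<mu>\<^sub>a(u, 2a)\<close>, that is, to indicator functions as test functions.
\<close>

section \<open>The Fourier transform\<close>

text \<open>The frequency ranges are dictated by the interval: every \<open>t\<close> in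
  \<open>(a, 2a)\<close> has \<open>t * |x| \<le> 1\<close> once \<open>|x| \<le> 1/(2a)\<close>,
  and none has once \<open>|x| \<ge> 1/a\<close>; in between \<open>1/|x|\<close> is comparable to
  \<open>a\<close>, so a crude bound of the cutoff by masses suffices. The measure
  \<open>da/a\<close> does two things: each \<open>s > 0\<close> gets the same mass
  \<open>ln 2\<close>, and \<open>a powr (1 - 1/p) / a\<close> is exactly the weight in the norm of
  V_p^*. The constant \<open>200 * decay_const p / ln 2\<close> grows without bound as
  \<open>p\<close> decreases to 1, where \<open>1/(1/a + |y|)\<close> stops being p-integrable. Two
  features of the dual norm shape the test functions. The measure may have atoms, and test functions
  are evaluated through their precise representative, so each of them is continuous or takes the
  midpoint value at its jump inside \<open>(a, 2a)\<close>. And transforms are distributional and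
  selected by choice; with integrable bounded test functions the selected transform is almost
  everywhere the Fourier integral, and its reflection is a preimage of the test function. This is
  where inversion for Schwartz functions and uniqueness of transforms come in.\<close>

lemma power_mult_exp_bound:
  fixes x :: real
  shows "\<bar>x\<bar> ^ n * exp (- x\<^sup>2 / 2) \<le> fact n * exp (1 / 2)"
proof -
  \<comment> \<open>A single term of the exponential series is at most its sum; afterwards
    \<open>|x| \<le> 1/2 + x^2/2\<close> trades the exponential for the Gaussian.\<close>
  have "\<bar>x\<bar> ^ n / fact n \<le> exp \<bar>x\<bar>"
    using sum_le_suminf[of "\<lambda>k. \<bar>x\<bar> ^ k /\<^sub>R fact k" "{n}"] summable_exp_generic[of "\<bar>x\<bar>"]
    by (simp add: exp_def divide_inverse mult.commute)
  then have "\<bar>x\<bar> ^ n \<le> fact n * exp \<bar>x\<bar>"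
    by (simp add: field_simps)
  also have "\<bar>x\<bar> \<le> 1 / 2 + x\<^sup>2 / 2"
    using zero_le_power2[of "\<bar>x\<bar> - 1"] by (simp add: power2_diff)
  finally have "\<bar>x\<bar> ^ n \<le> fact n * exp (1 / 2 + x\<^sup>2 / 2)" by simp
  then have "\<bar>x\<bar> ^ n * exp (- x\<^sup>2 / 2) \<le> fact n * exp (1 / 2 + x\<^sup>2 / 2) * exp (- x\<^sup>2 / 2)"
    by (intro mult_right_mono) auto
  also have "\<dots> = fact n * exp (1 / 2)"
    by (simp add: mult.assoc flip: exp_add)
  finally show ?thesis .
qed

text \<open>Induction over the coefficients with \<open>m\<close> free: the tail of
  \<open>pCons a P\<close> carries one more factor \<open>x\<close>, which is absorbed into the
  power \<open>x ^ m\<close>.\<close>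

lemma bounded_power_poly_exp:
  fixes P :: "complex poly"
  shows "bounded (range (\<lambda>x::real. x ^ m *\<^sub>R
     (poly P (of_real x) * exp (- (of_real x)\<^sup>2 / 2 + \<i> * of_real (\<xi> * x)))))"
proof (induction P arbitrary: m)
  case 0
  then show ?case by (simp add: image_constant_conv)
next
  case (pCons a P)
  let ?e = "\<lambda>x::real. exp (- (complex_of_real x)\<^sup>2 / 2 + \<i> * of_real (\<xi> * x))"
  have "norm (x ^ m *\<^sub>R (a * ?e x)) \<le> cmod a * (fact m * exp (1 / 2))" for x :: real
  proof -
    have "norm (?e x) = exp (- x\<^sup>2 / 2)"
      by (simp add: norm_exp_eq_Re flip: of_real_power)
    then show ?thesis
      using mult_left_mono[OF power_mult_exp_bound[of x m], of "cmod a"]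
      by (simp add: norm_mult power_abs algebra_simps)
  qed
  then have 1: "bounded (range (\<lambda>x::real. x ^ m *\<^sub>R (a * ?e x)))"
    by (auto simp: bounded_iff)
  have 2: "bounded (range (\<lambda>x::real. x ^ Suc m *\<^sub>R (poly P (of_real x) * ?e x)))"
    by (rule pCons.IH)
  have "bounded (range (\<lambda>x. x ^ m *\<^sub>R (a * ?e x) + x ^ Suc m *\<^sub>R (poly P (of_real x) * ?e x)))"
    by (rule bounded_plus_comp[OF 1 2])
  then show ?case
    by (simp add: scaleR_conv_of_real algebra_simps)
qed

text \<open>Every derivative is a polynomial times the same exponential; the linear factor in the
  recursion for \<open>P\<close> is the derivative of the exponent. Gaussians times characters are
  the test functions by which \<open>is_fourier_of_unique\<close> separates distributional
  transforms.\<close>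

lemma schwartz_gaussian_char:
  "schwartz (\<lambda>x. exp (- (of_real x)\<^sup>2 / 2 + \<i> * of_real (\<xi> * x)))"
proof -
  let ?e = "\<lambda>x::real. exp (- (complex_of_real x)\<^sup>2 / 2 + \<i> * of_real (\<xi> * x))"
  define P where "P = rec_nat (1 :: complex poly) (\<lambda>_ Q. pderiv Q + [:\<i> * of_real \<xi>, -1:] * Q)"
  have P0: "P 0 = 1" and PS: "P (Suc n) = pderiv (P n) + [:\<i> * of_real \<xi>, -1:] * P n" for n
    by (simp_all add: P_def)
  define D where "D = (\<lambda>n x. poly (P n) (complex_of_real x) * ?e x)"
  have "(D n has_vector_derivative D (Suc n) x) (at x)" for n x
  proof -
    have "((\<lambda>z. poly (P n) z * exp (- z\<^sup>2 / 2 + \<i> * of_real \<xi> * z)) has_field_derivative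
        poly (pderiv (P n)) z * exp (- z\<^sup>2 / 2 + \<i> * of_real \<xi> * z) +
        poly (P n) z * (exp (- z\<^sup>2 / 2 + \<i> * of_real \<xi> * z) * (\<i> * of_real \<xi> - z))) (at z)" for z :: complex
      by (auto intro!: derivative_eq_intros simp: algebra_simps)
    from has_vector_derivative_real_field[OF this, of "x" "UNIV"]
    show ?thesis
      by (simp add: D_def PS algebra_simps)
  qed
  moreover have "bounded (range (\<lambda>x. x ^ m *\<^sub>R D n x))" for n m
    unfolding D_def by (rule bounded_power_poly_exp)
  moreover have "D 0 = ?e" by (simp add: D_def P0)
  ultimately show ?thesis
    unfolding schwartz_def by blast
qed

section \<open>Decay and integrability of Fourier integrals of Schwartz functions\<close>

lemma integrable_inverse_one_plus_square: "integrable lborel (\<lambda>x::real. inverse (1 + x\<^sup>2))"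
  using integrable_inverse_1_plus_square by (simp add: set_integrable_def)

lemma integrable_decay:
  fixes g :: "real \<Rightarrow> 'a :: {banach, second_countable_topology}"
  assumes [measurable]: "g \<in> borel_measurable borel"
    and "\<And>x. norm (g x) \<le> A" "\<And>x. norm (x\<^sup>2 *\<^sub>R g x) \<le> B"
  shows "integrable lborel g"
proof (rule Bochner_Integration.integrable_bound)
  show "integrable lborel (\<lambda>x. (A + B) * inverse (1 + x\<^sup>2))"
    using integrable_inverse_one_plus_square by simp
  show "AE x in lborel. norm (g x) \<le> norm ((A + B) * inverse (1 + x\<^sup>2))"
  proof (rule AE_I2)
    fix x :: real
    have "norm (g x) * (1 + x\<^sup>2) \<le> A + B"
      using add_mono[OF assms(2,3), of x x] by (simp add: algebra_simps)
    moreover have "0 < 1 + x\<^sup>2" by (rule add_pos_nonneg) auto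
    ultimately have "norm (g x) \<le> (A + B) / (1 + x\<^sup>2)" by (simp add: field_simps)
    also have "\<dots> \<le> norm ((A + B) * inverse (1 + x\<^sup>2))"
      unfolding divide_inverse real_norm_def by (rule abs_ge_self)
    finally show "norm (g x) \<le> norm ((A + B) * inverse (1 + x\<^sup>2))" .
  qed
qed simp

lemma schwartzE:
  assumes "schwartz \<phi>"
  obtains D :: "nat \<Rightarrow> real \<Rightarrow> complex" where "D 0 = \<phi>"
    "\<And>n x. (D n has_vector_derivative D (Suc n) x) (at x)"
    "\<And>n m. bounded (range (\<lambda>x. x ^ m *\<^sub>R D n x))"
    "\<And>n. continuous_on UNIV (D n)" "\<And>n. D n \<in> borel_measurable borel"
    "\<And>n. integrable lborel (D n)"
proof -
  obtain D where D: "D 0 = \<phi>" "\<And>n x. (D n has_vector_derivative D (Suc n) x) (at x)"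
      "\<And>n m. bounded (range (\<lambda>x. x ^ m *\<^sub>R D n x))"
    using assms unfolding schwartz_def by blast
  have c: "continuous_on UNIV (D n)" for n
    using D(2)[of n] by (meson continuous_at_imp_continuous_on has_vector_derivative_continuous)
  have b: "D n \<in> borel_measurable borel" for n
    using c by (rule borel_measurable_continuous_onI)
  have "integrable lborel (D n)" for n
  proof -
    obtain A where "\<And>x. norm (D n x) \<le> A"
      using D(3)[of 0 n] by (auto simp: bounded_iff)
    moreover obtain B where "\<And>x. norm (x\<^sup>2 *\<^sub>R D n x) \<le> B"
      using D(3)[of 2 n] by (auto simp: bounded_iff)
    ultimately show ?thesis by (intro integrable_decay b)
  qed
  with D c b show thesis using that by blast
qed

lemma borel_measurable_cis [measurable]: "cis \<in> borel_measurable borel"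
  by (intro borel_measurable_continuous_onI continuous_intros)

lemma integrable_mult_cis:
  assumes "integrable M f" and [measurable]: "g \<in> borel_measurable M"
  shows "integrable M (\<lambda>x. f x * cis (g x))"
  using assms(1)
  by (rule Bochner_Integration.integrable_bound)
     (use assms in \<open>auto simp: norm_mult intro!: borel_measurable_times measurable_compose[OF _ borel_measurable_cis]\<close>)

lemma norm_fourier_integral_le:
  "cmod (fourier_integral f y) \<le> (LINT x|lborel. cmod (f x))"
  unfolding fourier_integral_def
  by (rule order_trans[OF integral_norm_bound]) (simp add: norm_mult)

lemma borel_measurable_fourier_integral [measurable]:
  assumes [measurable]: "f \<in> borel_measurable borel"
  shows "fourier_integral f \<in> borel_measurable borel"
  unfolding fourier_integral_def[abs_def] by measurable

lemma integral_vector_derivative_eq_0: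
  fixes F :: "real \<Rightarrow> complex"
  assumes "\<And>x. (F has_vector_derivative F' x) (at x)" "continuous_on UNIV F'"
    "integrable lborel F'" "(F \<longlongrightarrow> 0) at_top" "(F \<longlongrightarrow> 0) at_bot"
  shows "(LINT x|lborel. F' x) = 0"
proof -
  have "(LBINT x=-\<infinity>..\<infinity>. F' x) = 0 - 0"
  proof (rule interval_integral_FTC_integrable[where F = F])
    show "((F \<circ> real_of_ereal) \<longlongrightarrow> 0) (at_right (- \<infinity>))"
         "((F \<circ> real_of_ereal) \<longlongrightarrow> 0) (at_left \<infinity>)"
      using assms(4,5) by (simp_all add: ereal_tendsto_simps)
  qed (use assms in \<open>auto simp: set_integrable_def continuous_on_eq_continuous_at\<close>)
  then show ?thesis
    by (simp add: interval_lebesgue_integral_def set_lebesgue_integral_def einterval_def)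
qed

lemma tendsto_0_of_decay:
  fixes F :: "real \<Rightarrow> complex"
  assumes "\<And>x. norm (x *\<^sub>R F x) \<le> B"
  shows "(F \<longlongrightarrow> 0) at_top" "(F \<longlongrightarrow> 0) at_bot"
proof -
  have *: "norm (F x) \<le> B / \<bar>x\<bar>" if "x \<noteq> 0" for x
    using assms[of x] that by (simp add: pos_le_divide_eq mult.commute)
  have "((\<lambda>x. B / \<bar>x\<bar>) \<longlongrightarrow> 0) at_top" "((\<lambda>x. B / \<bar>x\<bar>) \<longlongrightarrow> 0) at_bot"
    by real_asymp+
  moreover have "\<forall>\<^sub>F x in at_top. norm (F x) \<le> B / \<bar>x\<bar>"
    using eventually_gt_at_top[of 0] by eventually_elim (rule *, simp)
  moreover have "\<forall>\<^sub>F x in at_bot. norm (F x) \<le> B / \<bar>x\<bar>"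
    using eventually_gt_at_bot[of 0] by eventually_elim (rule *, simp)
  ultimately show "(F \<longlongrightarrow> 0) at_top" "(F \<longlongrightarrow> 0) at_bot"
    by (auto intro: Lim_null_comparison)
qed

text \<open>Integration by parts: the derivative of \<open>f x * cis (- (2 * pi * x * y))\<close>
  has integral zero, because the bound on \<open>x *\<^sub>R f x\<close> makes this product vanish
  at both ends.\<close>

lemma fourier_integral_deriv:
  assumes der: "\<And>x. (f has_vector_derivative f' x) (at x)"
    and c: "continuous_on UNIV f'" and i: "integrable lborel f" "integrable lborel f'"
    and b: "\<And>x. norm (x *\<^sub>R f x) \<le> B"
  shows "fourier_integral f' y = 2 * pi * \<i> * y * fourier_integral f y"
proof -
  let ?c = "\<lambda>x. cis (- (2 * pi * x * y))"
  have cf: "continuous_on UNIV f"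
    using der by (meson continuous_at_imp_continuous_on has_vector_derivative_continuous)
  have dc: "(?c has_vector_derivative - (2 * pi * \<i> * y) * ?c x) (at x)" for x
  proof -
    have "((\<lambda>z. exp (- (2 * pi * \<i> * y) * z)) has_field_derivative
        exp (- (2 * pi * \<i> * y) * z) * - (2 * pi * \<i> * y)) (at z)" for z :: complex
      by (auto intro!: derivative_eq_intros)
    from has_vector_derivative_real_field[OF this, of "x" "UNIV"]
    show ?thesis by (simp add: cis_conv_exp algebra_simps)
  qed
  have "(LINT x|lborel. f x * (- (2 * pi * \<i> * y) * ?c x) + f' x * ?c x) = 0"
  proof (rule integral_vector_derivative_eq_0[where F = "\<lambda>x. f x * ?c x"])
    show "((\<lambda>x. f x * ?c x) has_vector_derivative
        f x * (- (2 * pi * \<i> * y) * ?c x) + f' x * ?c x) (at x)" for x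
      by (rule has_vector_derivative_mult[OF der dc])
    show "continuous_on UNIV (\<lambda>x. f x * (- (2 * pi * \<i> * y) * ?c x) + f' x * ?c x)"
      by (intro continuous_intros c cf)
    have *: "f x * (- (2 * pi * \<i> * y) * ?c x) = - (2 * pi * \<i> * y) * (f x * ?c x)" for x by simp
    show "integrable lborel (\<lambda>x. f x * (- (2 * pi * \<i> * y) * ?c x) + f' x * ?c x)"
      unfolding * using i by (intro Bochner_Integration.integrable_add integrable_mult_right integrable_mult_cis) auto
    have "norm (x *\<^sub>R (f x * ?c x)) \<le> B" for x using b[of x] by (simp add: norm_mult)
    from tendsto_0_of_decay[OF this]
    show "((\<lambda>x. f x * ?c x) \<longlongrightarrow> 0) at_top" "((\<lambda>x. f x * ?c x) \<longlongrightarrow> 0) at_bot" .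
  qed
  moreover have "f x * (- (2 * pi * \<i> * y) * ?c x) + f' x * ?c x
     = f' x * ?c x - (2 * pi * \<i> * y) * (f x * ?c x)" for x by (simp add: algebra_simps)
  ultimately have "(LINT x|lborel. f' x * ?c x - (2 * pi * \<i> * y) * (f x * ?c x)) = 0"
    by (simp only:)
  also have "(LINT x|lborel. f' x * ?c x - (2 * pi * \<i> * y) * (f x * ?c x)) =
      (LINT x|lborel. f' x * ?c x) - (LINT x|lborel. (2 * pi * \<i> * y) * (f x * ?c x))"
    using i by (intro Bochner_Integration.integral_diff integrable_mult_right integrable_mult_cis) auto
  finally show ?thesis
    unfolding fourier_integral_def integral_mult_right_zero by simp
qed

text \<open>Two derivatives bring out a factor \<open>y\<^sup>2\<close>, so the transform decays
  like an inverse square.\<close>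

lemma integrable_fourier_integral_schwartz:
  assumes "schwartz \<phi>"
  shows "integrable lborel (fourier_integral \<phi>)"
proof -
  obtain D where D: "D 0 = \<phi>" "\<And>n x. (D n has_vector_derivative D (Suc n) x) (at x)"
    "\<And>n m. bounded (range (\<lambda>x. x ^ m *\<^sub>R D n x))"
    "\<And>n. continuous_on UNIV (D n)" "\<And>n. D n \<in> borel_measurable borel"
    "\<And>n. integrable lborel (D n)"
    using schwartzE[OF assms] by blast
  have d: "fourier_integral (D (Suc n)) y = 2 * pi * \<i> * y * fourier_integral (D n) y" for n y
  proof -
    obtain B where "\<And>x. norm (x *\<^sub>R D n x) \<le> B"
      using D(3)[of 1 n] by (auto simp: bounded_iff)
    from fourier_integral_deriv[OF D(2) D(4) D(6) D(6) this] show ?thesis .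
  qed
  have *: "fourier_integral (D 2) y = - (4 * pi\<^sup>2) * (y\<^sup>2 *\<^sub>R fourier_integral \<phi> y)" for y
    using d[of 1 y] d[of 0 y] D(1)
    by (simp add: numeral_2_eq_2 power2_eq_square scaleR_conv_of_real algebra_simps)
  have "norm (y\<^sup>2 *\<^sub>R fourier_integral \<phi> y) \<le> (LINT x|lborel. cmod (D 2 x)) / (4 * pi\<^sup>2)" for y
    using norm_fourier_integral_le[of "D 2" y] unfolding *
    by (simp add: norm_mult norm_power field_simps)
  then show ?thesis
    using norm_fourier_integral_le D(1,5) by (intro integrable_decay) auto
qed

lemma integrable_bounded_times:
  fixes h \<theta> :: "'a \<Rightarrow> complex"
  assumes "integrable M \<theta>" and [measurable]: "h \<in> borel_measurable M" and b: "\<And>t. cmod (h t) \<le> B"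
  shows "integrable M (\<lambda>t. h t * \<theta> t)"
proof (rule Bochner_Integration.integrable_bound[OF integrable_mult_right[OF assms(1), of "of_real B"]])
  have [measurable]: "\<theta> \<in> borel_measurable M" using assms(1) by auto
  show "AE t in M. norm (h t * \<theta> t) \<le> norm (of_real B * \<theta> t)"
  proof (rule AE_I2)
    fix t
    have "cmod (h t) \<le> \<bar>B\<bar>" by (rule order_trans[OF b abs_ge_self])
    then show "norm (h t * \<theta> t) \<le> norm (of_real B * \<theta> t)"
      unfolding norm_mult norm_of_real by (rule mult_right_mono) simp
  qed
  show "(\<lambda>t. h t * \<theta> t) \<in> borel_measurable M" by measurable
qed

text \<open>Domination by a product of integrable functions of one variable, the form in which most
  exchanges of integrals below are justified.\<close>

lemma (in pair_sigma_finite) integrable_pair_bound: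
  fixes k :: "'a \<Rightarrow> 'b \<Rightarrow> complex" and f :: "'a \<Rightarrow> complex" and g :: "'b \<Rightarrow> complex"
  assumes f: "integrable M1 f" and g: "integrable M2 g"
    and [measurable]: "case_prod k \<in> borel_measurable (M1 \<Otimes>\<^sub>M M2)"
    and le: "\<And>s x. s \<in> space M1 \<Longrightarrow> x \<in> space M2 \<Longrightarrow> cmod (k s x) \<le> cmod (f s) * cmod (g x)"
  shows "integrable (M1 \<Otimes>\<^sub>M M2) (case_prod k)"
proof -
  have [measurable]: "f \<in> borel_measurable M1" "g \<in> borel_measurable M2"
    using f g by auto
  have "integrable (M1 \<Otimes>\<^sub>M M2) (\<lambda>(s, x). f s * g x)"
  proof (rule Fubini_integrable)
    show "integrable M1 (\<lambda>s. LINT x|M2. norm (case (s, x) of (s, x) \<Rightarrow> f s * g x))"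
      using f by (simp add: norm_mult)
    show "AE s in M1. integrable M2 (\<lambda>x. case (s, x) of (s, x) \<Rightarrow> f s * g x)"
      using g by simp
  qed measurable
  then show ?thesis
    by (rule Bochner_Integration.integrable_bound)
       (auto simp: norm_mult space_pair_measure intro!: AE_I2 le)
qed

section \<open>Multiplication formula, Gaussian summation and inversion\<close>

lemma fourier_integral_multiplication:
  assumes f: "integrable lborel f" and g: "integrable lborel g"
  shows "(LINT x|lborel. fourier_integral f x * g x) = (LINT x|lborel. f x * fourier_integral g x)"
proof -
  have [measurable]: "f \<in> borel_measurable borel" "g \<in> borel_measurable borel"
    using f g by auto
  let ?k = "\<lambda>s x. f s * g x * cis (- (2 * pi * s * x))"
  have i: "integrable (lborel \<Otimes>\<^sub>M lborel) (\<lambda>(s, x). ?k s x)"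
    by (rule lborel_pair.integrable_pair_bound[OF f g]) (auto simp: norm_mult)
  have "(LINT x|lborel. fourier_integral f x * g x) = (LINT x|lborel. LINT s|lborel. ?k s x)"
    unfolding fourier_integral_def
    by (intro Bochner_Integration.integral_cong refl) (subst integral_mult_left_zero[symmetric], simp add: mult_ac)
  also have "\<dots> = (LINT s|lborel. LINT x|lborel. ?k s x)"
    by (rule lborel_pair.Fubini_integral[OF i])
  also have "\<dots> = (LINT s|lborel. f s * fourier_integral g s)"
    unfolding fourier_integral_def
    by (intro Bochner_Integration.integral_cong refl) (subst integral_mult_right_zero[symmetric], simp add: mult_ac)
  finally show ?thesis .
qed

text \<open>The characteristic function of the standard normal law after the substitution
  \<open>z = 2 * pi * \<sigma> * x\<close>. The Gaussian is parametrised so that its transform is a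
  probability density of standard deviation \<open>\<sigma>\<close>.\<close>

lemma integral_cis_gaussian:
  assumes "0 < \<sigma>"
  shows "(LINT x|lborel. cis (2 * pi * x * u) * of_real (exp (- (2 * pi * \<sigma> * x)\<^sup>2 / 2))) =
     of_real (normal_density 0 \<sigma> u)"
    "integrable lborel (\<lambda>x. of_real (exp (- (2 * pi * \<sigma> * x)\<^sup>2 / 2)) :: complex)"
proof -
  have s: "exp (- z\<^sup>2 / 2) = sqrt (2 * pi) * std_normal_density z" for z
    by (simp add: std_normal_density_def)
  have "(LINT z|lborel. std_normal_density z *\<^sub>R cis (u / \<sigma> * z)) = of_real (exp (- (u / \<sigma>)\<^sup>2 / 2))"
    using fun_cong[OF char_std_normal_distribution, of "u / \<sigma>"]
    by (simp add: char_def integral_density cis_conv_exp)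
  moreover have "cis (u / \<sigma> * z) * of_real (exp (- z\<^sup>2 / 2)) =
      of_real (sqrt (2 * pi)) * (std_normal_density z *\<^sub>R cis (u / \<sigma> * z))" for z
    unfolding s by (simp add: scaleR_conv_of_real mult_ac)
  ultimately have *: "(LINT z|lborel. cis (u / \<sigma> * z) * of_real (exp (- z\<^sup>2 / 2))) =
      of_real (sqrt (2 * pi) * exp (- (u / \<sigma>)\<^sup>2 / 2))"
    by (simp only: integral_mult_right_zero of_real_mult)
  have "(LINT z|lborel. cis (u / \<sigma> * z) * of_real (exp (- z\<^sup>2 / 2)))
     = \<bar>2 * pi * \<sigma>\<bar> *\<^sub>R (LINT x|lborel. cis (2 * pi * x * u) * of_real (exp (- (2 * pi * \<sigma> * x)\<^sup>2 / 2)))"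
    using assms lborel_integral_real_affine[of "2 * pi * \<sigma>" "\<lambda>z. cis (u / \<sigma> * z) * of_real (exp (- z\<^sup>2 / 2))" 0]
    by (simp add: mult_ac)
  with * have "(LINT x|lborel. cis (2 * pi * x * u) * of_real (exp (- (2 * pi * \<sigma> * x)\<^sup>2 / 2))) =
     of_real (sqrt (2 * pi) * exp (- (u / \<sigma>)\<^sup>2 / 2) / (2 * pi * \<sigma>))"
    using assms by (simp add: scaleR_conv_of_real field_simps)
  also have "sqrt (2 * pi) * exp (- (u / \<sigma>)\<^sup>2 / 2) / (2 * pi * \<sigma>) = normal_density 0 \<sigma> u"
    using assms by (simp add: normal_density_def real_sqrt_mult field_simps power2_eq_square)
  finally show "(LINT x|lborel. cis (2 * pi * x * u) * of_real (exp (- (2 * pi * \<sigma> * x)\<^sup>2 / 2))) =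
     of_real (normal_density 0 \<sigma> u)" .
  have "integrable lborel (\<lambda>x. sqrt (2 * pi) * std_normal_density (0 + 2 * pi * \<sigma> * x))"
    using assms by (intro integrable_mult_right lborel_integrable_real_affine) auto
  then show "integrable lborel (\<lambda>x. of_real (exp (- (2 * pi * \<sigma> * x)\<^sup>2 / 2)) :: complex)"
    unfolding s by (simp only: integrable_of_real add_0)
qed

text \<open>Substituting \<open>x = t + \<sigma> n * z\<close> moves the shrinking width into the
  argument of \<open>f\<close>; continuity at \<open>t\<close> and domination by the standard normal
  density then give the limit.\<close>

lemma tendsto_integral_normal_density:
  fixes f :: "real \<Rightarrow> complex"
  assumes [measurable]: "f \<in> borel_measurable borel" and b: "\<And>x. cmod (f x) \<le> B" and "isCont f t"
    and s: "\<sigma> \<longlonglongrightarrow> 0" "\<And>n. 0 < \<sigma> n"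
  shows "(\<lambda>n. LINT x|lborel. f x * of_real (normal_density t (\<sigma> n) x)) \<longlonglongrightarrow> f t"
proof -
  have "(LINT x|lborel. f x * of_real (normal_density t (\<sigma> n) x)) =
      (LINT z|lborel. f (t + \<sigma> n * z) * of_real (std_normal_density z))" for n
  proof -
    have "(LINT x|lborel. f x * of_real (normal_density t (\<sigma> n) x)) =
       (LINT z|lborel. \<sigma> n *\<^sub>R (f (t + \<sigma> n * z) * of_real (normal_density t (\<sigma> n) (t + \<sigma> n * z))))"
      using s(2)[of n] by (subst lborel_integral_real_affine[of "\<sigma> n" _ t]) auto
    also have "\<dots> = (LINT z|lborel. f (t + \<sigma> n * z) * of_real (std_normal_density z))"
    proof (intro Bochner_Integration.integral_cong refl)
      fix z
      have "\<sigma> n * normal_density t (\<sigma> n) (t + \<sigma> n * z) = std_normal_density z"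
        using s(2)[of n] by (simp add: normal_density_def power_mult_distrib real_sqrt_mult)
      from arg_cong[OF this, of complex_of_real]
      show "\<sigma> n *\<^sub>R (f (t + \<sigma> n * z) * of_real (normal_density t (\<sigma> n) (t + \<sigma> n * z))) =
          f (t + \<sigma> n * z) * of_real (std_normal_density z)"
        by (simp add: scaleR_conv_of_real mult_ac del: of_real_mult flip: of_real_mult)
    qed
    finally show ?thesis .
  qed
  moreover have "(\<lambda>n. LINT z|lborel. f (t + \<sigma> n * z) * of_real (std_normal_density z)) \<longlonglongrightarrow>
      (LINT z|lborel. f t * of_real (std_normal_density z))"
  proof (rule integral_dominated_convergence[where w = "\<lambda>z. B * std_normal_density z"])
    show "AE z in lborel. (\<lambda>n. f (t + \<sigma> n * z) * of_real (std_normal_density z))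
        \<longlonglongrightarrow> f t * of_real (std_normal_density z)"
    proof (intro AE_I2 tendsto_intros isCont_tendsto_compose[OF \<open>isCont f t\<close>])
      show "(\<lambda>n. t + \<sigma> n * z) \<longlonglongrightarrow> t" for z
        using tendsto_add[OF tendsto_const tendsto_mult_left_zero[OF s(1), of z], of t] by simp
    qed
    show "AE z in lborel. norm (f (t + \<sigma> n * z) * of_real (std_normal_density z)) \<le> B * std_normal_density z" for n
      using b by (auto simp: norm_mult intro!: mult_right_mono)
  qed auto
  ultimately show ?thesis by simp
qed

text \<open>By the multiplication formula the inversion integral damped by a Gaussian is the mean of
  \<open>f\<close> against a normal density centred at \<open>t\<close>. As the width tends to 0 the
  mean tends to \<open>f t\<close>, and integrability of the transform lets the damping be
  removed.\<close>

lemma fourier_inversion: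
  assumes f: "integrable lborel f" and b: "\<And>x. cmod (f x) \<le> B" and c: "isCont f t"
    and i: "integrable lborel (fourier_integral f)"
  shows "(LINT x|lborel. fourier_integral f x * cis (2 * pi * x * t)) = f t"
proof -
  define \<sigma> where "\<sigma> = (\<lambda>n::nat. 1 / real (Suc n))"
  have s: "\<sigma> \<longlonglongrightarrow> 0" "\<And>n. 0 < \<sigma> n"
    unfolding \<sigma>_def by (rule LIMSEQ_Suc[OF lim_1_over_n]) simp
  let ?G = "\<lambda>n x. of_real (exp (- (2 * pi * \<sigma> n * x)\<^sup>2 / 2)) :: complex"
  have [measurable]: "f \<in> borel_measurable borel" using f by auto
  have "(LINT x|lborel. fourier_integral f x * (?G n x * cis (2 * pi * x * t))) =
      (LINT x|lborel. f x * of_real (normal_density t (\<sigma> n) x))" for n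
  proof (subst fourier_integral_multiplication[OF f])
    show "integrable lborel (\<lambda>x. ?G n x * cis (2 * pi * x * t))"
      by (intro integrable_mult_cis integral_cis_gaussian s) auto
    have "fourier_integral (\<lambda>x. ?G n x * cis (2 * pi * x * t)) x = of_real (normal_density t (\<sigma> n) x)" for x
    proof -
      have "fourier_integral (\<lambda>x. ?G n x * cis (2 * pi * x * t)) x =
         (LINT s|lborel. cis (2 * pi * s * (t - x)) * ?G n s)"
        unfolding fourier_integral_def
        by (intro Bochner_Integration.integral_cong refl) (simp add: mult_ac cis_mult, simp add: algebra_simps)
      also have "\<dots> = of_real (normal_density 0 (\<sigma> n) (t - x))"
        by (rule integral_cis_gaussian(1)[OF s(2)])
      also have "normal_density 0 (\<sigma> n) (t - x) = normal_density t (\<sigma> n) x"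
        by (simp add: normal_density_def power2_commute)
      finally show ?thesis .
    qed
    then show "(LINT x|lborel. f x * fourier_integral (\<lambda>x. ?G n x * cis (2 * pi * x * t)) x) =
        (LINT x|lborel. f x * of_real (normal_density t (\<sigma> n) x))" by simp
  qed
  then have "(\<lambda>n. LINT x|lborel. fourier_integral f x * (?G n x * cis (2 * pi * x * t))) \<longlonglongrightarrow> f t"
    using tendsto_integral_normal_density[OF _ b c s] by simp
  moreover have "(\<lambda>n. LINT x|lborel. fourier_integral f x * (?G n x * cis (2 * pi * x * t))) \<longlonglongrightarrow>
      (LINT x|lborel. fourier_integral f x * cis (2 * pi * x * t))"
  proof (rule integral_dominated_convergence[where w = "\<lambda>x. cmod (fourier_integral f x)"])
    show "AE x in lborel. (\<lambda>n. fourier_integral f x * (?G n x * cis (2 * pi * x * t)))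
        \<longlonglongrightarrow> fourier_integral f x * cis (2 * pi * x * t)"
    proof (rule AE_I2)
      fix x
      have "(\<lambda>n. exp (- (2 * pi * \<sigma> n * x)\<^sup>2 / 2)) \<longlonglongrightarrow> exp (- (2 * pi * 0 * x)\<^sup>2 / 2)"
        by (intro tendsto_intros s) auto
      from tendsto_of_real[OF this, where 'a = complex]
      have "(\<lambda>n. fourier_integral f x * (?G n x * cis (2 * pi * x * t)))
        \<longlonglongrightarrow> fourier_integral f x * (1 * cis (2 * pi * x * t))"
        by (intro tendsto_intros) simp
      then show "(\<lambda>n. fourier_integral f x * (?G n x * cis (2 * pi * x * t)))
        \<longlonglongrightarrow> fourier_integral f x * cis (2 * pi * x * t)" by simp
    qed
  qed (use i in \<open>auto simp: norm_mult mult_left_le\<close>)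
  ultimately show ?thesis by (rule LIMSEQ_unique[rotated])
qed

text \<open>Levy's uniqueness theorem speaks of probability measures, so \<open>F\<close> is split
  into its positive and negative parts. Frequency 0 gives both the same mass \<open>m\<close>; if
  \<open>m > 0\<close>, the normalised parts have equal characteristic functions and hence equal
  densities almost everywhere.\<close>

lemma fourier_uniqueness_real:
  fixes F :: "real \<Rightarrow> real"
  assumes F: "integrable lborel F" and z: "\<And>\<xi>. (LINT x|lborel. of_real (F x) * cis (\<xi> * x)) = 0"
  shows "AE x in lborel. F x = 0"
proof -
  have [measurable]: "F \<in> borel_measurable borel" using F by auto
  let ?P = "\<lambda>x. max 0 (F x)" and ?N = "\<lambda>x. max 0 (- F x)"
  have i: "integrable lborel ?P" "integrable lborel ?N"
    using F by (auto intro!: Bochner_Integration.integrable_max)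
  have eq: "(LINT x|lborel. of_real (?P x) * cis (\<xi> * x)) = (LINT x|lborel. of_real (?N x) * cis (\<xi> * x))" for \<xi>
  proof -
    have "(LINT x|lborel. of_real (?P x) * cis (\<xi> * x)) - (LINT x|lborel. of_real (?N x) * cis (\<xi> * x))
       = (LINT x|lborel. of_real (?P x) * cis (\<xi> * x) - of_real (?N x) * cis (\<xi> * x))"
      using i by (intro Bochner_Integration.integral_diff[symmetric] integrable_mult_cis) (auto simp: integrable_of_real)
    also have "\<dots> = (LINT x|lborel. of_real (F x) * cis (\<xi> * x))"
      by (intro Bochner_Integration.integral_cong refl) (auto simp: max_def)
    finally show ?thesis using z by simp
  qed
  define m where "m = (LINT x|lborel. ?P x)"
  have m: "m = (LINT x|lborel. ?N x)" "0 \<le> m"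
    using eq[of 0] unfolding m_def by simp_all
  show ?thesis
  proof (cases "m = 0")
    case True
    then have "AE x in lborel. ?P x = 0"
      using i unfolding m_def by (subst (asm) integral_nonneg_eq_0_iff_AE) simp_all
    moreover have "AE x in lborel. ?N x = 0"
      using True m(1) i by (subst (asm) m(1), subst (asm) integral_nonneg_eq_0_iff_AE) simp_all
    ultimately show ?thesis by eventually_elim (simp add: max_def split: if_splits)
  next
    case False
    then have "m > 0" using m(2) by linarith
    define M1 where "M1 = density lborel (\<lambda>x. ennreal (?P x / m))"
    define M2 where "M2 = density lborel (\<lambda>x. ennreal (?N x / m))"
    have d: "real_distribution M1" "real_distribution M2"
      unfolding M1_def M2_def using \<open>m > 0\<close> i m(1) m_def
      by (auto intro!: real_distribution.intro prob_spaceI real_distribution_axioms.intro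
          simp: emeasure_density nn_integral_eq_integral)
    have "char M1 = char M2"
    proof
      fix \<xi>
      have "char M1 \<xi> = (LINT x|lborel. of_real (?P x) * cis (\<xi> * x)) / m"
        unfolding char_def M1_def using \<open>m > 0\<close>
        by (subst integral_density) (auto simp: scaleR_conv_of_real cis_conv_exp)
      moreover have "char M2 \<xi> = (LINT x|lborel. of_real (?N x) * cis (\<xi> * x)) / m"
        unfolding char_def M2_def using \<open>m > 0\<close>
        by (subst integral_density) (auto simp: scaleR_conv_of_real cis_conv_exp)
      ultimately show "char M1 \<xi> = char M2 \<xi>" using eq by simp
    qed
    then have "M1 = M2" by (rule Levy_uniqueness[OF d])
    then have "AE x in lborel. ennreal (?P x / m) = ennreal (?N x / m)"
      unfolding M1_def M2_def by (intro sigma_finite_measure.density_unique[OF lborel.sigma_finite_measure_axioms]) auto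
    then show ?thesis
    proof eventually_elim
      case (elim x)
      then show ?case using \<open>m > 0\<close> by (simp add: ennreal_inj max_def split: if_splits)
    qed
  qed
qed

text \<open>The hypothesis at \<open>- \<xi>\<close>, conjugated, is the hypothesis for
  \<open>cnj (F x)\<close>; combining both reduces the claim to the real and the imaginary
  part.\<close>

lemma fourier_uniqueness:
  fixes F :: "real \<Rightarrow> complex"
  assumes F: "integrable lborel F" and z: "\<And>\<xi>. (LINT x|lborel. F x * cis (\<xi> * x)) = 0"
  shows "AE x in lborel. F x = 0"
proof -
  have [measurable]: "F \<in> borel_measurable borel" using F by auto
  have z': "(LINT x|lborel. cnj (F x) * cis (\<xi> * x)) = 0" for \<xi>
  proof -
    have "(LINT x|lborel. cnj (F x) * cis (\<xi> * x)) = (LINT x|lborel. cnj (F x * cis (- \<xi> * x)))"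
      by (simp add: cis_cnj)
    also have "\<dots> = 0" using z[of "- \<xi>"] by (simp only: Bochner_Integration.integral_cnj complex_cnj_zero)
    finally show ?thesis .
  qed
  have i: "integrable lborel (\<lambda>x. F x * cis (\<xi> * x))" "integrable lborel (\<lambda>x. cnj (F x) * cis (\<xi> * x))" for \<xi>
    using F by (auto intro!: integrable_mult_cis)
  have "AE x in lborel. Re (F x) = 0"
  proof (rule fourier_uniqueness_real)
    fix \<xi>
    have "(LINT x|lborel. of_real (Re (F x)) * cis (\<xi> * x)) =
        (LINT x|lborel. (F x * cis (\<xi> * x) + cnj (F x) * cis (\<xi> * x)) / 2)"
      by (intro Bochner_Integration.integral_cong refl) (simp flip: distrib_right add: complex_add_cnj)
    also have "\<dots> = 0" using i z z' by simp
    finally show "(LINT x|lborel. of_real (Re (F x)) * cis (\<xi> * x)) = 0" .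
  qed (use F in simp)
  moreover have "AE x in lborel. Im (F x) = 0"
  proof (rule fourier_uniqueness_real)
    fix \<xi>
    have "(LINT x|lborel. of_real (Im (F x)) * cis (\<xi> * x)) =
        (LINT x|lborel. (F x * cis (\<xi> * x) - cnj (F x) * cis (\<xi> * x)) / (2 * \<i>))"
    proof (intro Bochner_Integration.integral_cong refl)
      fix x
      have "F x * cis (\<xi> * x) - cnj (F x) * cis (\<xi> * x) = 2 * \<i> * (of_real (Im (F x)) * cis (\<xi> * x))"
        unfolding left_diff_distrib[symmetric] complex_diff_cnj by (simp add: mult_ac)
      then show "of_real (Im (F x)) * cis (\<xi> * x) =
          (F x * cis (\<xi> * x) - cnj (F x) * cis (\<xi> * x)) / (2 * \<i>)" by simp
    qed
    also have "\<dots> = 0" using i z z' by simp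
    finally show "(LINT x|lborel. of_real (Im (F x)) * cis (\<xi> * x)) = 0" .
  qed (use F in simp)
  ultimately show ?thesis by eventually_elim (simp add: complex_eq_iff)
qed

section \<open>Distributional transforms of integrable functions\<close>

lemma schwartz_regular:
  assumes "schwartz \<phi>"
  shows "integrable lborel \<phi>" "\<phi> \<in> borel_measurable borel" "isCont \<phi> t"
    "\<exists>B. \<forall>x. cmod (\<phi> x) \<le> B"
proof -
  obtain D where D: "D 0 = \<phi>" "\<And>n x. (D n has_vector_derivative D (Suc n) x) (at x)"
    "\<And>n m. bounded (range (\<lambda>x. x ^ m *\<^sub>R D n x))"
    "\<And>n. continuous_on UNIV (D n)" "\<And>n. D n \<in> borel_measurable borel"
    "\<And>n. integrable lborel (D n)"
    using schwartzE[OF assms] by blast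
  show "integrable lborel \<phi>" "\<phi> \<in> borel_measurable borel" "isCont \<phi> t"
    using D(4)[of 0] D(5)[of 0] D(6)[of 0] D(1) by (auto simp: continuous_on_eq_continuous_at)
  show "\<exists>B. \<forall>x. cmod (\<phi> x) \<le> B"
    using D(3)[of 0 0] D(1) by (auto simp: bounded_iff)
qed

lemma is_fourier_of_fourier_integral:
  assumes h: "integrable lborel h"
  shows "is_fourier_of (fourier_integral h) h"
  unfolding is_fourier_of_def
proof (intro allI impI conjI)
  fix \<phi> :: "real \<Rightarrow> complex" assume \<phi>: "schwartz \<phi>"
  have [measurable]: "h \<in> borel_measurable borel" using h by auto
  have p: "integrable lborel \<phi>" and [measurable]: "\<phi> \<in> borel_measurable borel"
    using schwartz_regular[OF \<phi>] by auto
  show "integrable lborel (\<lambda>x. fourier_integral h x * \<phi> x)"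
    by (rule Bochner_Integration.integrable_bound[OF integrable_mult_right[OF p, of "of_real (LINT x|lborel. cmod (h x))"]])
       (auto simp: norm_mult intro!: mult_right_mono order_trans[OF norm_fourier_integral_le])
  show "integrable lborel (\<lambda>x. h x * fourier_integral \<phi> x)"
    by (rule Bochner_Integration.integrable_bound[OF integrable_mult_left[OF h, of "of_real (LINT x|lborel. cmod (\<phi> x))"]])
       (auto simp: norm_mult intro!: mult_left_mono order_trans[OF norm_fourier_integral_le])
  show "(LINT x|lborel. fourier_integral h x * \<phi> x) = (LINT x|lborel. h x * fourier_integral \<phi> x)"
    by (rule fourier_integral_multiplication[OF h p])
qed

text \<open>About \<open>k\<close> it is only known that products with Schwartz functions are
  integrable. The difference is therefore multiplied by a Gaussian first; pairing with Gaussians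
  times characters shows that this product has zero transform at all frequencies.\<close>

lemma is_fourier_of_unique:
  assumes h: "integrable lborel h" and k: "is_fourier_of k h"
  shows "AE x in lborel. k x = fourier_integral h x"
proof -
  let ?e = "\<lambda>\<xi> x. exp (- (complex_of_real x)\<^sup>2 / 2 + \<i> * of_real (\<xi> * x))"
  let ?F = "\<lambda>x. (k x - fourier_integral h x) * ?e 0 x"
  have i: "integrable lborel (\<lambda>x. k x * ?e \<xi> x)" "integrable lborel (\<lambda>x. fourier_integral h x * ?e \<xi> x)"
     "(LINT x|lborel. k x * ?e \<xi> x) = (LINT x|lborel. fourier_integral h x * ?e \<xi> x)" for \<xi>
    using k is_fourier_of_fourier_integral[OF h] schwartz_gaussian_char[of \<xi>]
    unfolding is_fourier_of_def by auto
  have "AE x in lborel. ?F x = 0"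
  proof (rule fourier_uniqueness)
    show "integrable lborel ?F"
      using i(1,2)[of 0] unfolding left_diff_distrib by (rule Bochner_Integration.integrable_diff)
    fix \<xi>
    have "?F x * cis (\<xi> * x) = k x * ?e \<xi> x - fourier_integral h x * ?e \<xi> x" for x
    proof -
      have "?e \<xi> x = ?e 0 x * cis (\<xi> * x)"
        unfolding cis_conv_exp exp_add[symmetric] by simp
      then show ?thesis by (simp only: left_diff_distrib mult.assoc)
    qed
    then show "(LINT x|lborel. ?F x * cis (\<xi> * x)) = 0"
      using i[of \<xi>] by simp
  qed
  then show ?thesis by eventually_elim simp
qed

text \<open>\<open>fourier_integral h\<close> witnesses that the choice in \<open>fourier\<close>
  succeeds, and uniqueness pins the chosen function down up to a null set, which
  \<open>Lp_norm\<close> does not see.\<close>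

lemma fourier_eq_fourier_integral:
  assumes h: "integrable lborel h"
  shows "fourier h \<in> borel_measurable borel" "AE x in lborel. fourier h x = fourier_integral h x"
proof -
  have [measurable]: "h \<in> borel_measurable borel" using h by auto
  have "fourier_integral h \<in> borel_measurable borel \<and> is_fourier_of (fourier_integral h) h"
    using is_fourier_of_fourier_integral[OF h] by simp
  then have "fourier h \<in> borel_measurable borel \<and> is_fourier_of (fourier h) h"
    unfolding fourier_def by (rule someI[where P = "\<lambda>k. k \<in> borel_measurable borel \<and> is_fourier_of k h"])
  then show "fourier h \<in> borel_measurable borel" "AE x in lborel. fourier h x = fourier_integral h x"
    using is_fourier_of_unique[OF h] by auto
qed

text \<open>This provides the preimage demanded by \<open>Lhat_space\<close>. Inversion is applied
  to the Schwartz function alone, since \<open>h\<close> may jump, as \<open>step_test\<close> does,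
  and then its transform need not be integrable.\<close>

lemma is_fourier_of_inverse:
  assumes h: "integrable lborel h" and [measurable]: "h \<in> borel_measurable borel" and b: "\<And>x. cmod (h x) \<le> M"
  shows "is_fourier_of h (\<lambda>x. fourier_integral h (- x))"
  unfolding is_fourier_of_def
proof (intro allI impI conjI)
  fix \<phi> :: "real \<Rightarrow> complex" assume \<phi>: "schwartz \<phi>"
  have p: "integrable lborel \<phi>" and c: "isCont \<phi> t" and [measurable]: "\<phi> \<in> borel_measurable borel" for t
    using schwartz_regular[OF \<phi>] by auto
  obtain B where B: "\<And>x. cmod (\<phi> x) \<le> B"
    using schwartz_regular(4)[OF \<phi>] by blast
  have F: "integrable lborel (fourier_integral \<phi>)"
    by (rule integrable_fourier_integral_schwartz[OF \<phi>])
  have F': "integrable lborel (\<lambda>x. fourier_integral \<phi> (- x))"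
    using lborel_integrable_real_affine[OF F, of "-1" 0] by simp
  have inv: "fourier_integral (\<lambda>x. fourier_integral \<phi> (- x)) t = \<phi> t" for t
  proof -
    have "fourier_integral (\<lambda>x. fourier_integral \<phi> (- x)) t =
        (LINT x|lborel. fourier_integral \<phi> x * cis (2 * pi * x * t))"
      unfolding fourier_integral_def[of "\<lambda>x. fourier_integral \<phi> (- x)"]
      by (subst lborel_integral_real_affine[of "-1" _ 0]) simp_all
    also have "\<dots> = \<phi> t"
      by (rule fourier_inversion[OF p B c F])
    finally show ?thesis .
  qed
  show "integrable lborel (\<lambda>x. h x * \<phi> x)"
    by (rule Bochner_Integration.integrable_bound[OF integrable_mult_right[OF p, of "of_real M"]])
       (auto simp: norm_mult intro!: mult_right_mono order_trans[OF b])
  show "integrable lborel (\<lambda>x. fourier_integral h (- x) * fourier_integral \<phi> x)"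
    by (rule Bochner_Integration.integrable_bound[OF integrable_mult_right[OF F, of "of_real (LINT x|lborel. cmod (h x))"]])
       (auto simp: norm_mult intro!: mult_right_mono order_trans[OF norm_fourier_integral_le])
  have "(LINT x|lborel. fourier_integral h (- x) * fourier_integral \<phi> x) =
      (LINT x|lborel. fourier_integral h x * fourier_integral \<phi> (- x))"
    by (subst lborel_integral_real_affine[of "-1" _ 0]) simp_all
  also have "\<dots> = (LINT x|lborel. h x * \<phi> x)"
    by (simp add: fourier_integral_multiplication[OF h F'] inv)
  finally show "(LINT x|lborel. h x * \<phi> x) =
      (LINT x|lborel. fourier_integral h (- x) * fourier_integral \<phi> x)" by simp
qed

section \<open>Test functions for the dual norm\<close>

lemma exponent_cases [consumes 1, case_names infinite finite]:
  assumes "1 < (p :: ennreal)"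
  obtains "p = \<infinity>" | r where "1 < r" "p = ennreal r"
  using assms by (cases p) auto

lemma conj_exp_ennreal: "1 < r \<Longrightarrow> conj_exp (ennreal r) = ennreal (r / (r - 1))"
  unfolding conj_exp_def
  by (subst ennreal_1[symmetric], subst inverse_ennreal, simp, subst ennreal_minus, simp,
      subst inverse_ennreal) (auto simp: field_simps)

lemma conj_exp_bounds:
  assumes "1 < p"
  shows "1 \<le> conj_exp p" "conj_exp p < \<infinity>"
  using assms
proof (atomize (full), cases p rule: exponent_cases)
  case infinite
  then show "1 \<le> conj_exp p \<and> conj_exp p < \<infinity>" by (simp add: conj_exp_def)
next
  case (finite r)
  then have "1 < ennreal (r / (r - 1))" by (simp add: less_divide_eq)
  then show "1 \<le> conj_exp p \<and> conj_exp p < \<infinity>"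
    unfolding finite(2) conj_exp_ennreal[OF finite(1)] by (simp add: less_imp_le)
qed

lemma conj_exp_conj_exp:
  assumes "1 < p"
  shows "conj_exp (conj_exp p) = p"
  using assms
proof (cases p rule: exponent_cases)
  case infinite
  then show ?thesis by (simp add: conj_exp_def)
next
  case (finite r)
  then have "1 < r / (r - 1)" "r / (r - 1) / (r / (r - 1) - 1) = r" by (simp_all add: field_simps)
  then show ?thesis
    unfolding finite(2) conj_exp_ennreal[OF finite(1)] by (simp add: conj_exp_ennreal)
qed

text \<open>Boundedness reduces the power \<open>r\<close> of the modulus to the first power, at the
  price of a factor \<open>M powr (r - 1)\<close>.\<close>

lemma Lp_space_bounded_integrable:
  assumes [measurable]: "h \<in> borel_measurable borel" and i: "integrable lborel h"
    and b: "\<And>x. cmod (h x) \<le> M" and q: "1 \<le> q" "q < \<infinity>"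
  shows "h \<in> Lp_space q"
proof -
  define r where "r = enn2real q"
  have r: "1 \<le> r" using enn2real_mono[of 1 q] q by (simp add: r_def)
  have le: "cmod (h x) powr r \<le> M powr (r - 1) * cmod (h x)" for x
  proof -
    have "cmod (h x) powr r = cmod (h x) powr (r - 1) * cmod (h x)"
      by (cases "h x = 0") (simp_all add: powr_diff)
    also have "\<dots> \<le> M powr (r - 1) * cmod (h x)"
      using r b[of x] by (intro mult_right_mono powr_mono2) auto
    finally show ?thesis .
  qed
  have "(\<integral>\<^sup>+x. ennreal (cmod (h x) powr r) \<partial>lborel) \<le> (\<integral>\<^sup>+x. ennreal (M powr (r - 1) * cmod (h x)) \<partial>lborel)"
    by (intro nn_integral_mono ennreal_leI le)
  also have "\<dots> = ennreal (LINT x|lborel. M powr (r - 1) * cmod (h x))"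
    using i by (intro nn_integral_eq_integral) auto
  finally have "(\<integral>\<^sup>+x. ennreal (cmod (h x) powr r) \<partial>lborel) \<noteq> \<infinity>"
    by (auto simp: top_unique)
  then show ?thesis
    using q by (auto simp: Lp_space_def Lp_norm_def r_def[symmetric] Let_def)
qed

lemma nn_integral_powr_decay:
  assumes "0 < b" "1 < r"
  shows "(\<integral>\<^sup>+y. ennreal ((b + \<bar>y\<bar>) powr - r) \<partial>lborel) \<le> ennreal (2 * b powr (1 - r) / (r - 1))"
proof -
  let ?f = "\<lambda>y. (b + y) powr - r"
  have half: "(\<integral>\<^sup>+y. ennreal (?f y) * indicator {0..} y \<partial>lborel) = ennreal (0 - (- ((b + 0) powr (1 - r)) / (r - 1)))"
  proof (rule nn_integral_FTC_atLeast)
    show "((\<lambda>y. - ((b + y) powr (1 - r)) / (r - 1)) \<longlongrightarrow> 0) at_top"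
      using assms by real_asymp
    show "((\<lambda>y. - ((b + y) powr (1 - r)) / (r - 1)) has_real_derivative ?f y) (at y)" if "0 \<le> y" for y
    proof -
      have "((\<lambda>y. (b + y) powr (1 - r)) has_real_derivative (1 - r) * (b + y) powr (1 - r - 1) * 1) (at y)"
        using assms that by (auto intro!: derivative_eq_intros)
      then have "((\<lambda>y. - ((b + y) powr (1 - r)) / (r - 1)) has_real_derivative
          - ((1 - r) * (b + y) powr (1 - r - 1) * 1) / (r - 1)) (at y)"
        by (intro DERIV_cdivide DERIV_minus)
      also have "- ((1 - r) * (b + y) powr (1 - r - 1) * 1) / (r - 1) = (r - 1) * ?f y / (r - 1)"
        by (simp add: algebra_simps)
      also have "\<dots> = ?f y" using assms by simp
      finally show ?thesis .
    qed
  qed auto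
  have "(\<integral>\<^sup>+y. ennreal (?f (- y)) * indicator {..0} y \<partial>lborel) = (\<integral>\<^sup>+y. ennreal (?f y) * indicator {0..} y \<partial>lborel)"
    by (subst nn_integral_real_affine[where c = "-1" and t = 0]) (auto simp: indicator_def intro!: nn_integral_cong)
  moreover have "(\<integral>\<^sup>+y. ennreal ((b + \<bar>y\<bar>) powr - r) \<partial>lborel) \<le>
      (\<integral>\<^sup>+y. ennreal (?f y) * indicator {0..} y + ennreal (?f (- y)) * indicator {..0} y \<partial>lborel)"
    by (intro nn_integral_mono) (auto simp: indicator_def)
  ultimately have "(\<integral>\<^sup>+y. ennreal ((b + \<bar>y\<bar>) powr - r) \<partial>lborel) \<le>
      ennreal (b powr (1 - r) / (r - 1)) + ennreal (b powr (1 - r) / (r - 1))"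
    using half by (simp add: nn_integral_add)
  also have "\<dots> = ennreal (2 * b powr (1 - r) / (r - 1))"
    using assms by (simp flip: ennreal_plus)
  finally show ?thesis .
qed

text \<open>\<open>decay_const p * a powr (1 - 1 / p)\<close> bounds the \<open>L\<^sup>p\<close> norm of \<open>1 / (1 / a + \<bar>y\<bar>)\<close>.\<close>

definition decay_const :: "ennreal \<Rightarrow> real" where
  "decay_const p = (if p = \<infinity> then 1 else (2 / (enn2real p - 1)) powr (1 / enn2real p))"

lemma decay_const_pos: "1 < p \<Longrightarrow> 0 < decay_const p"
  by (cases p rule: exponent_cases) (auto simp: decay_const_def)

text \<open>For \<open>p = \<infinity>\<close> the majorant is largest at \<open>y = 0\<close>, with
  value \<open>K * a\<close>. For finite \<open>p = r\<close> the integral of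
  \<open>(1 / a + |y|) powr - r\<close> is at most \<open>2 / (r - 1) * a powr (r - 1)\<close>,
  whose r-th root gives both \<open>decay_const p\<close> and the exponent
  \<open>1 - 1 / r\<close>.\<close>

lemma Lp_norm_decay:
  assumes p: "1 < p" and "0 < a" "0 \<le> K" and [measurable]: "g \<in> borel_measurable borel"
    and le: "AE y in lborel. cmod (g y) \<le> K / (1 / a + \<bar>y\<bar>)"
  shows "Lp_norm p g \<le> ennreal (K * decay_const p * a powr (1 - enn2real (inverse p)))"
proof (cases "p = \<infinity>")
  case True
  have "K / (1 / a + \<bar>y\<bar>) \<le> K * a" for y
  proof -
    have "K / (1 / a + \<bar>y\<bar>) \<le> K / (1 / a)"
      using assms by (intro divide_left_mono mult_pos_pos add_pos_nonneg) auto
    then show ?thesis by simp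
  qed
  with le have "AE y in lborel. ennreal (cmod (g y)) \<le> ennreal (K * a)"
    by (auto elim!: eventually_mono intro!: ennreal_leI intro: order_trans)
  then show ?thesis
    using True assms by (auto simp: Lp_norm_def decay_const_def intro!: esssup_I)
next
  case False
  define r where "r = enn2real p"
  have r: "1 < r" "p = ennreal r"
    using p False by (auto simp: r_def elim!: exponent_cases)
  have ip: "enn2real (inverse p) = 1 / r"
    using r by (simp add: inverse_ennreal divide_inverse)
  define I where "I = (\<integral>\<^sup>+x. ennreal (cmod (g x) powr r) \<partial>lborel)"
  have "I \<le> (\<integral>\<^sup>+x. ennreal (K powr r) * ennreal ((1 / a + \<bar>x\<bar>) powr - r) \<partial>lborel)"
    unfolding I_def
  proof (intro nn_integral_mono_AE, use le in eventually_elim)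
    case (elim x)
    have "cmod (g x) powr r \<le> (K / (1 / a + \<bar>x\<bar>)) powr r"
      using elim r by (intro powr_mono2) auto
    also have "\<dots> = K powr r * (1 / a + \<bar>x\<bar>) powr - r"
      using assms by (simp only: powr_minus powr_divide divide_inverse[symmetric])
    finally show ?case by (simp add: ennreal_mult[symmetric] ennreal_leI)
  qed
  also have "\<dots> = ennreal (K powr r) * (\<integral>\<^sup>+x. ennreal ((1 / a + \<bar>x\<bar>) powr - r) \<partial>lborel)"
    by (rule nn_integral_cmult) measurable
  also have "\<dots> \<le> ennreal (K powr r) * ennreal (2 * (1 / a) powr (1 - r) / (r - 1))"
    using assms r by (intro mult_left_mono nn_integral_powr_decay) auto
  also have "\<dots> = ennreal (K powr r * (2 / (r - 1)) * a powr (r - 1))"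
    using assms r by (simp add: ennreal_mult[symmetric] powr_divide powr_diff mult_ac)
  finally have I: "I \<le> ennreal (K powr r * (2 / (r - 1)) * a powr (r - 1))" .
  then have fin: "I \<noteq> \<infinity>" by (auto simp: top_unique)
  have "enn2real I \<le> K powr r * (2 / (r - 1)) * a powr (r - 1)"
    using I r assms by (intro enn2real_leI) auto
  then have "enn2real I powr (1 / r) \<le> (K powr r * (2 / (r - 1)) * a powr (r - 1)) powr (1 / r)"
    using r by (intro powr_mono2) auto
  also have "\<dots> = K * decay_const p * a powr (1 - 1 / r)"
  proof -
    have "(K powr r) powr (1 / r) = K" "(a powr (r - 1)) powr (1 / r) = a powr (1 - 1 / r)"
      using r assms by (simp_all add: powr_powr diff_divide_distrib)
    moreover have "0 \<le> K powr r" "0 \<le> 2 / (r - 1)" "0 \<le> a powr (r - 1)" using r by auto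
    ultimately show ?thesis
      using False by (simp only: powr_mult mult_nonneg_nonneg decay_const_def r_def[symmetric] if_False)
  qed
  finally show ?thesis
    using False fin unfolding Lp_norm_def r_def[symmetric] I_def[symmetric] ip by (simp add: Let_def ennreal_leI)
qed

text \<open>Dividing \<open>h\<close> by \<open>N\<close> yields a competitor in the supremum. Its
  membership in \<open>Lhat_space\<close> rests on the reflected Fourier integral as preimage, its
  norm on the chosen \<open>fourier\<close>, and both obey the same decay bound. Precision at every
  point of \<open>(a, 2a)\<close> settles the almost-everywhere condition for any
  \<open>\<nu>\<close>, with or without atoms.\<close>

lemma star_norm_test:
  fixes \<theta> h :: "real \<Rightarrow> complex"
  assumes p: "1 < p" and a: "0 < a" and K: "0 < K"
    and \<nu>: "sets \<nu> = sets borel" "integrable \<nu> \<theta>" "\<And>t. t \<notin> {a<..<2*a} \<Longrightarrow> \<theta> t = 0"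
    and h[measurable]: "h \<in> borel_measurable borel" "integrable lborel h" "\<And>x. cmod (h x) \<le> M"
      "\<And>y. cmod (fourier_integral h y) \<le> K / (1 / a + \<bar>y\<bar>)"
      "\<And>t. t \<in> {a<..<2*a} \<Longrightarrow> precise_at h t"
  shows "ennreal (cmod (LINT t|\<nu>. h t * \<theta> t)) \<le>
    ennreal (K * decay_const p * a powr (1 - enn2real (inverse p))) * star_norm p \<nu> \<theta>"
proof -
  define N where "N = K * decay_const p * a powr (1 - enn2real (inverse p))"
  have N: "0 < N" unfolding N_def using decay_const_pos[OF p] K a by simp
  define g where "g = (\<lambda>t. h t / of_real N)"
  have [measurable]: "g \<in> borel_measurable borel" unfolding g_def by measurable
  have gi: "integrable lborel g" unfolding g_def using h by simp
  have gb: "cmod (g x) \<le> M / N" for x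
    unfolding g_def using N h(3)[of x] by (simp add: norm_divide divide_right_mono)
  have gF: "fourier_integral g y = fourier_integral h y / of_real N" for y
    unfolding fourier_integral_def g_def by simp
  define q where "q = conj_exp p"
  have q: "1 \<le> q" "q < \<infinity>" "conj_exp q = p"
    unfolding q_def using conj_exp_bounds[OF p] conj_exp_conj_exp[OF p] by auto
  have gK: "cmod (fourier_integral g y) \<le> (K / N) / (1 / a + \<bar>y\<bar>)" for y
    using divide_right_mono[OF h(4)[of y], of N] N by (simp add: gF norm_divide mult.commute)
  have "(\<lambda>x. fourier_integral g (- x)) \<in> Lp_space p"
  proof -
    have "Lp_norm p (\<lambda>x. fourier_integral g (- x)) \<le> ennreal (K / N * decay_const p * a powr (1 - enn2real (inverse p)))"
      using gK[of "- y" for y] K N by (intro Lp_norm_decay p a) auto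
    then show ?thesis by (auto simp: Lp_space_def intro: le_less_trans)
  qed
  then have 1: "g \<in> Lhat_space q"
    using Lp_space_bounded_integrable[OF _ gi gb q(1,2)] is_fourier_of_inverse[OF gi _ gb] q(3)
    by (auto simp: Lhat_space_def)
  have "Lp_norm p (fourier g) \<le> ennreal (K / N * decay_const p * a powr (1 - enn2real (inverse p)))"
  proof (rule Lp_norm_decay[OF p a])
    show "AE y in lborel. cmod (fourier g y) \<le> K / N / (1 / a + \<bar>y\<bar>)"
      using fourier_eq_fourier_integral(2)[OF gi] by eventually_elim (metis gK)
  qed (use K N fourier_eq_fourier_integral(1)[OF gi] in auto)
  also have "K / N * decay_const p * a powr (1 - enn2real (inverse p)) = 1"
    using decay_const_pos[OF p] K a by (simp add: N_def)
  finally have 2: "Lhat_norm q g \<le> 1" by (simp add: Lhat_norm_def q(3))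
  have 3: "AE t in \<nu>. \<theta> t \<noteq> 0 \<longrightarrow> precise_at g t"
  proof (intro AE_I2 impI)
    fix t assume "\<theta> t \<noteq> 0"
    then have "precise_at h t" using \<nu>(3) h(5) by blast
    then have "((\<lambda>r. (LINT s:{t - r..t + r}|lborel. h s) / of_real (2 * r) / of_real N) \<longlongrightarrow> h t / of_real N) (at_right 0)"
      using N unfolding precise_at_def by (intro tendsto_intros) auto
    then show "precise_at g t"
      unfolding precise_at_def g_def by (simp add: divide_divide_eq_left mult.commute)
  qed
  have 4: "integrable \<nu> (\<lambda>t. g t * \<theta> t)"
    by (rule integrable_bounded_times[OF \<nu>(2) _ gb]) (simp add: measurable_cong_sets[OF \<nu>(1) refl])
  have "ennreal (cmod (LINT t|\<nu>. g t * \<theta> t)) \<le> star_norm p \<nu> \<theta>"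
    unfolding star_norm_def q_def[symmetric] by (rule SUP_upper) (use 1 2 3 4 in auto)
  moreover have "cmod (LINT t|\<nu>. h t * \<theta> t) = N * cmod (LINT t|\<nu>. g t * \<theta> t)"
    unfolding g_def using N by (simp add: norm_divide)
  ultimately show ?thesis
    using N unfolding N_def[symmetric] by (simp add: ennreal_mult mult_left_mono)
qed

section \<open>Precise representatives and step functions as test functions\<close>

lemma integrable_indicator_Icc: "integrable lborel (indicat_real {b..c :: real})"
  by (cases "b \<le> c") (auto intro!: integrable_real_indicator)

lemma precise_at_isCont:
  assumes h: "integrable lborel h" and c: "isCont h t"
  shows "precise_at h t"
  unfolding precise_at_def
proof (rule tendstoI)
  fix e :: real assume e: "0 < e"
  obtain d where d: "0 < d" "\<And>s. dist s t < d \<Longrightarrow> dist (h s) (h t) < e / 2"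
    using c e unfolding continuous_at_eps_delta by (metis half_gt_zero dist_commute)
  have "dist ((LINT s:{t - r..t + r}|lborel. h s) / of_real (2 * r)) (h t) < e" if r: "0 < r" "r < d" for r
  proof -
    let ?S = "{t - r..t + r}"
    have i: "set_integrable lborel ?S h" "set_integrable lborel ?S (\<lambda>_. h t)"
      using h integrable_scaleR_left[OF integrable_indicator_Icc]
      by (auto simp: set_integrable_def integrable_mult_indicator)
    have cst: "(LINT s:?S|lborel. h t) = of_real (2 * r) * h t"
      using r by (simp add: set_integral_const scaleR_conv_of_real)
    have "cmod ((LINT s:?S|lborel. h s) - of_real (2 * r) * h t) = cmod (LINT s:?S|lborel. h s - h t)"
      using i cst by (simp add: set_integral_diff)
    also have "\<dots> \<le> (LINT s:?S|lborel. e / 2)"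
      unfolding set_lebesgue_integral_def
    proof (rule Bochner_Integration.integral_norm_bound_integral)
      show "integrable lborel (\<lambda>s. indicat_real ?S s *\<^sub>R (h s - h t))"
        using set_integral_diff(1)[OF i] by (simp add: set_integrable_def)
      show "norm (indicat_real ?S s *\<^sub>R (h s - h t)) \<le> indicat_real ?S s *\<^sub>R (e / 2)" for s
      proof (cases "s \<in> ?S")
        case True
        then have "dist s t < d" using r by (auto simp: dist_real_def abs_if)
        from d(2)[OF this] True show ?thesis by (simp add: dist_norm less_imp_le)
      qed simp
    qed (intro integrable_scaleR_left integrable_indicator_Icc)
    also have "\<dots> = 2 * r * (e / 2)" using r by (simp add: set_integral_const)
    finally have "cmod ((LINT s:?S|lborel. h s) - of_real (2 * r) * h t) \<le> r * e" by simp
    moreover have "0 < r * e" using r e by simp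
    ultimately have "cmod ((LINT s:?S|lborel. h s) - of_real (2 * r) * h t) < 2 * r * e" by linarith
    moreover have "(LINT s:?S|lborel. h s) / of_real (2 * r) - h t =
        ((LINT s:?S|lborel. h s) - of_real (2 * r) * h t) / of_real (2 * r)"
      using r by (simp add: field_simps)
    ultimately show ?thesis
      using r e by (simp add: dist_norm norm_divide field_simps)
  qed
  then show "\<forall>\<^sub>F r in at_right 0. dist ((LINT s:{t - r..t + r}|lborel. h s) / of_real (2 * r)) (h t) < e"
    using d(1) by (auto simp: eventually_at_right_field)
qed

text \<open>The value at the jump makes the function equal to its precise representative there.\<close>

definition step_test :: "real \<Rightarrow> real \<Rightarrow> real \<Rightarrow> complex" where
  "step_test w b t = (if t = w then 1 / 2 else indicator {w<..<b} t)"

lemma step_test_AE: "AE t in lborel. step_test w b t = indicator {w..b} t"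
  using AE_lborel_singleton[of w] AE_lborel_singleton[of b]
  by eventually_elim (auto simp: step_test_def indicator_def)

lemma borel_measurable_step_test [measurable]: "step_test w b \<in> borel_measurable borel"
  unfolding step_test_def[abs_def] by measurable

lemma integrable_step_test: "integrable lborel (step_test w b)"
proof -
  have "integrable lborel (\<lambda>t. complex_of_real (indicator {w..b} t))"
    by (intro integrable_of_real integrable_indicator_Icc)
  then have "integrable lborel (indicator {w..b} :: real \<Rightarrow> complex)"
    by (simp add: of_real_indicator)
  then show ?thesis
    by (rule integrable_cong_AE_imp) (use step_test_AE[of w b] in \<open>auto elim: eventually_mono\<close>)
qed

text \<open>The function is locally constant off the two jumps, and small centred intervals at
  \<open>w\<close> lie half inside the step. At \<open>b\<close> the means tend to 1/2 while the
  value is 0; in the application \<open>b = 2 * a\<close> lies outside the open interval that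
  carries the measure.\<close>

lemma precise_at_step_test:
  assumes "t \<noteq> b" "w < b"
  shows "precise_at (step_test w b) t"
proof (cases "t = w")
  case False
  have "isCont (step_test w b) t"
  proof -
    consider "t < w" | "w < t" "t < b" | "b < t" using False assms by linarith
    then have "\<exists>S c. open S \<and> t \<in> S \<and> (\<forall>s\<in>S. step_test w b s = c)"
    proof cases
      case 1 then show ?thesis
        by (intro exI[of _ "{..<w}"] exI[of _ 0]) (auto simp: step_test_def)
    next
      case 2 then show ?thesis
        by (intro exI[of _ "{w<..<b}"] exI[of _ 1]) (auto simp: step_test_def)
    next
      case 3 then show ?thesis using assms
        by (intro exI[of _ "{b<..}"] exI[of _ 0]) (auto simp: step_test_def)
    qed
    then obtain S c where "open S" "t \<in> S" "\<And>s. s \<in> S \<Longrightarrow> step_test w b s = c" by blast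
    then have "\<forall>\<^sub>F s in nhds t. step_test w b s = c"
      unfolding eventually_nhds by blast
    then show ?thesis
      by (subst isCont_cong[where g = "\<lambda>_. c"]) auto
  qed
  then show ?thesis by (intro precise_at_isCont integrable_step_test)
next
  case True
  have "(LINT s:{w - r..w + r}|lborel. step_test w b s) / of_real (2 * r) = step_test w b w"
    if r: "0 < r" "r < b - w" for r
  proof -
    have "(LINT s:{w - r..w + r}|lborel. step_test w b s) = (LINT s:{w..w + r}|lborel. 1)"
      unfolding set_lebesgue_integral_def
    proof (rule integral_cong_AE)
      show "AE s in lborel. indicat_real {w - r..w + r} s *\<^sub>R step_test w b s = indicat_real {w..w + r} s *\<^sub>R 1"
        using step_test_AE[of w b] by eventually_elim (use r in \<open>auto simp: indicator_def\<close>)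
    qed measurable
    also have "\<dots> = of_real r" using r by (simp add: set_integral_const scaleR_conv_of_real)
    finally show ?thesis using r by (simp add: step_test_def)
  qed
  then have "\<forall>\<^sub>F r in at_right 0. (LINT s:{w - r..w + r}|lborel. step_test w b s) / of_real (2 * r) = step_test w b w"
    using assms unfolding eventually_at_right_field by (intro exI[of _ "b - w"]) auto
  then show ?thesis
    unfolding precise_at_def True by (rule tendsto_eventually)
qed

lemma norm_step_test: "cmod (step_test w b t) \<le> 1"
  by (auto simp: step_test_def indicator_def)

text \<open>The interval has length at most \<open>a\<close>, so the transform is at most
  \<open>a\<close>; the explicit primitive bounds it by \<open>1 / (pi * |y|)\<close>. After
  multiplication by \<open>1 / a\<close> and \<open>|y|\<close> respectively, each estimate
  contributes at most 1, hence the constant 2.\<close>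

lemma fourier_integral_step_test:
  assumes a: "0 < a" and w: "a \<le> w" "w < 2 * a"
  shows "cmod (fourier_integral (step_test w (2 * a)) y) \<le> 2 / (1 / a + \<bar>y\<bar>)"
proof -
  let ?F = "fourier_integral (step_test w (2 * a)) y"
  have F: "?F = (LINT x:{w..2 * a}|lborel. cis (- (2 * pi * x * y)))"
    unfolding fourier_integral_def set_lebesgue_integral_def
  proof (rule integral_cong_AE)
    show "AE x in lborel. step_test w (2 * a) x * cis (- (2 * pi * x * y)) =
        indicat_real {w..2 * a} x *\<^sub>R cis (- (2 * pi * x * y))"
      using step_test_AE[of w "2 * a"] by eventually_elim (auto simp: indicator_def)
  qed measurable
  have "cmod ?F \<le> (LINT x|lborel. cmod (step_test w (2 * a) x))"
    by (rule norm_fourier_integral_le)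
  also have "\<dots> = (LINT x|lborel. indicat_real {w..2 * a} x)"
  proof (rule integral_cong_AE)
    show "AE x in lborel. cmod (step_test w (2 * a) x) = indicat_real {w..2 * a} x"
      using step_test_AE[of w "2 * a"] by eventually_elim (auto simp: indicator_def)
  qed measurable
  also have "\<dots> \<le> a" using w by simp
  finally have 1: "cmod ?F \<le> a" .
  have 2: "\<bar>y\<bar> * cmod ?F \<le> 1"
  proof (cases "y = 0")
    case False
    let ?k = "- (2 * pi * y)"
    have "(LINT x:{w..2 * a}|lborel. cis (- (2 * pi * x * y))) =
        cis (?k * (2 * a)) / (\<i> * ?k) - cis (?k * w) / (\<i> * ?k)"
      unfolding set_lebesgue_integral_def
    proof (rule integral_FTC_Icc)
      show "((\<lambda>x. cis (?k * x) / (\<i> * ?k)) has_vector_derivative cis (- (2 * pi * x * y))) (at x within {w..2 * a})" for x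
      proof -
        have "((\<lambda>z. exp (\<i> * ?k * z) / (\<i> * ?k)) has_field_derivative exp (\<i> * ?k * z) * (\<i> * ?k) / (\<i> * ?k)) (at z)"
          for z :: complex
          by (intro DERIV_cdivide) (auto intro!: derivative_eq_intros)
        from has_vector_derivative_real_field[OF this, of x "{w..2 * a}"]
        show ?thesis using False by (simp add: cis_conv_exp mult_ac)
      qed
      show "continuous_on {w..2 * a} (\<lambda>x. cis (- (2 * pi * x * y)))"
        by (intro continuous_intros)
    qed (use w in auto)
    then have "cmod ?F \<le> 1 / (2 * pi * \<bar>y\<bar>) + 1 / (2 * pi * \<bar>y\<bar>)"
      unfolding F by (auto intro!: order_trans[OF norm_triangle_ineq4] simp: norm_divide norm_mult abs_mult)
    then have "\<bar>y\<bar> * cmod ?F \<le> 1 / pi"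
      using False by (simp add: field_simps)
    also have "\<dots> \<le> 1" using pi_gt3 by simp
    finally show ?thesis .
  qed simp
  have "cmod ?F * (1 / a + \<bar>y\<bar>) \<le> 2"
  proof -
    have "cmod ?F * (1 / a) \<le> 1" using 1 a by simp
    then show ?thesis using 2 unfolding distrib_left by (simp only: mult.commute)
  qed
  moreover have "0 < 1 / a + \<bar>y\<bar>" using a by (intro add_pos_nonneg) auto
  ultimately show ?thesis by (simp add: pos_le_divide_eq)
qed

section \<open>Measures on a dyadic interval\<close>

locale dyadic_measure =
  fixes p :: ennreal and a :: real and \<nu> :: "real measure" and \<theta> :: "real \<Rightarrow> complex"
  assumes p: "1 < p" and a: "0 < a" and sigma_finite: "sigma_finite_measure \<nu>"
    and sets_nu [simp, measurable_cong]: "sets \<nu> = sets borel"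
    and integrable_theta: "integrable \<nu> \<theta>" and support: "\<And>t. t \<notin> {a<..<2*a} \<Longrightarrow> \<theta> t = 0"
begin

lemma theta_measurable [measurable]: "\<theta> \<in> borel_measurable \<nu>"
  using integrable_theta by auto

text \<open>The unit in which one dyadic piece is measured: a test function whose transform is at
  most \<open>K / (1 / a + |y|)\<close> pairs with the measure to at most \<open>K * weight\<close>.
  Divided by \<open>a\<close> and integrated over all pieces, it gives \<open>decay_const p\<close>
  times the norm of V_p^*.\<close>

definition weight :: ennreal where
  "weight = ennreal (decay_const p * a powr (1 - enn2real (inverse p))) * star_norm p \<nu> \<theta>"

lemma test_bound:
  fixes h :: "real \<Rightarrow> complex"
  assumes "0 < K" and h: "h \<in> borel_measurable borel" "integrable lborel h" "\<And>x. cmod (h x) \<le> M"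
      "\<And>y. cmod (fourier_integral h y) \<le> K / (1 / a + \<bar>y\<bar>)"
      "\<And>t. t \<in> {a<..<2*a} \<Longrightarrow> precise_at h t"
  shows "ennreal (cmod (LINT t|\<nu>. h t * \<theta> t)) \<le> ennreal K * weight"
  using star_norm_test[OF p a assms(1) sets_nu integrable_theta support h] assms(1) decay_const_pos[OF p]
  unfolding weight_def by (simp add: ennreal_mult mult.assoc)

lemma integrable_bounded_mult:
  fixes h :: "real \<Rightarrow> complex"
  assumes [measurable]: "h \<in> borel_measurable borel" and "\<And>t. cmod (h t) \<le> M"
  shows "integrable \<nu> (\<lambda>t. h t * \<theta> t)"
  by (rule integrable_bounded_times[OF integrable_theta _ assms(2)]) simp

text \<open>On the support the half-line indicator is that of \<open>(u, 2a)\<close>, which is the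
  limit of admissible step functions jumping at points that decrease to \<open>u\<close>. The
  constant 2 is the one of \<open>fourier_integral_step_test\<close>.\<close>

lemma tail_bound:
  assumes fin: "weight < \<infinity>" and u: "a \<le> u"
  shows "cmod (LINT t|\<nu>. indicator {u<..} t * \<theta> t) \<le> 2 * enn2real weight"
proof (cases "u < 2 * a")
  case False
  then have "indicator {u<..} t * \<theta> t = 0" for t using support[of t] by (auto simp: indicator_def)
  then have "(LINT t|\<nu>. indicator {u<..} t * \<theta> t) = (LINT t|\<nu>. 0)"
    by (intro Bochner_Integration.integral_cong refl)
  then show ?thesis by simp
next
  case True
  \<comment> \<open>The test function jumping at \<open>u\<close> itself would also count half of an atom at \<open>u\<close>.\<close>
  define w where "w = (\<lambda>n::nat. u + (2 * a - u) / real (n + 2))"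
  \<comment> \<open>The shift by 2 in the denominator keeps even \<open>w 0\<close> strictly below
    \<open>2 * a\<close>, so that the step is never empty.\<close>
  have w: "u < w n" "w n < 2 * a" for n
    using True mult_strict_left_mono[of 1 "real (n + 2)" "2 * a - u"] unfolding w_def by (simp_all add: field_simps)
  have wl: "w \<longlonglongrightarrow> u"
    unfolding w_def by real_asymp
  have "cmod (LINT t|\<nu>. step_test (w n) (2 * a) t * \<theta> t) \<le> 2 * enn2real weight" for n
  proof -
    have "ennreal (cmod (LINT t|\<nu>. step_test (w n) (2 * a) t * \<theta> t)) \<le> ennreal 2 * weight"
      using w[of n] u
      by (intro test_bound[where M = 1] integrable_step_test norm_step_test fourier_integral_step_test a precise_at_step_test) auto
    also have "\<dots> = ennreal (2 * enn2real weight)"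
      using fin by (simp add: ennreal_mult)
    finally show ?thesis by simp
  qed
  moreover have "(\<lambda>n. LINT t|\<nu>. step_test (w n) (2 * a) t * \<theta> t) \<longlonglongrightarrow> (LINT t|\<nu>. indicator {u<..} t * \<theta> t)"
  proof (rule integral_dominated_convergence[where w = "\<lambda>t. cmod (\<theta> t)"])
    show "AE t in \<nu>. (\<lambda>n. step_test (w n) (2 * a) t * \<theta> t) \<longlonglongrightarrow> indicator {u<..} t * \<theta> t"
    proof (rule AE_I2)
      fix t
      consider "t \<notin> {a<..<2*a}" | "t \<le> u" | "u < t" "t < 2 * a" by fastforce
      then show "(\<lambda>n. step_test (w n) (2 * a) t * \<theta> t) \<longlonglongrightarrow> indicator {u<..} t * \<theta> t"
      proof cases
        case 1 then show ?thesis using support by simp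
      next
        case 2
        then have "step_test (w n) (2 * a) t = 0" for n using w[of n] by (auto simp: step_test_def)
        then show ?thesis using 2 by simp
      next
        case 3
        have "\<forall>\<^sub>F n in sequentially. w n < t" by (rule order_tendstoD(2)[OF wl 3(1)])
        then have "\<forall>\<^sub>F n in sequentially. step_test (w n) (2 * a) t * \<theta> t = indicator {u<..} t * \<theta> t"
          by eventually_elim (use 3 in \<open>auto simp: step_test_def\<close>)
        then show ?thesis by (rule tendsto_eventually)
      qed
    qed
    show "AE t in \<nu>. norm (step_test (w n) (2 * a) t * \<theta> t) \<le> cmod (\<theta> t)" for n
      using norm_step_test by (auto simp: norm_mult intro!: mult_left_le_one_le)
  qed (use integrable_theta in auto)
  ultimately show ?thesis
    by (intro Lim_bounded[OF tendsto_norm]) auto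
qed

end

section \<open>Large frequencies by duality\<close>

lemma isCont_fourier_integral:
  assumes f: "integrable lborel f"
  shows "isCont (fourier_integral f) y"
  unfolding continuous_at_sequentially comp_def fourier_integral_def
proof (intro allI impI)
  fix Y :: "nat \<Rightarrow> real" assume Y: "Y \<longlonglongrightarrow> y"
  have [measurable]: "f \<in> borel_measurable borel" using f by auto
  show "(\<lambda>n. LINT x|lborel. f x * cis (- (2 * pi * x * Y n))) \<longlonglongrightarrow> (LINT x|lborel. f x * cis (- (2 * pi * x * y)))"
  proof (rule integral_dominated_convergence[where w = "\<lambda>x. cmod (f x)"])
    show "AE x in lborel. (\<lambda>n. f x * cis (- (2 * pi * x * Y n))) \<longlonglongrightarrow> f x * cis (- (2 * pi * x * y))"
      by (intro AE_I2 tendsto_intros Y isCont_tendsto_compose[of _ cis] continuous_intros)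
  qed (use f in \<open>auto simp: norm_mult\<close>)
qed

context dyadic_measure
begin

text \<open>The test function is the Fourier transform of \<open>W\<close> times the conjugate sign of \<open>M\<close>, multiplied
  by the Gaussian. Its own transform is a convolution of \<open>W\<close>, up to signs, with a Gaussian of width
  \<open>\<sigma> \<le> 1 / a\<close>, which preserves the bound \<open>1 / (1 / a + \<bar>y\<bar>)\<close>.\<close>

lemma gaussian_duality:
  fixes \<sigma> R :: real
  assumes \<sigma>: "0 < \<sigma>" "\<sigma> \<le> 1 / a"
  defines "W \<equiv> \<lambda>x. indicator {x. 1 / (2 * a) < \<bar>x\<bar> \<and> \<bar>x\<bar> < R} x / \<bar>x\<bar> :: real"
    and "M \<equiv> \<lambda>x. LINT s|\<nu>. cis (2 * pi * x * s) * of_real (exp (- (2 * pi * \<sigma> * s)\<^sup>2 / 2)) * \<theta> s"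
  shows "(\<integral>\<^sup>+x. ennreal (W x * cmod (M x)) \<partial>lborel) \<le> 6 * weight"
proof -
  interpret nu: sigma_finite_measure \<nu> by (rule sigma_finite)
  interpret NL: pair_sigma_finite \<nu> lborel
    by (intro pair_sigma_finite.intro sigma_finite lborel.sigma_finite_measure_axioms)
  define g where "g = (\<lambda>s. complex_of_real (exp (- (2 * pi * \<sigma> * s)\<^sup>2 / 2)))"
  have [measurable]: "g \<in> borel_measurable borel" unfolding g_def by measurable
  have g1: "cmod (g s) \<le> 1" for s by (simp add: g_def)
  have gi: "integrable lborel g" unfolding g_def by (rule integral_cis_gaussian(2)[OF \<sigma>(1)])
  have [measurable]: "W \<in> borel_measurable borel" unfolding W_def by measurable
  have W0: "0 \<le> W x" for x by (simp add: W_def)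
  have W1: "W x \<le> 2 * a" for x
  proof (cases "1 / (2 * a) < \<bar>x\<bar>")
    case True
    then have "1 / \<bar>x\<bar> \<le> 1 / (1 / (2 * a))" using a by (intro divide_left_mono mult_pos_pos) auto
    then show ?thesis using a by (auto simp: W_def indicator_def)
  qed (use a in \<open>simp add: W_def\<close>)
  \<comment> \<open>Integrability comes from the truncation at \<open>R\<close>; the final bound
    does not involve \<open>R\<close>, so it survives the limit
    \<open>R \<longrightarrow> \<infinity>\<close> taken later.\<close>
  have Wi: "integrable lborel W"
  proof (rule Bochner_Integration.integrable_bound)
    show "integrable lborel (\<lambda>x. 2 * a * indicator {-R..R} x)"
      by (intro integrable_mult_right integrable_indicator_Icc)
    show "AE x in lborel. norm (W x) \<le> norm (2 * a * indicator {- R..R} x)"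
    proof (rule AE_I2)
      fix x show "norm (W x) \<le> norm (2 * a * indicator {- R..R} x)"
        using W0[of x] W1[of x] a by (cases "\<bar>x\<bar> < R") (auto simp: W_def indicator_def)
    qed
  qed measurable
  have M_eq: "M x = (LINT s|\<nu>. cis (2 * pi * x * s) * g s * \<theta> s)" for x by (simp add: M_def g_def)
  have [measurable]: "M \<in> borel_measurable borel" unfolding M_eq[abs_def] by measurable
  define k where "k = (\<lambda>x. cnj (sgn (M x)) * of_real (W x))"
  have [measurable]: "cnj \<in> borel_measurable borel"
    by (intro borel_measurable_continuous_onI continuous_intros)
  have [measurable]: "k \<in> borel_measurable borel"
    unfolding k_def sgn_div_norm by measurable
  have kW: "cmod (k x) \<le> W x" for x
    using W0[of x] by (simp add: k_def norm_mult norm_sgn)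
  have kM: "k x * M x = of_real (W x * cmod (M x))" for x
  proof -
    have "cnj (sgn z) * z = of_real (cmod z)" for z
      by (cases "z = 0") (simp_all add: sgn_div_norm scaleR_conv_of_real complex_norm_square[symmetric] power2_eq_square divide_simps mult.commute)
    then show ?thesis by (simp add: k_def mult_ac)
  qed
  have ki: "integrable lborel k"
    using Wi by (rule Bochner_Integration.integrable_bound) (use kW W0 in auto)
  define H where "H = (\<lambda>t. LINT x|lborel. k x * cis (2 * pi * x * t))"
  have H_eq: "H t = fourier_integral k (- t)" for t by (simp add: H_def fourier_integral_def)
  have [measurable]: "H \<in> borel_measurable borel" unfolding H_eq[abs_def] by measurable
  define B where "B = (LINT x|lborel. cmod (k x))"
  have HB: "cmod (H t) \<le> B" for t unfolding H_eq B_def by (rule norm_fourier_integral_le)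
  define h where "h = (\<lambda>t. H t * g t)"
  have [measurable]: "h \<in> borel_measurable borel" unfolding h_def by measurable
  have hB: "cmod (h t) \<le> B" for t
    using mult_mono[OF HB[of t] g1[of t]] order_trans[OF norm_ge_zero HB[of t]] by (simp add: h_def norm_mult)
  have hi: "integrable lborel h"
    unfolding h_def
  proof (rule Bochner_Integration.integrable_bound[OF integrable_mult_right[OF gi, of "of_real B"]])
    show "AE t in lborel. norm (H t * g t) \<le> norm (of_real B * g t)"
      unfolding norm_mult norm_of_real
      by (intro AE_I2 mult_right_mono order_trans[OF HB abs_ge_self]) simp
  qed measurable
  have hc: "isCont h t" for t
  proof -
    have "isCont (\<lambda>t. fourier_integral k (- t)) t"
      by (rule isCont_o2[OF _ isCont_fourier_integral[OF ki]]) (intro continuous_intros)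
    moreover have "isCont g t" unfolding g_def by (intro continuous_intros) auto
    ultimately show ?thesis unfolding h_def H_eq by (intro continuous_intros)
  qed
  have hF: "fourier_integral h y = (LINT x|lborel. k x * of_real (normal_density y \<sigma> x))" for y
  proof -
    let ?f = "\<lambda>x t. k x * g t * cis (2 * pi * t * (x - y))"
    have "integrable (lborel \<Otimes>\<^sub>M lborel) (case_prod ?f)"
      by (rule lborel_pair.integrable_pair_bound[OF ki gi]) (auto simp: norm_mult)
    note fub = lborel_pair.Fubini_integral[OF this]
    have "fourier_integral h y = (LINT t|lborel. LINT x|lborel. ?f x t)"
      unfolding fourier_integral_def h_def H_def
    proof (intro Bochner_Integration.integral_cong refl)
      fix t
      have "(LINT x|lborel. ?f x t) = (LINT x|lborel. k x * cis (2 * pi * x * t) * (g t * cis (- (2 * pi * t * y))))"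
        by (intro Bochner_Integration.integral_cong refl) (simp add: right_diff_distrib cis_divide[symmetric] cis_inverse divide_inverse mult_ac)
      then show "(LINT x|lborel. k x * cis (2 * pi * x * t)) * g t * cis (- (2 * pi * t * y)) = (LINT x|lborel. ?f x t)"
        unfolding integral_mult_left_zero by (simp only: mult.assoc)
    qed
    also have "\<dots> = (LINT x|lborel. LINT t|lborel. ?f x t)" by (rule fub)
    also have "\<dots> = (LINT x|lborel. k x * of_real (normal_density y \<sigma> x))"
    proof (intro Bochner_Integration.integral_cong refl)
      fix x
      have "(LINT t|lborel. ?f x t) = k x * (LINT t|lborel. cis (2 * pi * t * (x - y)) * g t)"
        by (subst integral_mult_right_zero[symmetric]) (simp add: mult_ac)
      also have "(LINT t|lborel. cis (2 * pi * t * (x - y)) * g t) = of_real (normal_density 0 \<sigma> (x - y))"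
        unfolding g_def by (rule integral_cis_gaussian(1)[OF \<sigma>(1)])
      also have "normal_density 0 \<sigma> (x - y) = normal_density y \<sigma> x"
        by (simp add: normal_density_def)
      finally show "(LINT t|lborel. ?f x t) = k x * of_real (normal_density y \<sigma> x)" .
    qed
    finally show ?thesis .
  qed
  have hK: "cmod (fourier_integral h y) \<le> 6 / (1 / a + \<bar>y\<bar>)" for y
  proof -
    let ?d = "normal_density y \<sigma>"
    let ?c = "3 / (1 / a + \<bar>y\<bar>)"
    have ap: "0 < 1 / a + \<bar>z\<bar>" for z using a by (intro add_pos_nonneg) auto
    \<comment> \<open>On the support of \<open>W\<close> one has \<open>1 / a < 2 * |x|\<close>,
      whence \<open>1 / |x| \<le> 3 / (1 / a + |x|)\<close>. Replacing \<open>x\<close> by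
      \<open>y\<close> in the denominator costs the factor \<open>1 + a * |x - y|\<close>, which
      grows only linearly and so can be integrated against a normal density.\<close>
    have Wle: "W x \<le> ?c * (1 + a * \<bar>x - y\<bar>)" for x
    proof (cases "1 / (2 * a) < \<bar>x\<bar>")
      case True
      then have x: "0 < \<bar>x\<bar>" "1 / a + \<bar>x\<bar> \<le> 3 * \<bar>x\<bar>" using a by (auto simp: field_simps)
      have "W x \<le> 1 / \<bar>x\<bar>" by (auto simp: W_def indicator_def)
      also have "1 / \<bar>x\<bar> \<le> 3 / (1 / a + \<bar>x\<bar>)"
        using x ap[of x] by (simp add: divide_le_eq le_divide_eq)
      also have "\<dots> \<le> ?c * (1 + a * \<bar>x - y\<bar>)"
      proof -
        have "1 / a + \<bar>y\<bar> \<le> 1 / a + \<bar>x\<bar> + \<bar>x - y\<bar>" by linarith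
        also have "\<bar>x - y\<bar> \<le> (1 / a + \<bar>x\<bar>) * (a * \<bar>x - y\<bar>)"
          using a by (simp add: distrib_right)
        finally have "1 / a + \<bar>y\<bar> \<le> (1 / a + \<bar>x\<bar>) * (1 + a * \<bar>x - y\<bar>)"
          by (simp add: distrib_left)
        moreover have "3 / X \<le> 3 / Y * Z" if "0 < X" "0 < Y" "Y \<le> X * Z" for X Y Z :: real
          using that by (simp add: field_simps)
        ultimately show ?thesis using ap by blast
      qed
      finally show ?thesis .
    next
      case False
      then have "W x = 0" by (simp add: W_def)
      then show ?thesis using ap[of y] a by simp
    qed
    have d: "integrable lborel ?d" "(LINT x|lborel. ?d x) = 1"
      using \<sigma>(1) by auto
    \<comment> \<open>The first absolute moment of the normal law, which controls the linear growth
      in \<open>Wle\<close>.\<close>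
    have d': "integrable lborel (\<lambda>x. ?d x * \<bar>x - y\<bar>)" "(LINT x|lborel. ?d x * \<bar>x - y\<bar>) = \<sigma> * sqrt (2 / pi)"
      using integrable_normal_moment_abs[OF \<sigma>(1), of y 1] integral_normal_moment_abs_odd[OF \<sigma>(1), of y 0] by simp_all
    have "cmod (fourier_integral h y) \<le> (LINT x|lborel. ?c * (?d x + a * (?d x * \<bar>x - y\<bar>)))"
      unfolding hF
    proof (rule Bochner_Integration.integral_norm_bound_integral)
      show "integrable lborel (\<lambda>x. k x * of_real (?d x))"
      proof (rule Bochner_Integration.integrable_bound[OF integrable_mult_right[OF d(1), of "2 * a"]])
        show "AE x in lborel. norm (k x * of_real (?d x)) \<le> norm (2 * a * ?d x)"
          using order_trans[OF kW W1] a by (intro AE_I2) (auto simp: norm_mult intro!: mult_right_mono)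
      qed measurable
      show "norm (k x * of_real (?d x)) \<le> ?c * (?d x + a * (?d x * \<bar>x - y\<bar>))" for x
      proof -
        have "norm (k x * of_real (?d x)) \<le> ?c * (1 + a * \<bar>x - y\<bar>) * ?d x"
          using mult_right_mono[OF order_trans[OF kW Wle, of x], of "?d x"] by (simp only: norm_mult norm_of_real) simp
        also have "\<dots> = ?c * (?d x + a * (?d x * \<bar>x - y\<bar>))"
          by (simp only: ring_distribs mult_1_right mult_ac)
        finally show ?thesis .
      qed
    qed (use d d' in \<open>intro integrable_mult_right Bochner_Integration.integrable_add\<close>)
    also have "\<dots> = ?c * (1 + a * (\<sigma> * sqrt (2 / pi)))"
      using d d' by simp
    \<comment> \<open>Here \<open>\<sigma> \<le> 1 / a\<close> enters, together with
      \<open>2 / pi < 1\<close>. The resulting 2 times the 3 in \<open>?c\<close> is the constant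
      6.\<close>
    also have "\<dots> \<le> ?c * (1 + 1)"
    proof -
      have "a * (\<sigma> * sqrt (2 / pi)) \<le> a * (1 / a * 1)"
        using a \<sigma> pi_gt3 by (intro mult_left_mono mult_mono) auto
      then show ?thesis using a ap[of y] by (intro mult_left_mono) auto
    qed
    finally show ?thesis by simp
  qed
  have "of_real (LINT x|lborel. W x * cmod (M x)) = (LINT x|lborel. k x * M x)"
    unfolding kM by (rule integral_complex_of_real[symmetric])
  also have "\<dots> = (LINT x|lborel. LINT s|\<nu>. k x * (cis (2 * pi * x * s) * g s * \<theta> s))"
    unfolding M_eq by simp
  also have "\<dots> = (LINT s|\<nu>. LINT x|lborel. k x * (cis (2 * pi * x * s) * g s * \<theta> s))"
  proof (rule NL.Fubini_integral, rule NL.integrable_pair_bound[OF integrable_theta ki])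
    show "cmod (k x * (cis (2 * pi * x * s) * g s * \<theta> s)) \<le> cmod (\<theta> s) * cmod (k x)" for s x
      using mult_right_mono[OF g1[of s], of "cmod (\<theta> s) * cmod (k x)"] by (simp add: norm_mult mult_ac)
  qed measurable
  also have "\<dots> = (LINT s|\<nu>. h s * \<theta> s)"
  proof (intro Bochner_Integration.integral_cong refl)
    fix s
    have "(LINT x|lborel. k x * (cis (2 * pi * x * s) * g s * \<theta> s)) = (LINT x|lborel. (k x * cis (2 * pi * x * s)) * (g s * \<theta> s))"
      by (simp add: mult_ac)
    also have "\<dots> = h s * \<theta> s" unfolding integral_mult_left_zero by (simp add: h_def H_def mult_ac)
    finally show "(LINT x|lborel. k x * (cis (2 * pi * x * s) * g s * \<theta> s)) = h s * \<theta> s" .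
  qed
  finally have eq: "of_real (LINT x|lborel. W x * cmod (M x)) = (LINT s|\<nu>. h s * \<theta> s)" .
  have Mb: "cmod (M x) \<le> (LINT s|\<nu>. cmod (\<theta> s))" for x
    unfolding M_eq using integrable_theta g1
    by (intro order_trans[OF integral_norm_bound] integral_mono')
       (auto simp: norm_mult intro!: mult_left_le_one_le integrable_bounded_mult[where M = 1, THEN integrable_norm])
  have "(\<integral>\<^sup>+x. ennreal (W x * cmod (M x)) \<partial>lborel) = ennreal (LINT x|lborel. W x * cmod (M x))"
  proof (rule nn_integral_eq_integral)
    show "integrable lborel (\<lambda>x. W x * cmod (M x))"
      by (rule Bochner_Integration.integrable_bound[OF integrable_mult_left[OF Wi, of "LINT s|\<nu>. cmod (\<theta> s)"]])
         (use W0 Mb order_trans[OF norm_ge_zero Mb] in \<open>auto simp: abs_mult intro!: mult_left_mono\<close>)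
  qed (use W0 in auto)
  also have "\<dots> = ennreal (cmod (LINT s|\<nu>. h s * \<theta> s))"
    unfolding eq[symmetric] norm_of_real using W0 by (subst abs_of_nonneg) (auto intro!: integral_nonneg_AE)
  also have "\<dots> \<le> ennreal 6 * weight"
    by (rule test_bound[OF _ _ hi hB hK precise_at_isCont[OF hi hc]]) auto
  finally show ?thesis by simp
qed

end

section \<open>The kernel with its cutoff, for all frequencies\<close>

lemma norm_cis_diff_le: "cmod (cis x - cis y) \<le> \<bar>x - y\<bar>"
proof -
  have "cmod (cis x - cis y) = cmod (exp (\<i> * of_real (x - y)) - 1)"
  proof -
    have "cis x - cis y = cis y * (exp (\<i> * of_real (x - y)) - 1)"
      by (simp add: cis_conv_exp right_diff_distrib flip: exp_add)
    then show ?thesis by (simp add: norm_mult)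
  qed
  also have "\<dots> \<le> \<bar>x - y\<bar>"
    using iexp_approx1[of "x - y" 0] by simp
  finally show ?thesis .
qed

text \<open>The cutoff is written as a product, so that at \<open>x = 0\<close> it equals 1 and the
  kernel vanishes; with a quotient, the convention \<open>1 / 0 = 0\<close> would cut at the origin
  instead.\<close>

definition trig_kernel :: "real \<Rightarrow> real \<Rightarrow> complex" where
  "trig_kernel x t = cis (2 * pi * x * t) - indicator {t. t * \<bar>x\<bar> \<le> 1} t"

lemma measurable_trig_kernel [measurable]: "(\<lambda>(x, t). trig_kernel x t) \<in> borel_measurable (borel \<Otimes>\<^sub>M borel)"
  unfolding trig_kernel_def by measurable

lemma norm_trig_kernel: "cmod (trig_kernel x t) \<le> 2"
  unfolding trig_kernel_def
  by (rule order_trans[OF norm_triangle_ineq4]) (auto simp: indicator_def)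

context dyadic_measure
begin

text \<open>The bound of \<open>gaussian_duality\<close> is uniform in width and truncation, so
  Fatou's lemma removes both at once: the widths \<open>\<sigma> n\<close> tend to 0 while staying
  below \<open>1 / a\<close>, and the truncation at \<open>n\<close> disappears.\<close>

lemma integral_large_frequencies:
  "(\<integral>\<^sup>+x. ennreal (indicator {x. 1 / (2 * a) < \<bar>x\<bar>} x / \<bar>x\<bar> * cmod (LINT s|\<nu>. cis (2 * pi * x * s) * \<theta> s)) \<partial>lborel)
    \<le> 6 * weight"
proof -
  interpret nu: sigma_finite_measure \<nu> by (rule sigma_finite)
  define \<sigma> where "\<sigma> = (\<lambda>n. 1 / (a * real (Suc n)))"
  have \<sigma>: "0 < \<sigma> n" "\<sigma> n \<le> 1 / a" for n
    using a by (auto simp: \<sigma>_def intro!: divide_left_mono)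
  have \<sigma>0: "\<sigma> \<longlonglongrightarrow> 0" unfolding \<sigma>_def using a by real_asymp
  define W where "W = (\<lambda>n x. indicator {x. 1 / (2 * a) < \<bar>x\<bar> \<and> \<bar>x\<bar> < real n} x / \<bar>x\<bar> :: real)"
  define M where "M = (\<lambda>n x. LINT s|\<nu>. cis (2 * pi * x * s) * of_real (exp (- (2 * pi * \<sigma> n * s)\<^sup>2 / 2)) * \<theta> s)"
  have [measurable]: "W n \<in> borel_measurable borel" "M n \<in> borel_measurable borel" for n
    unfolding W_def M_def by measurable
  have lim: "(\<lambda>n. W n x * cmod (M n x)) \<longlonglongrightarrow>
      indicator {x. 1 / (2 * a) < \<bar>x\<bar>} x / \<bar>x\<bar> * cmod (LINT s|\<nu>. cis (2 * pi * x * s) * \<theta> s)" for x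
  proof (intro tendsto_mult tendsto_norm)
    have "\<forall>\<^sub>F n in sequentially. \<bar>x\<bar> < real n"
      using filterlim_real_sequentially unfolding filterlim_at_top_dense by blast
    then have "\<forall>\<^sub>F n in sequentially. W n x = indicator {x. 1 / (2 * a) < \<bar>x\<bar>} x / \<bar>x\<bar>"
      by eventually_elim (auto simp: W_def indicator_def)
    then show "(\<lambda>n. W n x) \<longlonglongrightarrow> indicator {x. 1 / (2 * a) < \<bar>x\<bar>} x / \<bar>x\<bar>"
      by (rule tendsto_eventually)
    show "(\<lambda>n. M n x) \<longlonglongrightarrow> (LINT s|\<nu>. cis (2 * pi * x * s) * \<theta> s)"
      unfolding M_def
    proof (rule integral_dominated_convergence[where w = "\<lambda>s. cmod (\<theta> s)"])
      show "AE s in \<nu>. (\<lambda>n. cis (2 * pi * x * s) * of_real (exp (- (2 * pi * \<sigma> n * s)\<^sup>2 / 2)) * \<theta> s)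
          \<longlonglongrightarrow> cis (2 * pi * x * s) * \<theta> s"
      proof (rule AE_I2)
        fix s
        have "(\<lambda>n. exp (- (2 * pi * \<sigma> n * s)\<^sup>2 / 2)) \<longlonglongrightarrow> exp (- (2 * pi * 0 * s)\<^sup>2 / 2)"
          by (intro tendsto_intros \<sigma>0) auto
        from tendsto_of_real[OF this, where 'a = complex]
        have "(\<lambda>n. cis (2 * pi * x * s) * of_real (exp (- (2 * pi * \<sigma> n * s)\<^sup>2 / 2)) * \<theta> s)
          \<longlonglongrightarrow> cis (2 * pi * x * s) * 1 * \<theta> s"
          by (intro tendsto_intros) simp
        then show "(\<lambda>n. cis (2 * pi * x * s) * of_real (exp (- (2 * pi * \<sigma> n * s)\<^sup>2 / 2)) * \<theta> s)
          \<longlonglongrightarrow> cis (2 * pi * x * s) * \<theta> s" by simp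
      qed
    qed (use integrable_theta in \<open>auto simp: norm_mult intro!: mult_left_le_one_le\<close>)
  qed
  have "(\<integral>\<^sup>+x. ennreal (indicator {x. 1 / (2 * a) < \<bar>x\<bar>} x / \<bar>x\<bar> * cmod (LINT s|\<nu>. cis (2 * pi * x * s) * \<theta> s)) \<partial>lborel)
      = (\<integral>\<^sup>+x. liminf (\<lambda>n. ennreal (W n x * cmod (M n x))) \<partial>lborel)"
    by (intro nn_integral_cong lim_imp_Liminf[symmetric] tendsto_ennrealI lim) simp
  also have "\<dots> \<le> liminf (\<lambda>n. \<integral>\<^sup>+x. ennreal (W n x * cmod (M n x)) \<partial>lborel)"
    by (rule nn_integral_liminf) measurable
  also have "\<dots> \<le> liminf (\<lambda>n::nat. 6 * weight)"
    unfolding W_def M_def by (intro Liminf_mono always_eventually allI gaussian_duality \<sigma>)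
  also have "\<dots> = 6 * weight" by (simp add: Liminf_const)
  finally show ?thesis .
qed

text \<open>On the support the cutoff is identically 1. Writing
  \<open>cis (2 * pi * x * t) - 1\<close> as its value at \<open>a\<close> plus the integral of its
  derivative from \<open>a\<close> to \<open>t\<close>, and exchanging integrals, leaves only tail
  masses. Boundary term and integral each give \<open>2 * pi * |x| * a\<close> times the tail bound
  \<open>2 * weight\<close>, together \<open>8 * pi\<close>.\<close>

lemma kernel_small_frequencies:
  assumes fin: "weight < \<infinity>" and x: "2 * a * \<bar>x\<bar> \<le> 1"
  shows "cmod (LINT t|\<nu>. trig_kernel x t * \<theta> t) \<le> 8 * pi * a * \<bar>x\<bar> * enn2real weight"
proof -
  interpret NL: pair_sigma_finite \<nu> lborel
    by (intro pair_sigma_finite.intro sigma_finite lborel.sigma_finite_measure_axioms)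
  define B where "B = 2 * enn2real weight"
  let ?c = "\<lambda>t. cis (2 * pi * x * t)"
  let ?d = "\<lambda>u. \<i> * of_real (2 * pi * x) * ?c u"
  have T: "cmod (LINT t|\<nu>. indicator {u<..} t * \<theta> t) \<le> B" if "a \<le> u" for u
    unfolding B_def by (rule tail_bound[OF fin that])
  \<comment> \<open>The condition \<open>u < t\<close> is expressed as a tail indicator in
    \<open>t\<close>, so that after the exchange of integrals the inner one is a tail mass. It
    differs from the integration range \<open>{a..t}\<close> only at the null point
    \<open>u = t\<close>.\<close>
  have split: "trig_kernel x t * \<theta> t = (?c a - 1) * (indicator {a<..} t * \<theta> t) +
      (LINT u|lborel. indicator {a..2 * a} u *\<^sub>R (?d u * (indicator {u<..} t * \<theta> t)))" for t
  proof (cases "t \<in> {a<..<2 * a}")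
    case False then show ?thesis using support by simp
  next
    case True
    have "(LINT u|lborel. indicator {a..2 * a} u *\<^sub>R (?d u * (indicator {u<..} t * \<theta> t))) =
        (LINT u|lborel. (indicator {a..t} u *\<^sub>R ?d u) * \<theta> t)"
    proof (rule integral_cong_AE)
      show "AE u in lborel. indicator {a..2 * a} u *\<^sub>R (?d u * (indicator {u<..} t * \<theta> t)) =
          (indicator {a..t} u *\<^sub>R ?d u) * \<theta> t"
        using AE_lborel_singleton[of t] by eventually_elim (use True in \<open>auto simp: indicator_def\<close>)
    qed (simp_all add: indicator_def, measurable)
    also have "\<dots> = (LINT u|lborel. indicator {a..t} u *\<^sub>R ?d u) * \<theta> t"
      by (rule integral_mult_left_zero)
    also have "(LINT u|lborel. indicator {a..t} u *\<^sub>R ?d u) = ?c t - ?c a"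
    proof (rule integral_FTC_Icc)
      show "(?c has_vector_derivative ?d u) (at u within {a..t})" for u
      proof -
        have "((\<lambda>z. exp (\<i> * of_real (2 * pi * x) * z)) has_field_derivative
            exp (\<i> * of_real (2 * pi * x) * z) * (\<i> * of_real (2 * pi * x))) (at z)" for z :: complex
          by (auto intro!: derivative_eq_intros)
        from has_vector_derivative_real_field[OF this, of u "{a..t}"]
        show ?thesis by (simp add: cis_conv_exp mult_ac)
      qed
      show "continuous_on {a..t} ?d" by (intro continuous_intros)
    qed (use True in auto)
    finally have J: "(LINT u|lborel. indicator {a..2 * a} u *\<^sub>R (?d u * (indicator {u<..} t * \<theta> t))) =
        (?c t - ?c a) * \<theta> t" .
    have "t * \<bar>x\<bar> \<le> 1"
      using True x mult_right_mono[of t "2 * a" "\<bar>x\<bar>"] by simp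
    then show ?thesis
      unfolding J using True by (simp add: trig_kernel_def left_diff_distrib)
  qed
  have i: "integrable (\<nu> \<Otimes>\<^sub>M lborel) (\<lambda>(t, u). indicator {a..2 * a} u *\<^sub>R (?d u * (indicator {u<..} t * \<theta> t)))"
  proof (rule NL.integrable_pair_bound[OF integrable_theta])
    show "integrable lborel (\<lambda>u. of_real (2 * pi * \<bar>x\<bar> * indicator {a..2 * a} u) :: complex)"
      by (intro integrable_of_real integrable_mult_right integrable_indicator_Icc)
  qed (measurable, auto simp: norm_mult indicator_def mult_ac)
  have i1: "integrable \<nu> (\<lambda>t. (?c a - 1) * (indicator {a<..} t * \<theta> t))"
    by (intro integrable_mult_right integrable_bounded_mult[where M = 1]) (auto simp: indicator_def)
  have "(LINT t|\<nu>. trig_kernel x t * \<theta> t) = (?c a - 1) * (LINT t|\<nu>. indicator {a<..} t * \<theta> t) +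
      (LINT t|\<nu>. LINT u|lborel. indicator {a..2 * a} u *\<^sub>R (?d u * (indicator {u<..} t * \<theta> t)))"
    unfolding split using i1 NL.integrable_fst[OF i] by simp
  also have "(LINT t|\<nu>. LINT u|lborel. indicator {a..2 * a} u *\<^sub>R (?d u * (indicator {u<..} t * \<theta> t))) =
      (LINT u|lborel. LINT t|\<nu>. indicator {a..2 * a} u *\<^sub>R (?d u * (indicator {u<..} t * \<theta> t)))"
    by (rule NL.Fubini_integral[OF i, symmetric])
  also have "cmod ((?c a - 1) * (LINT t|\<nu>. indicator {a<..} t * \<theta> t) + \<dots>) \<le> 2 * pi * \<bar>x\<bar> * a * B + 2 * pi * \<bar>x\<bar> * a * B"
  proof (intro order_trans[OF norm_triangle_ineq] add_mono)
    have "cmod (?c a - 1) \<le> 2 * pi * \<bar>x\<bar> * a"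
      using norm_cis_diff_le[of "2 * pi * x * a" 0] a by (simp add: abs_mult)
    then show "cmod ((?c a - 1) * (LINT t|\<nu>. indicator {a<..} t * \<theta> t)) \<le> 2 * pi * \<bar>x\<bar> * a * B"
      unfolding norm_mult using T[of a] a by (intro mult_mono) (auto intro: order_trans[OF norm_ge_zero])
    have "cmod (LINT u|lborel. LINT t|\<nu>. indicator {a..2 * a} u *\<^sub>R (?d u * (indicator {u<..} t * \<theta> t)))
        \<le> (LINT u|lborel. 2 * pi * \<bar>x\<bar> * B * indicator {a..2 * a} u)"
    proof (rule Bochner_Integration.integral_norm_bound_integral)
      show "integrable lborel (\<lambda>u. LINT t|\<nu>. indicator {a..2 * a} u *\<^sub>R (?d u * (indicator {u<..} t * \<theta> t)))"
        by (rule NL.integrable_snd[OF i])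
      show "integrable lborel (\<lambda>u. 2 * pi * \<bar>x\<bar> * B * indicator {a..2 * a} u)"
        by (intro integrable_mult_right integrable_indicator_Icc)
      show "norm (LINT t|\<nu>. indicator {a..2 * a} u *\<^sub>R (?d u * (indicator {u<..} t * \<theta> t))) \<le>
          2 * pi * \<bar>x\<bar> * B * indicator {a..2 * a} u" for u
        unfolding integral_scaleR_right integral_mult_right_zero
        using mult_left_mono[OF T[of u], of "2 * pi * \<bar>x\<bar>"]
        by (cases "u \<in> {a..2 * a}") (simp_all add: norm_mult abs_mult mult_ac)
    qed
    also have "\<dots> = 2 * pi * \<bar>x\<bar> * B * a" using a by simp
    finally show "cmod (LINT u|lborel. LINT t|\<nu>. indicator {a..2 * a} u *\<^sub>R (?d u * (indicator {u<..} t * \<theta> t)))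
        \<le> 2 * pi * \<bar>x\<bar> * a * B" by (simp add: mult_ac)
  qed
  finally show ?thesis by (simp add: B_def mult_ac)
qed

text \<open>The integral of the cutoff is a difference of two tail masses, hence the constant 4, and
  it vanishes for \<open>|x| > 1 / a\<close> because then the cutoff is zero on the support.\<close>

lemma kernel_large_frequencies:
  assumes fin: "weight < \<infinity>"
  shows "cmod (LINT t|\<nu>. trig_kernel x t * \<theta> t) \<le>
    cmod (LINT t|\<nu>. cis (2 * pi * x * t) * \<theta> t) + 4 * enn2real weight * indicator {- (1 / a)..1 / a} x"
proof -
  have i: "integrable \<nu> (\<lambda>t. cis (2 * pi * x * t) * \<theta> t)" "integrable \<nu> (\<lambda>t. indicator {t. t * \<bar>x\<bar> \<le> 1} t * \<theta> t)"
    by (intro integrable_bounded_mult[where M = 1]; auto simp: indicator_def)+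
  have "(LINT t|\<nu>. trig_kernel x t * \<theta> t) =
      (LINT t|\<nu>. cis (2 * pi * x * t) * \<theta> t) - (LINT t|\<nu>. indicator {t. t * \<bar>x\<bar> \<le> 1} t * \<theta> t)"
    unfolding trig_kernel_def left_diff_distrib by (rule Bochner_Integration.integral_diff[OF i])
  moreover have "cmod (LINT t|\<nu>. indicator {t. t * \<bar>x\<bar> \<le> 1} t * \<theta> t) \<le> 4 * enn2real weight * indicator {- (1 / a)..1 / a} x"
  proof (cases "a * \<bar>x\<bar> \<le> 1")
    case False
    have "indicator {t. t * \<bar>x\<bar> \<le> 1} t * \<theta> t = 0" for t
    proof (cases "t \<in> {a<..<2*a}")
      case True
      then have "a * \<bar>x\<bar> \<le> t * \<bar>x\<bar>" by (intro mult_right_mono) auto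
      with False show ?thesis by simp
    qed (use support in simp)
    then have "(LINT t|\<nu>. indicator {t. t * \<bar>x\<bar> \<le> 1} t * \<theta> t) = (LINT t|\<nu>. 0)"
      by (intro Bochner_Integration.integral_cong refl)
    then show ?thesis by simp
  next
    case True
    \<comment> \<open>At \<open>x = 0\<close> the cutoff is 1 everywhere; the value
      \<open>2 * a\<close> gives an empty tail beyond \<open>u\<close> and thus agrees with
      this.\<close>
    define u where "u = (if x = 0 then 2 * a else 1 / \<bar>x\<bar>)"
    have u: "a \<le> u" using True a by (auto simp: u_def field_simps)
    have "indicator {t. t * \<bar>x\<bar> \<le> 1} t * \<theta> t = indicator {a<..} t * \<theta> t - indicator {u<..} t * \<theta> t" for t
    proof (cases "t \<in> {a<..<2*a}")
      case True
      then have "(t * \<bar>x\<bar> \<le> 1) \<longleftrightarrow> \<not> u < t" by (auto simp: u_def field_simps)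
      with True show ?thesis by (simp add: indicator_def)
    qed (use support in simp)
    then have "(LINT t|\<nu>. indicator {t. t * \<bar>x\<bar> \<le> 1} t * \<theta> t) =
        (LINT t|\<nu>. indicator {a<..} t * \<theta> t - indicator {u<..} t * \<theta> t)"
      by (intro Bochner_Integration.integral_cong refl)
    also have "\<dots> = (LINT t|\<nu>. indicator {a<..} t * \<theta> t) - (LINT t|\<nu>. indicator {u<..} t * \<theta> t)"
      by (intro Bochner_Integration.integral_diff integrable_bounded_mult[where M = 1]) (auto simp: indicator_def)
    also have "cmod \<dots> \<le> 2 * enn2real weight + 2 * enn2real weight"
      by (intro order_trans[OF norm_triangle_ineq4] add_mono tail_bound fin u order_refl)
    also have "\<dots> = 4 * enn2real weight * indicator {- (1 / a)..1 / a} x"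
    proof -
      have "\<bar>x\<bar> \<le> 1 / a" using True a by (simp add: field_simps)
      then show ?thesis by (auto simp: indicator_def abs_le_iff)
    qed
    finally show ?thesis .
  qed
  ultimately show ?thesis
    by (smt (verit) norm_triangle_ineq4)
qed

lemma dyadic_bound:
  "(\<integral>\<^sup>+x. ennreal (cmod (LINT t|\<nu>. trig_kernel x t * \<theta> t) / \<bar>x\<bar>) \<partial>lborel) \<le> 100 * weight"
proof (cases "weight < \<infinity>")
  case False
  then have "weight = \<infinity>" by (metis infinity_ennreal_def top.not_eq_extremum)
  then show ?thesis by (simp add: ennreal_mult_top)
next
  case fin: True
  interpret nu: sigma_finite_measure \<nu> by (rule sigma_finite)
  define B where "B = enn2real weight"
  have B: "0 \<le> B" "weight = ennreal B" using fin by (auto simp: B_def)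
  let ?M = "\<lambda>x. LINT s|\<nu>. cis (2 * pi * x * s) * \<theta> s"
  let ?L = "\<lambda>x. indicator {x. 1 / (2 * a) < \<bar>x\<bar>} x / \<bar>x\<bar> * cmod (?M x) :: real"
  \<comment> \<open>The constant 40 covers both ranges: small frequencies give
    \<open>8 * pi * a * B\<close> with \<open>pi < 5\<close>, the transition zone gives
    \<open>4 * B / |x| \<le> 8 * a * B\<close>. Integration over an interval of length
    \<open>2 / a\<close> yields 80, and 80 plus 6 is rounded up to 100.\<close>
  let ?S = "\<lambda>x. 40 * a * B * indicator {- (1 / a)..1 / a} x :: real"
  have "cmod (LINT t|\<nu>. trig_kernel x t * \<theta> t) / \<bar>x\<bar> \<le> ?L x + ?S x" for x
  proof (cases "x = 0")
    case True then show ?thesis using a B by simp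
  next
    case x: False
    show ?thesis
    proof (cases "2 * a * \<bar>x\<bar> \<le> 1")
      case True
      have "cmod (LINT t|\<nu>. trig_kernel x t * \<theta> t) / \<bar>x\<bar> \<le> 8 * pi * a * \<bar>x\<bar> * B / \<bar>x\<bar>"
        unfolding B_def by (intro divide_right_mono kernel_small_frequencies fin True) simp
      also have "\<dots> = pi * (8 * a * B)" using x by simp
      also have "\<dots> \<le> 5 * (8 * a * B)" using a B pi_less_4 by (intro mult_right_mono) auto
      also have "\<dots> = ?S x"
      proof -
        have "\<bar>x\<bar> \<le> 1 / (2 * a)" using True a by (simp add: field_simps)
        also have "\<dots> \<le> 1 / a" using a by (simp add: field_simps)
        finally show ?thesis by (auto simp: indicator_def abs_le_iff)
      qed
      also have "\<dots> \<le> ?L x + ?S x" by simp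
      finally show ?thesis .
    next
      case False
      then have x2: "1 / (2 * a) < \<bar>x\<bar>" using a by (simp add: field_simps)
      have "1 / \<bar>x\<bar> \<le> 2 * a" using False x by (simp add: field_simps)
      then have "(4 * B * indicator {- (1 / a)..1 / a} x) * (1 / \<bar>x\<bar>) \<le> (4 * B * indicator {- (1 / a)..1 / a} x) * (2 * a)"
        using B by (intro mult_left_mono) auto
      also have "\<dots> \<le> ?S x" using a B by (auto simp: indicator_def)
      finally have "(4 * B * indicator {- (1 / a)..1 / a} x) / \<bar>x\<bar> \<le> ?S x" by simp
      moreover have "cmod (LINT t|\<nu>. trig_kernel x t * \<theta> t) / \<bar>x\<bar> \<le>
          (cmod (?M x) + 4 * B * indicator {- (1 / a)..1 / a} x) / \<bar>x\<bar>"
        unfolding B_def by (intro divide_right_mono kernel_large_frequencies fin) simp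
      ultimately show ?thesis using x2 by (simp add: add_divide_distrib)
    qed
  qed
  then have "(\<integral>\<^sup>+x. ennreal (cmod (LINT t|\<nu>. trig_kernel x t * \<theta> t) / \<bar>x\<bar>) \<partial>lborel) \<le>
      (\<integral>\<^sup>+x. ennreal (?L x) + ennreal (?S x) \<partial>lborel)"
    using a B by (intro nn_integral_mono) (auto simp flip: ennreal_plus intro!: ennreal_leI)
  also have "\<dots> = (\<integral>\<^sup>+x. ennreal (?L x) \<partial>lborel) + (\<integral>\<^sup>+x. ennreal (?S x) \<partial>lborel)"
    by (rule nn_integral_add) measurable
  also have "\<dots> \<le> 6 * weight + ennreal (80 * B)"
  proof (intro add_mono integral_large_frequencies)
    have "(\<integral>\<^sup>+x. ennreal (?S x) \<partial>lborel) = ennreal (LINT x|lborel. ?S x)"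
      using a B by (intro nn_integral_eq_integral integrable_mult_right integrable_indicator_Icc) auto
    also have "(LINT x|lborel. ?S x) = 80 * B" using a by simp
    finally show "(\<integral>\<^sup>+x. ennreal (?S x) \<partial>lborel) \<le> ennreal (80 * B)" by simp
  qed
  also have "\<dots> = ennreal (86 * B)"
    unfolding B(2) using B(1) by (simp flip: ennreal_plus ennreal_numeral ennreal_mult)
  also have "\<dots> \<le> ennreal (100 * B)" using B(1) by (intro ennreal_leI) simp
  also have "\<dots> = 100 * weight"
    unfolding B(2) using B(1) by (simp add: ennreal_mult)
  finally show ?thesis .
qed

end

section \<open>The Lebesgue-Stieltjes measure\<close>

lemma mono_tendsto_at_right:
  fixes g :: "real \<Rightarrow> real"
  assumes "mono g"
  shows "(g \<longlongrightarrow> Inf (g ` {t<..})) (at_right t)"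
proof (rule order_tendstoI)
  have bdd: "bdd_below (g ` {t<..})"
    using assms by (intro bdd_belowI[of _ "g t"]) (auto intro!: monoD[OF assms])
  fix c
  { assume c: "c < Inf (g ` {t<..})"
    have "c < g s" if "t < s" for s
      using c cInf_lower[OF _ bdd, of "g s"] that by auto
    then show "\<forall>\<^sub>F s in at_right t. c < g s"
      using eventually_at_right_less[of t] by (rule eventually_mono[rotated]) }
  { assume "Inf (g ` {t<..}) < c"
    then obtain s where s: "t < s" "g s < c"
      using bdd by (subst (asm) cInf_less_iff) auto
    then have "g r < c" if "r < s" for r
      using monoD[OF assms, of r s] that by auto
    then show "\<forall>\<^sub>F s in at_right t. g s < c"
      using s(1) unfolding eventually_at_right_field by blast }
qed

text \<open>The interval measure of the right-continuous version \<open>G\<close>. Since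
  \<open>g\<close> is constant on the negative axis, \<open>G\<close> equals \<open>g 0\<close>
  there, so a jump of \<open>g\<close> to the right of 0 becomes an atom at 0 and
  \<open>[0, b]\<close> receives \<open>G b - g 0\<close>.\<close>

lemma stieltjes_measure_mono:
  fixes g :: "real \<Rightarrow> real"
  assumes g: "mono g" and b: "\<And>t. \<bar>g t\<bar> \<le> B" and c: "\<And>t. t \<le> 0 \<Longrightarrow> g t = g 0"
  obtains \<mu> where "sets \<mu> = sets borel" "finite_measure \<mu>"
    "\<And>b. 0 \<le> b \<Longrightarrow> measure \<mu> {0..b} = Lim (at_right b) g - g 0"
proof -
  define G where "G = (\<lambda>t. Inf (g ` {t<..}))"
  have lim: "(g \<longlongrightarrow> G t) (at_right t)" for t unfolding G_def by (rule mono_tendsto_at_right[OF g])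
  have Lim: "Lim (at_right t) g = G t" for t by (intro tendsto_Lim lim) simp
  have le: "g t \<le> G t" for t
  proof (rule tendsto_lowerbound[OF lim])
    show "\<forall>\<^sub>F s in at_right t. g t \<le> g s"
      using eventually_at_right_less[of t] by eventually_elim (rule monoD[OF g less_imp_le])
  qed simp
  have ge: "G t \<le> g s" if "t < s" for t s
  proof (rule tendsto_upperbound[OF lim])
    have "g r \<le> g s" if "r < s" for r using monoD[OF g, of r s] that by simp
    then show "\<forall>\<^sub>F r in at_right t. g r \<le> g s"
      using that unfolding eventually_at_right_field by blast
  qed simp
  have mono: "G x \<le> G y" if "x \<le> y" for x y
    using that ge[of x y] le[of y] by (cases "x = y") auto
  have rc: "continuous (at_right t) G" for t
    unfolding continuous_within
  proof (rule order_tendstoI)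
    fix d assume "d < G t"
    then have "d < G s" if "t < s" for s using mono[of t s] that by simp
    then show "\<forall>\<^sub>F s in at_right t. d < G s"
      using eventually_at_right_less[of t] by (rule eventually_mono[rotated])
  next
    fix d assume "G t < d"
    then obtain s where s: "t < s" "\<And>r. t < r \<Longrightarrow> r < s \<Longrightarrow> g r < d"
      using order_tendstoD(2)[OF lim] unfolding eventually_at_right_field by blast
    have "G r < d" if "t < r" "r < s" for r
      using ge[of r "(r + s) / 2"] s(2)[of "(r + s) / 2"] that by auto
    then show "\<forall>\<^sub>F s in at_right t. G s < d"
      using s(1) unfolding eventually_at_right_field by blast
  qed
  have Gneg: "G t = g 0" if "t < 0" for t
    using le[of t] ge[OF that] c[of t] that by auto
  have GB: "\<bar>G t\<bar> \<le> B" for t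
    using le[of t] ge[of t "t + 1"] b[of t] b[of "t + 1"] by (simp add: abs_le_iff)
  define \<mu> where "\<mu> = interval_measure G"
  have Ioc: "emeasure \<mu> {x<..y} = ennreal (G y - G x)" if "x \<le> y" for x y
    unfolding \<mu>_def by (rule emeasure_interval_measure_Ioc[OF that mono rc])
  have sets: "sets \<mu> = sets borel" by (simp add: \<mu>_def)
  note [measurable_cong] = sets
  have fin: "finite_measure \<mu>"
  proof
    have un: "(\<Union>n. {- real n<..real n}) = UNIV"
    proof (intro equalityI subsetI UNIV_I)
      fix x :: real
      obtain n :: nat where "\<bar>x\<bar> < real n" using reals_Archimedean2 by blast
      then show "x \<in> (\<Union>n. {- real n<..real n})" by (intro UN_I[of n]) (auto simp: abs_less_iff)
    qed
    have "emeasure \<mu> UNIV = (SUP n. emeasure \<mu> {- real n<..real n})"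
      unfolding un[symmetric] by (rule SUP_emeasure_incseq[symmetric]) (auto simp: sets incseq_def)
    also have "\<dots> \<le> ennreal (2 * B)"
    proof (rule SUP_least)
      fix n
      show "emeasure \<mu> {- real n<..real n} \<le> ennreal (2 * B)"
        using GB[of "real n"] GB[of "- real n"] by (subst Ioc) (auto intro!: ennreal_leI)
    qed
    also have "\<dots> < \<infinity>" by simp
    finally show "emeasure \<mu> (space \<mu>) \<noteq> \<infinity>" by (simp add: \<mu>_def)
  qed
  \<comment> \<open>Interval measures are known on half-open intervals \<open>(x, y]\<close>;
    knowing that \<open>(-1, 0)\<close> is null converts the value on \<open>(-1, b]\<close> into
    the one on \<open>[0, b]\<close>.\<close>
  have null: "emeasure \<mu> {-1<..<0} = 0"
  proof -
    have "{-1<..<0::real} = (\<Union>n. {-1<..- 1 / real (Suc n)})"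
    proof (intro equalityI subsetI)
      fix x :: real assume x: "x \<in> {-1<..<0}"
      obtain n :: nat where "1 / real (Suc n) < - x"
        using x nat_approx_posE[of "- x"] by auto
      then show "x \<in> (\<Union>n. {-1<..- 1 / real (Suc n)})" using x by (auto intro!: exI[of _ n])
    next
      fix x :: real assume "x \<in> (\<Union>n. {-1<..- 1 / real (Suc n)})"
      then obtain n where n: "-1 < x" "x \<le> - (1 / (1 + real n))" by auto
      moreover have "0 < 1 / (1 + real n)" by simp
      ultimately show "x \<in> {-1<..<0}" unfolding greaterThanLessThan_iff by linarith
    qed
    moreover have "{-1<..- 1 / real (Suc n)} \<in> null_sets \<mu>" for n
    proof -
      have n: "- 1 / real (Suc n) < 0" "-1 \<le> - 1 / real (Suc n)" by (simp_all add: field_simps)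
      then show ?thesis by (auto simp: null_sets_def sets Ioc Gneg)
    qed
    ultimately have "{-1<..<0} \<in> null_sets \<mu>" by (simp only: null_sets_UN)
    then show ?thesis by auto
  qed
  have "measure \<mu> {0..b} = Lim (at_right b) g - g 0" if "0 \<le> b" for b
  proof -
    have "{-1<..b} = {-1<..<0} \<union> {0..b}" using that by auto
    then have "emeasure \<mu> {-1<..b} = emeasure \<mu> {-1<..<0} + emeasure \<mu> {0..b}"
      by (simp only:) (rule plus_emeasure[symmetric], auto simp: sets)
    then have "emeasure \<mu> {0..b} = ennreal (G b - g 0)"
      using that by (simp add: Ioc null Gneg)
    moreover have "g 0 \<le> G b" using le[of b] monoD[OF g that] by simp
    ultimately show ?thesis unfolding Lim measure_def by simp
  qed
  then show thesis using that sets fin by blast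
qed

text \<open>With the variation \<open>V\<close> of \<open>f\<close> on \<open>[0, t]\<close>, the
  functions \<open>V\<close>, \<open>V - Re f\<close> and \<open>V - Im f\<close> are increasing,
  and \<open>f\<close> is \<open>(1 + i) V - (V - Re f) - i (V - Im f)\<close>. Freezing the
  argument at \<open>max 0 t\<close> makes them constant on the negative axis.\<close>

lemma bounded_variation_decomposition:
  assumes bv: "bounded_variation_on {0..} f"
  obtains g1 g2 g3 :: "real \<Rightarrow> real" and B where
    "mono g1" "mono g2" "mono g3" "\<And>t. \<bar>g1 t\<bar> \<le> B" "\<And>t. \<bar>g2 t\<bar> \<le> B" "\<And>t. \<bar>g3 t\<bar> \<le> B"
    "\<And>t. t \<le> 0 \<Longrightarrow> g1 t = g1 0" "\<And>t. t \<le> 0 \<Longrightarrow> g2 t = g2 0" "\<And>t. t \<le> 0 \<Longrightarrow> g3 t = g3 0"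
    "\<And>t. 0 \<le> t \<Longrightarrow> f t = (1 + \<i>) * of_real (g1 t) - of_real (g2 t) - \<i> * of_real (g3 t)"
proof -
  obtain B where B: "\<And>(n::nat) \<tau>. (\<forall>i\<le>n. \<tau> i \<in> {0..}) \<Longrightarrow> (\<forall>i<n. \<tau> i \<le> \<tau> (Suc i)) \<Longrightarrow>
      (\<Sum>i<n. cmod (f (\<tau> (Suc i)) - f (\<tau> i))) \<le> B"
    using bv unfolding bounded_variation_on_def by blast
  define S where "S = (\<lambda>t. {(\<Sum>i<n. cmod (f (\<tau> (Suc i)) - f (\<tau> i))) | (n::nat) \<tau>.
      (\<forall>i\<le>n. \<tau> i \<in> {0..t}) \<and> (\<forall>i<n. \<tau> i \<le> \<tau> (Suc i))})"
  define V where "V = (\<lambda>t. Sup (S t))"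
  have SB: "s \<le> B" if "s \<in> S t" for s t
    using that B unfolding S_def by force
  then have bdd: "bdd_above (S t)" for t unfolding bdd_above_def by blast
  have S0: "0 \<in> S t" if "0 \<le> t" for t
    unfolding S_def using that by (auto intro!: exI[of _ 0] exI[of _ "\<lambda>_. 0"])
  have V0: "0 \<le> V t" "V t \<le> B" if "0 \<le> t" for t
    unfolding V_def using S0[OF that] by (auto intro: cSup_upper bdd cSup_least SB)
  have step: "V s + cmod (f t - f s) \<le> V t" if st: "0 \<le> s" "s \<le> t" for s t
  proof -
    have "y \<le> V t - cmod (f t - f s)" if "y \<in> S s" for y
    proof -
      obtain n :: nat and \<tau> where \<tau>: "y = (\<Sum>i<n. cmod (f (\<tau> (Suc i)) - f (\<tau> i)))"
          "\<And>i. i \<le> n \<Longrightarrow> \<tau> i \<in> {0..s}" "\<And>i. i < n \<Longrightarrow> \<tau> i \<le> \<tau> (Suc i)"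
        using \<open>y \<in> S s\<close> unfolding S_def by blast
      \<comment> \<open>A partition of \<open>[0, s]\<close> is continued by the points
        \<open>s\<close> and \<open>t\<close>, which adds at least \<open>cmod (f t - f s)\<close>
        to its variation sum.\<close>
      define \<rho> where "\<rho> = (\<lambda>i. if i \<le> n then \<tau> i else if i = Suc n then s else t)"
      have "(\<Sum>i<Suc (Suc n). cmod (f (\<rho> (Suc i)) - f (\<rho> i))) =
          (\<Sum>i<n. cmod (f (\<rho> (Suc i)) - f (\<rho> i))) + cmod (f s - f (\<tau> n)) + cmod (f t - f s)"
        by (simp add: \<rho>_def)
      also have "(\<Sum>i<n. cmod (f (\<rho> (Suc i)) - f (\<rho> i))) = y"
        unfolding \<tau>(1) by (intro sum.cong) (auto simp: \<rho>_def)
      finally have "y + cmod (f t - f s) \<le> (\<Sum>i<Suc (Suc n). cmod (f (\<rho> (Suc i)) - f (\<rho> i)))" by simp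
      also have "\<dots> \<le> V t"
        unfolding V_def
      proof (rule cSup_upper[OF _ bdd])
        have "\<forall>i\<le>Suc (Suc n). \<rho> i \<in> {0..t}"
          using \<tau>(2) st by (force simp: \<rho>_def)
        moreover have "\<forall>i<Suc (Suc n). \<rho> i \<le> \<rho> (Suc i)"
        proof (intro allI impI)
          fix i assume "i < Suc (Suc n)"
          then consider "i < n" | "i = n" | "i = Suc n" by linarith
          then show "\<rho> i \<le> \<rho> (Suc i)" using \<tau>(2,3) st by cases (auto simp: \<rho>_def)
        qed
        ultimately show "(\<Sum>i<Suc (Suc n). cmod (f (\<rho> (Suc i)) - f (\<rho> i))) \<in> S t"
          unfolding S_def by blast
      qed
      finally show ?thesis by simp
    qed
    then have "V s \<le> V t - cmod (f t - f s)"
      unfolding V_def using S0[OF st(1)] by (intro cSup_least) auto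
    then show ?thesis by simp
  qed
  define g1 where "g1 = (\<lambda>t. V (max 0 t))"
  define g2 where "g2 = (\<lambda>t. V (max 0 t) - Re (f (max 0 t)))"
  define g3 where "g3 = (\<lambda>t. V (max 0 t) - Im (f (max 0 t)))"
  have m: "max 0 s \<le> max 0 t" "0 \<le> max 0 s" if "s \<le> t" for s t :: real using that by auto
  have "mono g1"
  proof (rule monoI)
    fix s t :: real assume "s \<le> t"
    then show "g1 s \<le> g1 t" using step[of "max 0 s" "max 0 t"] m[of s t] norm_ge_zero[of "f (max 0 t) - f (max 0 s)"]
      unfolding g1_def by (smt (verit))
  qed
  moreover have "mono g2"
  proof (rule monoI)
    fix s t :: real assume "s \<le> t"
    then show "g2 s \<le> g2 t" using step[of "max 0 s" "max 0 t"] m[of s t] complex_Re_le_cmod[of "f (max 0 t) - f (max 0 s)"]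
      unfolding g2_def by simp
  qed
  moreover have "mono g3"
  proof (rule monoI)
    fix s t :: real assume "s \<le> t"
    then show "g3 s \<le> g3 t" using step[of "max 0 s" "max 0 t"] m[of s t] abs_Im_le_cmod[of "f (max 0 t) - f (max 0 s)"]
      unfolding g3_def minus_complex.simps by linarith
  qed
  moreover have fB: "cmod (f (max 0 t)) \<le> cmod (f 0) + B" for t
    using step[of 0 "max 0 t"] V0[of 0] V0[of "max 0 t"] norm_triangle_sub[of "f (max 0 t)" "f 0"] by simp
  have "\<bar>g1 t\<bar> \<le> cmod (f 0) + 2 * B" "\<bar>g2 t\<bar> \<le> cmod (f 0) + 2 * B" "\<bar>g3 t\<bar> \<le> cmod (f 0) + 2 * B" for t
  proof -
    note V0[of "max 0 t"] fB[of t] abs_Re_le_cmod[of "f (max 0 t)"] abs_Im_le_cmod[of "f (max 0 t)"] norm_ge_zero[of "f 0"]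
    then show "\<bar>g1 t\<bar> \<le> cmod (f 0) + 2 * B" "\<bar>g2 t\<bar> \<le> cmod (f 0) + 2 * B" "\<bar>g3 t\<bar> \<le> cmod (f 0) + 2 * B"
      unfolding g1_def g2_def g3_def by (smt (verit) max.cobounded1)+
  qed
  moreover have "f t = (1 + \<i>) * of_real (g1 t) - of_real (g2 t) - \<i> * of_real (g3 t)" if "0 \<le> t" for t
    using that by (simp add: g1_def g2_def g3_def complex_eq_iff)
  moreover have "g1 t = g1 0" "g2 t = g2 0" "g3 t = g3 0" if "t \<le> 0" for t
    using that by (simp_all add: g1_def g2_def g3_def)
  ultimately show thesis using that by blast
qed

text \<open>A complex measure is represented by one positive measure and one density, so the three
  measures must share a base. Their sum dominates each of them, and Radon-Nikodym supplies the
  densities.\<close>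

lemma common_density:
  fixes \<mu>1 \<mu>2 \<mu>3 :: "real measure"
  assumes s [simp]: "sets \<mu>1 = sets borel" "sets \<mu>2 = sets borel" "sets \<mu>3 = sets borel"
    and f: "finite_measure \<mu>1" "finite_measure \<mu>2" "finite_measure \<mu>3"
  obtains \<nu> :: "real measure" and D1 D2 D3 :: "real \<Rightarrow> real" where
    "sets \<nu> = sets borel" "finite_measure \<nu>" "integrable \<nu> D1" "integrable \<nu> D2" "integrable \<nu> D3"
    "\<And>A. A \<in> sets borel \<Longrightarrow> (LINT t:A|\<nu>. D1 t) = measure \<mu>1 A"
    "\<And>A. A \<in> sets borel \<Longrightarrow> (LINT t:A|\<nu>. D2 t) = measure \<mu>2 A"
    "\<And>A. A \<in> sets borel \<Longrightarrow> (LINT t:A|\<nu>. D3 t) = measure \<mu>3 A"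
proof -
  define \<nu> where "\<nu> = measure_of UNIV (sets borel) (\<lambda>A. emeasure \<mu>1 A + emeasure \<mu>2 A + emeasure \<mu>3 A)"
  have sets_nu [simp]: "sets \<nu> = sets borel"
    unfolding \<nu>_def using sets.sigma_sets_eq[of "borel :: real measure"] by simp
  have em: "emeasure \<nu> A = emeasure \<mu>1 A + emeasure \<mu>2 A + emeasure \<mu>3 A" if "A \<in> sets borel" for A
  proof (rule emeasure_measure_of[OF \<nu>_def])
    show "countably_additive (sets \<nu>) (\<lambda>A. emeasure \<mu>1 A + emeasure \<mu>2 A + emeasure \<mu>3 A)"
    proof (rule countably_additiveI)
      fix A :: "nat \<Rightarrow> real set" assume A: "range A \<subseteq> sets \<nu>" "disjoint_family A"
      have "(\<Sum>i. emeasure \<mu>1 (A i) + emeasure \<mu>2 (A i) + emeasure \<mu>3 (A i)) =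
          (\<Sum>i. emeasure \<mu>1 (A i)) + (\<Sum>i. emeasure \<mu>2 (A i)) + (\<Sum>i. emeasure \<mu>3 (A i))"
        by (simp add: suminf_add[symmetric])
      also have "\<dots> = emeasure \<mu>1 (\<Union>i. A i) + emeasure \<mu>2 (\<Union>i. A i) + emeasure \<mu>3 (\<Union>i. A i)"
        using A by (simp add: suminf_emeasure)
      finally show "(\<Sum>i. emeasure \<mu>1 (A i) + emeasure \<mu>2 (A i) + emeasure \<mu>3 (A i)) =
          emeasure \<mu>1 (\<Union>i. A i) + emeasure \<mu>2 (\<Union>i. A i) + emeasure \<mu>3 (\<Union>i. A i)" .
    qed
  qed (use that in \<open>auto simp: positive_def\<close>)
  have sp: "space \<nu> = UNIV" "space \<mu>1 = UNIV" "space \<mu>2 = UNIV" "space \<mu>3 = UNIV"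
    using sets_eq_imp_space_eq[OF sets_nu] sets_eq_imp_space_eq[OF s(1)] sets_eq_imp_space_eq[OF s(2)]
      sets_eq_imp_space_eq[OF s(3)] by simp_all
  have fin: "finite_measure \<nu>"
    using f[THEN finite_measure.emeasure_finite[of _ UNIV]] by (intro finite_measureI) (simp add: sp em)
  interpret finite_measure \<nu> by (rule fin)
  have dens: "\<exists>D :: real \<Rightarrow> real. integrable \<nu> D \<and> (\<forall>A\<in>sets borel. (LINT t:A|\<nu>. D t) = measure \<mu> A)"
    if \<mu>: "sets \<mu> = sets borel" "finite_measure \<mu>" "\<And>A. A \<in> sets borel \<Longrightarrow> emeasure \<mu> A \<le> emeasure \<nu> A" for \<mu>
  proof -
    have ac: "absolutely_continuous \<nu> \<mu>"
      using \<mu>(1,3) by (auto simp: absolutely_continuous_def null_sets_def) (metis le_zero_eq)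
    obtain D where D [measurable]: "D \<in> borel_measurable \<nu>" and
        ae: "AE x in \<nu>. RN_deriv \<nu> \<mu> x = ennreal (D x)" and nn: "\<And>x. 0 \<le> D x"
      using real_RN_deriv[OF \<mu>(2) ac] \<mu>(1) by (metis sets_nu)
    have "\<mu> = density \<nu> (RN_deriv \<nu> \<mu>)"
      using density_RN_deriv[OF ac] \<mu>(1) by simp
    also have "\<dots> = density \<nu> (\<lambda>x. ennreal (D x))"
      using ae by (intro density_cong) auto
    finally have eq: "\<mu> = density \<nu> (\<lambda>x. ennreal (D x))" .
    have A: "(\<integral>\<^sup>+x. ennreal (indicator A x * D x) \<partial>\<nu>) = ennreal (measure \<mu> A)" if "A \<in> sets borel" for A
    proof -
      have "ennreal (measure \<mu> A) = emeasure \<mu> A"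
        using finite_measure.emeasure_eq_measure[OF \<mu>(2)] by simp
      also have "\<dots> = (\<integral>\<^sup>+x. ennreal (D x) * indicator A x \<partial>\<nu>)"
        by (subst eq) (use that in \<open>simp add: emeasure_density\<close>)
      also have "\<dots> = (\<integral>\<^sup>+x. ennreal (indicator A x * D x) \<partial>\<nu>)"
        by (intro nn_integral_cong) (auto simp: indicator_def)
      finally show ?thesis by simp
    qed
    have I: "(LINT t:A|\<nu>. D t) = measure \<mu> A" if "A \<in> sets borel" for A
      unfolding set_lebesgue_integral_def
    proof (subst integral_eq_nn_integral)
      show "(\<lambda>t. indicat_real A t *\<^sub>R D t) \<in> borel_measurable \<nu>"
        using that by (intro borel_measurable_scaleR borel_measurable_indicator) auto
    qed (use A[OF that] nn in auto)
    have "integrable \<nu> D"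
      using A[of UNIV] nn by (intro integrableI_nonneg) auto
    with I show ?thesis by blast
  qed
  obtain D1 where D1: "integrable \<nu> D1" "\<And>A. A \<in> sets borel \<Longrightarrow> (LINT t:A|\<nu>. D1 t) = measure \<mu>1 A"
    using dens[OF s(1) f(1)] by (auto simp: em add_increasing2 add.assoc)
  obtain D2 where D2: "integrable \<nu> D2" "\<And>A. A \<in> sets borel \<Longrightarrow> (LINT t:A|\<nu>. D2 t) = measure \<mu>2 A"
    using dens[OF s(2) f(2)] by (auto simp: em add_increasing2 add_increasing add.assoc)
  obtain D3 where D3: "integrable \<nu> D3" "\<And>A. A \<in> sets borel \<Longrightarrow> (LINT t:A|\<nu>. D3 t) = measure \<mu>3 A"
    using dens[OF s(3) f(3)] by (auto simp: em add_increasing)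
  show thesis by (rule that[OF sets_nu fin D1(1) D2(1) D3(1) D1(2) D2(2) D3(2)])
qed

text \<open>All four claims pass through the decomposition into monotone functions: these have right
  limits, are measurable, have countably many discontinuities and generate measures. Nothing is
  known of \<open>f\<close> on the negative axis, hence the indicator in the third claim.\<close>

lemma bounded_variation_regularity:
  assumes bv: "bounded_variation_on {0..} f"
  shows "\<And>b. 0 \<le> b \<Longrightarrow> (f \<longlongrightarrow> Lim (at_right b) f) (at_right b)"
    and "\<exists>N. countable N \<and> (\<forall>b>0. b \<notin> N \<longrightarrow> Lim (at_right b) f = f b)"
    and "(\<lambda>t. indicator {0..} t *\<^sub>R f t) \<in> borel_measurable borel"
    and "\<exists>\<nu> \<theta>. is_stieltjes f \<nu> \<theta>"
proof -
  obtain g1 g2 g3 :: "real \<Rightarrow> real" and B where m: "mono g1" "mono g2" "mono g3"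
    and b: "\<And>t. \<bar>g1 t\<bar> \<le> B" "\<And>t. \<bar>g2 t\<bar> \<le> B" "\<And>t. \<bar>g3 t\<bar> \<le> B"
    and c: "\<And>t. t \<le> 0 \<Longrightarrow> g1 t = g1 0" "\<And>t. t \<le> 0 \<Longrightarrow> g2 t = g2 0" "\<And>t. t \<le> 0 \<Longrightarrow> g3 t = g3 0"
    and f: "\<And>t. 0 \<le> t \<Longrightarrow> f t = (1 + \<i>) * of_real (g1 t) - of_real (g2 t) - \<i> * of_real (g3 t)"
    using bounded_variation_decomposition[OF bv] by blast
  define F where "F = (\<lambda>t. (1 + \<i>) * of_real (g1 t) - of_real (g2 t) - \<i> * of_real (g3 t))"
  have ex: "(g \<longlongrightarrow> Lim (at_right t) g) (at_right t)" if "mono g" for g :: "real \<Rightarrow> real" and t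
    using tendsto_Lim[OF _ mono_tendsto_at_right[OF that], of t] mono_tendsto_at_right[OF that, of t] by simp
  have lim: "(f \<longlongrightarrow> (1 + \<i>) * of_real (Lim (at_right t) g1) - of_real (Lim (at_right t) g2)
      - \<i> * of_real (Lim (at_right t) g3)) (at_right t)" if "0 \<le> t" for t
  proof (rule Lim_transform_eventually)
    show "(F \<longlongrightarrow> (1 + \<i>) * of_real (Lim (at_right t) g1) - of_real (Lim (at_right t) g2)
      - \<i> * of_real (Lim (at_right t) g3)) (at_right t)"
      unfolding F_def by (intro tendsto_intros ex m)
    show "\<forall>\<^sub>F s in at_right t. F s = f s"
      using that by (auto simp: eventually_at_right_field F_def f intro!: exI[of _ "t + 1"])
  qed
  have Lim: "Lim (at_right t) f = (1 + \<i>) * of_real (Lim (at_right t) g1) - of_real (Lim (at_right t) g2)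
      - \<i> * of_real (Lim (at_right t) g3)" if "0 \<le> t" for t
    by (rule tendsto_Lim[OF _ lim[OF that]]) simp
  show "(f \<longlongrightarrow> Lim (at_right b) f) (at_right b)" if "0 \<le> b" for b
    unfolding Lim[OF that] by (rule lim[OF that])
  let ?N = "{a. \<not> isCont g1 a} \<union> {a. \<not> isCont g2 a} \<union> {a. \<not> isCont g3 a}"
  have "countable ?N" by (intro countable_Un mono_ctble_discont m)
  moreover have "Lim (at_right b) f = f b" if "0 < b" "b \<notin> ?N" for b
  proof -
    have L: "Lim (at_right b) g = g b" if "isCont g b" for g :: "real \<Rightarrow> real"
      using that unfolding isCont_def
      by (intro tendsto_Lim) (auto intro: tendsto_mono[OF at_le])
    show ?thesis using that by (auto simp: Lim f L)
  qed
  ultimately show "\<exists>N. countable N \<and> (\<forall>b>0. b \<notin> N \<longrightarrow> Lim (at_right b) f = f b)"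
    by blast
  have [measurable]: "g1 \<in> borel_measurable borel" "g2 \<in> borel_measurable borel" "g3 \<in> borel_measurable borel"
    by (intro borel_measurable_mono m)+
  have "(\<lambda>t. indicator {0..} t *\<^sub>R f t) = (\<lambda>t. indicator {0..} t *\<^sub>R F t)"
    by (auto simp: fun_eq_iff F_def f indicator_def)
  also have "\<dots> \<in> borel_measurable borel" unfolding F_def by measurable
  finally show "(\<lambda>t. indicator {0..} t *\<^sub>R f t) \<in> borel_measurable borel" .
  obtain \<mu>1 where \<mu>1: "sets \<mu>1 = sets borel" "finite_measure \<mu>1"
      "\<And>b. 0 \<le> b \<Longrightarrow> measure \<mu>1 {0..b} = Lim (at_right b) g1 - g1 0"
    using stieltjes_measure_mono[OF m(1) b(1) c(1)] by blast
  obtain \<mu>2 where \<mu>2: "sets \<mu>2 = sets borel" "finite_measure \<mu>2"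
      "\<And>b. 0 \<le> b \<Longrightarrow> measure \<mu>2 {0..b} = Lim (at_right b) g2 - g2 0"
    using stieltjes_measure_mono[OF m(2) b(2) c(2)] by blast
  obtain \<mu>3 where \<mu>3: "sets \<mu>3 = sets borel" "finite_measure \<mu>3"
      "\<And>b. 0 \<le> b \<Longrightarrow> measure \<mu>3 {0..b} = Lim (at_right b) g3 - g3 0"
    using stieltjes_measure_mono[OF m(3) b(3) c(3)] by blast
  obtain \<nu> :: "real measure" and D1 D2 D3 :: "real \<Rightarrow> real" where
    \<nu>: "sets \<nu> = sets borel" "finite_measure \<nu>" and D: "integrable \<nu> D1" "integrable \<nu> D2" "integrable \<nu> D3"
    and I: "\<And>A. A \<in> sets borel \<Longrightarrow> (LINT t:A|\<nu>. D1 t) = measure \<mu>1 A"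
    "\<And>A. A \<in> sets borel \<Longrightarrow> (LINT t:A|\<nu>. D2 t) = measure \<mu>2 A"
    "\<And>A. A \<in> sets borel \<Longrightarrow> (LINT t:A|\<nu>. D3 t) = measure \<mu>3 A"
    using common_density[OF \<mu>1(1) \<mu>2(1) \<mu>3(1) \<mu>1(2) \<mu>2(2) \<mu>3(2)] by blast
  define E where "E = (\<lambda>t. (1 + \<i>) * of_real (D1 t) - of_real (D2 t) - \<i> * of_real (D3 t))"
  have E: "integrable \<nu> E"
    unfolding E_def using D by (intro Bochner_Integration.integrable_diff integrable_mult_right integrable_of_real)
  have "is_stieltjes f \<nu> (\<lambda>t. indicator {0..} t *\<^sub>R E t)"
    unfolding is_stieltjes_def
  proof (intro conjI allI impI)
    show "sigma_finite_measure \<nu>" using \<nu>(2) by (rule finite_measure.axioms)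
    show "sets \<nu> = sets borel" by fact
    show "integrable \<nu> (\<lambda>t. indicator {0..} t *\<^sub>R E t)"
      using E \<nu>(1) by (intro integrable_mult_indicator) auto
    show "indicator {0..} t *\<^sub>R E t = 0" if "t < 0" for t using that by simp
    fix b :: real assume b: "0 \<le> b"
    have ind: "integrable \<nu> (\<lambda>t. indicator {0..b} t *\<^sub>R D t)" if "integrable \<nu> D" for D :: "real \<Rightarrow> real"
      using that \<nu>(1) by (intro integrable_mult_indicator) auto
    have "(LINT t:{0..b}|\<nu>. indicator {0..} t *\<^sub>R E t) =
       (LINT t|\<nu>. (1 + \<i>) * of_real (indicator {0..b} t *\<^sub>R D1 t) - of_real (indicator {0..b} t *\<^sub>R D2 t)
          - \<i> * of_real (indicator {0..b} t *\<^sub>R D3 t))"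
      unfolding set_lebesgue_integral_def E_def
      by (intro Bochner_Integration.integral_cong refl) (auto simp: indicator_def)
    also have "\<dots> = (1 + \<i>) * of_real (LINT t:{0..b}|\<nu>. D1 t) - of_real (LINT t:{0..b}|\<nu>. D2 t)
          - \<i> * of_real (LINT t:{0..b}|\<nu>. D3 t)"
      unfolding set_lebesgue_integral_def using ind[OF D(1)] ind[OF D(2)] ind[OF D(3)]
      by (simp only: Bochner_Integration.integral_diff Bochner_Integration.integrable_diff integrable_mult_right
          integrable_of_real integral_mult_right_zero integral_complex_of_real)
    also have "\<dots> = Lim (at_right b) f - f 0"
      using b by (simp add: I \<mu>1(3) \<mu>2(3) \<mu>3(3) Lim f algebra_simps)
    finally show "(LINT t:{0..b}|\<nu>. indicator {0..} t *\<^sub>R E t) = Lim (at_right b) f - f 0" .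
  qed
  then show "\<exists>\<nu> \<theta>. is_stieltjes f \<nu> \<theta>" by blast
qed

text \<open>Since \<open>f\<close> vanishes at infinity, the total mass is \<open>- f 0\<close>;
  subtracting the mass of \<open>[0, b]\<close> leaves the tail.\<close>

lemma is_stieltjes_tail:
  assumes bv: "bounded_variation_on {0..} f" and f0: "(f \<longlongrightarrow> 0) at_top" and st: "is_stieltjes f \<nu> \<theta>"
    and b: "0 \<le> b"
  shows "(LINT s|\<nu>. indicator {b<..} s *\<^sub>R \<theta> s) = - Lim (at_right b) f"
proof -
  have i: "integrable \<nu> \<theta>" and s [simp]: "sets \<nu> = sets borel" and n: "\<And>t. t < 0 \<Longrightarrow> \<theta> t = 0"
    and I: "\<And>b. 0 \<le> b \<Longrightarrow> (LINT t:{0..b}|\<nu>. \<theta> t) = Lim (at_right b) f - f 0"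
    using st by (auto simp: is_stieltjes_def)
  have ii: "integrable \<nu> (\<lambda>s. indicator A s *\<^sub>R \<theta> s)" if "A \<in> sets borel" for A
    using i that by (intro integrable_mult_indicator) auto
  have "(\<lambda>n. LINT t:{0..real n}|\<nu>. \<theta> t) \<longlonglongrightarrow> (LINT t|\<nu>. \<theta> t)"
    unfolding set_lebesgue_integral_def
  proof (rule integral_dominated_convergence[where w = "\<lambda>t. cmod (\<theta> t)"])
    show "AE t in \<nu>. (\<lambda>k. indicator {0..real k} t *\<^sub>R \<theta> t) \<longlonglongrightarrow> \<theta> t"
    proof (rule AE_I2, rule tendsto_eventually)
      fix t
      have "\<forall>\<^sub>F k in sequentially. t < real k"
        using filterlim_real_sequentially unfolding filterlim_at_top_dense by blast
      then show "\<forall>\<^sub>F k in sequentially. indicator {0..real k} t *\<^sub>R \<theta> t = \<theta> t"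
        by eventually_elim (use n[of t] in \<open>auto simp: indicator_def not_le\<close>)
    qed
    show "(\<lambda>t. indicator {0..real k} t *\<^sub>R \<theta> t) \<in> borel_measurable \<nu>" for k
      by (rule borel_measurable_integrable[OF ii]) simp
  qed (use i in \<open>auto simp: indicator_def\<close>)
  moreover have "(\<lambda>n. LINT t:{0..real n}|\<nu>. \<theta> t) \<longlonglongrightarrow> 0 - f 0"
  proof -
    have "(\<lambda>n. Lim (at_right (real n)) f) \<longlonglongrightarrow> 0"
    proof (rule LIMSEQ_I)
      fix e :: real assume e: "0 < e"
      obtain N where N: "\<And>t. N \<le> t \<Longrightarrow> cmod (f t) < e / 2"
        using f0 e unfolding tendsto_iff eventually_at_top_linorder by (metis dist_0_norm dist_commute half_gt_zero)
      have "cmod (Lim (at_right (real k)) f) \<le> e / 2" if "N \<le> real k" for k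
      proof (rule tendsto_upperbound[OF tendsto_norm[OF bounded_variation_regularity(1)[OF bv, of "real k"]]])
        show "\<forall>\<^sub>F x in at_right (real k). cmod (f x) \<le> e / 2"
          using N that by (auto simp: eventually_at_right_field intro!: exI[of _ "real k + 1"] less_imp_le)
      qed auto
      then show "\<exists>no. \<forall>k\<ge>no. cmod (Lim (at_right (real k)) f - 0) < e"
        using e by (intro exI[of _ "nat \<lceil>N\<rceil>"]) (force simp: nat_ceiling_le_eq)
    qed
    from tendsto_diff[OF this tendsto_const, of "f 0"] show ?thesis by (simp add: I)
  qed
  ultimately have total: "(LINT t|\<nu>. \<theta> t) = - f 0"
    using LIMSEQ_unique by fastforce
  have "\<theta> t = indicator {0..b} t *\<^sub>R \<theta> t + indicator {b<..} t *\<^sub>R \<theta> t" for t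
    using n[of t] b by (auto simp: indicator_def not_le)
  then have "(LINT t|\<nu>. \<theta> t) = (LINT t|\<nu>. indicator {0..b} t *\<^sub>R \<theta> t + indicator {b<..} t *\<^sub>R \<theta> t)"
    by (intro Bochner_Integration.integral_cong refl)
  also have "\<dots> = (LINT t:{0..b}|\<nu>. \<theta> t) + (LINT t|\<nu>. indicator {b<..} t *\<^sub>R \<theta> t)"
    unfolding set_lebesgue_integral_def by (intro Bochner_Integration.integral_add ii) auto
  finally show ?thesis using total I[OF b] by (simp add: add_eq_0_iff)
qed

lemma is_stieltjes_stieltjes:
  assumes "bounded_variation_on {0..} f"
  shows "is_stieltjes f (fst (stieltjes f)) (snd (stieltjes f))"
proof -
  obtain \<nu> \<theta> where "is_stieltjes f \<nu> \<theta>"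
    using bounded_variation_regularity(4)[OF assms] by blast
  then have "is_stieltjes f (fst (\<nu>, \<theta>)) (snd (\<nu>, \<theta>))" by simp
  then show ?thesis
    unfolding stieltjes_def by (rule someI[where P = "\<lambda>m. is_stieltjes f (fst m) (snd m)"])
qed

section \<open>The remainder term\<close>

text \<open>The primitive in \<open>s\<close> of \<open>cos (2 * pi * (x * s - \<gamma>))\<close>;
  the second sine makes it vanish at \<open>s = 0\<close>, so that an atom of the measure at 0 does
  not contribute.\<close>

definition trig_primitive :: "real \<Rightarrow> real \<Rightarrow> real \<Rightarrow> real" where
  "trig_primitive \<gamma> x s = (sin (2 * pi * (x * s - \<gamma>)) + sin (2 * pi * \<gamma>)) / (2 * pi * x)"

lemma integral_trig_primitive:
  assumes "0 < x" "0 \<le> b"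
  shows "(LINT t:{0..b}|lborel. cos (2 * pi * (x * t - \<gamma>))) = trig_primitive \<gamma> x b"
proof -
  have "(LINT t:{0..b}|lborel. cos (2 * pi * (x * t - \<gamma>))) = trig_primitive \<gamma> x b - trig_primitive \<gamma> x 0"
    unfolding set_lebesgue_integral_def
  proof (rule integral_FTC_Icc)
    fix t
    have "(trig_primitive \<gamma> x has_real_derivative cos (2 * pi * (x * t - \<gamma>)) * (2 * pi * x) / (2 * pi * x)) (at t within {0..b})"
      unfolding trig_primitive_def
      by (intro DERIV_cdivide) (auto intro!: derivative_eq_intros simp: algebra_simps)
    then show "(trig_primitive \<gamma> x has_vector_derivative cos (2 * pi * (x * t - \<gamma>))) (at t within {0..b})"
      using assms by (simp add: has_real_derivative_iff_has_vector_derivative)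
  qed (use assms in \<open>auto intro!: continuous_intros\<close>)
  then show ?thesis by (simp add: trig_primitive_def)
qed

lemma abs_trig_primitive:
  assumes "0 < x"
  shows "\<bar>trig_primitive \<gamma> x s\<bar> \<le> 1 / (pi * x)"
proof -
  have le: "\<bar>sin (2 * pi * (x * s - \<gamma>)) + sin (2 * pi * \<gamma>)\<bar> \<le> 2"
    using abs_sin_le_one[of "2 * pi * (x * s - \<gamma>)"] abs_sin_le_one[of "2 * pi * \<gamma>"] by linarith
  have "\<bar>trig_primitive \<gamma> x s\<bar> \<le> 2 / (2 * pi * x)"
    using divide_right_mono[OF le, of "2 * pi * x"] assms
    unfolding trig_primitive_def abs_divide by (simp add: abs_mult)
  then show ?thesis by simp
qed

lemma measurable_trig_primitive [measurable]:
  "(\<lambda>(x, s). trig_primitive \<gamma> x s) \<in> borel_measurable (borel \<Otimes>\<^sub>M borel)"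
  unfolding trig_primitive_def by measurable

locale bv_function =
  fixes f :: "real \<Rightarrow> complex" and \<nu> :: "real measure" and \<theta> :: "real \<Rightarrow> complex"
  assumes bv: "bounded_variation_on {0..} f" and vanish: "(f \<longlongrightarrow> 0) at_top"
    and st: "is_stieltjes f \<nu> \<theta>"
begin

lemma sets_nu [simp, measurable_cong]: "sets \<nu> = sets borel"
  and sigma_finite: "sigma_finite_measure \<nu>"
  and integrable_theta: "integrable \<nu> \<theta>"
  and theta_neg: "t < 0 \<Longrightarrow> \<theta> t = 0"
  using st by (auto simp: is_stieltjes_def)

lemma theta_measurable [measurable]: "\<theta> \<in> borel_measurable \<nu>"
  using integrable_theta by auto

lemma integrable_mult_theta:
  fixes h :: "real \<Rightarrow> complex"
  assumes [measurable]: "h \<in> borel_measurable borel" and "\<And>t. cmod (h t) \<le> M"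
  shows "integrable \<nu> (\<lambda>t. h t * \<theta> t)"
  by (rule integrable_bounded_times[OF integrable_theta _ assms(2)]) simp

text \<open>The measure sees \<open>f\<close> through its right limits, which may differ from the
  values of \<open>f\<close> at jumps; \<open>N\<close> collects the countably many
  discontinuities.\<close>

lemma tail_representation:
  obtains N where "countable N"
    "\<And>t. 0 < t \<Longrightarrow> t \<notin> N \<Longrightarrow> f t = - (LINT s|\<nu>. indicator {t<..} s * \<theta> s)"
proof -
  obtain N where N: "countable N" "\<And>b. 0 < b \<Longrightarrow> b \<notin> N \<Longrightarrow> Lim (at_right b) f = f b"
    using bounded_variation_regularity(2)[OF bv] by blast
  have "f t = - (LINT s|\<nu>. indicator {t<..} s * \<theta> s)" if "0 < t" "t \<notin> N" for t
  proof -
    have "indicator {t<..} s *\<^sub>R \<theta> s = indicator {t<..} s * \<theta> s" for s by (simp add: indicator_def)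
    then show ?thesis
      using is_stieltjes_tail[OF bv vanish st, of t] N(2)[OF that] that by simp
  qed
  with N(1) show thesis by (rule that)
qed

text \<open>Integration by parts in the guise of Fubini: \<open>f t\<close> is replaced by minus the
  mass beyond \<open>t\<close>, and then \<open>s\<close> contributes the integral of the cosine
  over \<open>[0, min A s]\<close>.\<close>

lemma truncated_transform:
  assumes x: "0 < x" and A: "0 \<le> A"
  shows "(LINT t:{0..A}|lborel. f t * of_real (cos (2 * pi * (x * t - \<gamma>)))) =
     - (LINT s|\<nu>. of_real (trig_primitive \<gamma> x (min A s)) * \<theta> s)"
proof -
  interpret nu: sigma_finite_measure \<nu> by (rule sigma_finite)
  interpret NL: pair_sigma_finite \<nu> lborel
    by (intro pair_sigma_finite.intro sigma_finite lborel.sigma_finite_measure_axioms)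
  obtain N where N: "countable N"
      "\<And>t. 0 < t \<Longrightarrow> t \<notin> N \<Longrightarrow> f t = - (LINT s|\<nu>. indicator {t<..} s * \<theta> s)"
    using tail_representation by blast
  let ?c = "\<lambda>t. complex_of_real (cos (2 * pi * (x * t - \<gamma>)))"
  let ?k = "\<lambda>s t. indicator {0..A} t * ?c t * (indicator {t<..} s * \<theta> s)"
  have [measurable]: "(\<lambda>t. indicator {0..} t *\<^sub>R f t) \<in> borel_measurable borel"
    by (rule bounded_variation_regularity(3)[OF bv])
  have i: "integrable (\<nu> \<Otimes>\<^sub>M lborel) (case_prod ?k)"
  proof (rule NL.integrable_pair_bound[OF integrable_theta])
    show "integrable lborel (\<lambda>t. of_real (indicator {0..A} t) :: complex)"
      by (intro integrable_of_real integrable_indicator_Icc)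
    show "cmod (?k s t) \<le> cmod (\<theta> s) * cmod (of_real (indicator {0..A} t))" for s t
      by (auto simp: norm_mult indicator_def intro!: mult_left_le_one_le)
    show "case_prod ?k \<in> borel_measurable (\<nu> \<Otimes>\<^sub>M lborel)"
      unfolding indicator_def greaterThan_iff atLeastAtMost_iff by measurable
  qed
  have "(LINT t:{0..A}|lborel. f t * ?c t) = (LINT t|lborel. - (LINT s|\<nu>. ?k s t))"
    unfolding set_lebesgue_integral_def
  proof (rule integral_cong_AE)
    have eq: "(\<lambda>t. indicator {0..A} t *\<^sub>R (f t * ?c t)) = (\<lambda>t. (indicator {0..} t *\<^sub>R f t) * (indicator {0..A} t *\<^sub>R ?c t))"
      by (auto simp: fun_eq_iff indicator_def)
    show "(\<lambda>t. indicator {0..A} t *\<^sub>R (f t * ?c t)) \<in> borel_measurable lborel"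
      unfolding eq by measurable
    have "N \<union> {0} \<in> null_sets lborel" using N(1) by (intro countable_imp_null_set_lborel) auto
    then have "AE t in lborel. t \<notin> N \<union> {0}" by (rule AE_not_in)
    then show "AE t in lborel. indicator {0..A} t *\<^sub>R (f t * ?c t) = - (LINT s|\<nu>. ?k s t)"
    proof eventually_elim
      case (elim t)
      show ?case
      proof (cases "t \<in> {0..A}")
        case True
        with elim have "f t = - (LINT s|\<nu>. indicator {t<..} s * \<theta> s)" by (intro N(2)) auto
        then show ?thesis using True by simp
      qed simp
    qed
    show "(\<lambda>t. - (LINT s|\<nu>. ?k s t)) \<in> borel_measurable lborel"
      unfolding indicator_def greaterThan_iff atLeastAtMost_iff by measurable
  qed
  also have "\<dots> = - (LINT t|lborel. LINT s|\<nu>. ?k s t)" by simp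
  also have "(LINT t|lborel. LINT s|\<nu>. ?k s t) = (LINT s|\<nu>. LINT t|lborel. ?k s t)"
    by (rule NL.Fubini_integral[OF i])
  also have "\<dots> = (LINT s|\<nu>. of_real (trig_primitive \<gamma> x (min A s)) * \<theta> s)"
  proof (intro Bochner_Integration.integral_cong refl)
    fix s
    \<comment> \<open>For negative \<open>s\<close> the left side is zero but the primitive need not
      be; there the equation holds because \<open>\<theta>\<close> vanishes.\<close>
    show "(LINT t|lborel. ?k s t) = of_real (trig_primitive \<gamma> x (min A s)) * \<theta> s"
    proof (cases "s < 0")
      case True then show ?thesis by (simp add: theta_neg)
    next
      case False
      have "(LINT t|lborel. ?k s t) = (LINT t|lborel. of_real (indicator {0..min A s} t *\<^sub>R cos (2 * pi * (x * t - \<gamma>))) * \<theta> s)"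
      proof (rule integral_cong_AE)
        show "AE t in lborel. ?k s t = of_real (indicator {0..min A s} t *\<^sub>R cos (2 * pi * (x * t - \<gamma>))) * \<theta> s"
          using AE_lborel_singleton[of s] by eventually_elim (auto simp: indicator_def)
        show "?k s \<in> borel_measurable lborel" unfolding indicator_def greaterThan_iff atLeastAtMost_iff by measurable
      qed measurable
      also have "\<dots> = of_real (LINT t:{0..min A s}|lborel. cos (2 * pi * (x * t - \<gamma>))) * \<theta> s"
        unfolding set_lebesgue_integral_def integral_mult_left_zero integral_complex_of_real ..
      also have "\<dots> = of_real (trig_primitive \<gamma> x (min A s)) * \<theta> s"
        using False A x by (subst integral_trig_primitive) auto
      finally show ?thesis .
    qed
  qed
  finally show ?thesis .
qed

text \<open>The primitive is bounded by \<open>1 / (pi * x)\<close> uniformly in \<open>A\<close>,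
  so dominated convergence gives the improper integral at every \<open>x > 0\<close>, not merely
  almost everywhere.\<close>

lemma trig_transform:
  assumes x: "0 < x"
  shows "has_trig_transform \<gamma> f x (- (LINT s|\<nu>. of_real (trig_primitive \<gamma> x s) * \<theta> s))"
  unfolding has_trig_transform_def
proof (rule Lim_transform_eventually)
  show "((\<lambda>A. - (LINT s|\<nu>. of_real (trig_primitive \<gamma> x (min A s)) * \<theta> s)) \<longlongrightarrow>
      - (LINT s|\<nu>. of_real (trig_primitive \<gamma> x s) * \<theta> s)) at_top"
  proof (intro tendsto_minus integral_dominated_convergence_at_top[where w = "\<lambda>s. 1 / (pi * x) * cmod (\<theta> s)"])
    show "AE s in \<nu>. ((\<lambda>A. of_real (trig_primitive \<gamma> x (min A s)) * \<theta> s) \<longlongrightarrow> of_real (trig_primitive \<gamma> x s) * \<theta> s) at_top"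
    proof (rule AE_I2, rule tendsto_eventually)
      fix s
      show "\<forall>\<^sub>F A in at_top. of_real (trig_primitive \<gamma> x (min A s)) * \<theta> s = of_real (trig_primitive \<gamma> x s) * \<theta> s"
        using eventually_ge_at_top[of s] by eventually_elim (simp add: min_def)
    qed
    show "\<forall>\<^sub>F A in at_top. AE s in \<nu>. norm (of_real (trig_primitive \<gamma> x (min A s)) * \<theta> s) \<le> 1 / (pi * x) * cmod (\<theta> s)"
      by (intro always_eventually allI AE_I2)
         (simp only: norm_mult norm_of_real, intro mult_right_mono abs_trig_primitive x norm_ge_zero)
  qed (use integrable_theta in \<open>auto intro!: borel_measurable_times\<close>)
  show "\<forall>\<^sub>F A in at_top. - (LINT s|\<nu>. of_real (trig_primitive \<gamma> x (min A s)) * \<theta> s) =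
      (LINT t:{0..A}|lborel. f t * of_real (cos (2 * pi * (x * t - \<gamma>))))"
    using eventually_ge_at_top[of 0] by eventually_elim (simp add: truncated_transform[OF x])
qed

text \<open>Restricted to \<open>s > 0\<close> because dyadic intervals \<open>(a, 2a)\<close> with
  \<open>a > 0\<close> miss the origin; an atom at 0 is not lost, since
  \<open>trig_kernel x 0 = 0\<close>.\<close>

definition kernel_integral :: "real \<Rightarrow> complex" where
  "kernel_integral x = (LINT s|\<nu>. indicator {0<..} s * trig_kernel x s * \<theta> s)"

text \<open>Defined by subtraction with the actual value \<open>f (1 / x)\<close>, so that the
  asserted formula holds at every \<open>x > 0\<close>; for the sine transform the link with the
  kernel holds almost everywhere.\<close>

definition remainder :: "real \<Rightarrow> real \<Rightarrow> complex" where
  "remainder \<gamma> x = - (LINT s|\<nu>. of_real (trig_primitive \<gamma> x s) * \<theta> s) - 1 / (2 * pi * x) * f (1 / x) * sin (2 * pi * \<gamma>)"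

lemma integrable_kernel: "integrable \<nu> (\<lambda>s. indicator {0<..} s * trig_kernel x s * \<theta> s)"
  by (rule integrable_mult_theta[where M = 2]) (auto simp: norm_mult indicator_def norm_trig_kernel)

text \<open>Here \<open>2 * pi * x\<close> times the primitive is
  \<open>1 - cos (2 * pi * x * s)\<close>, while the even part of the kernel is the cosine minus the
  cutoff. Their sum is the indicator of \<open>s > 1 / x\<close>, whose integral is
  \<open>- f (1 / x)\<close> by hypothesis.\<close>

lemma remainder_sine:
  assumes x: "0 < x" and f: "f (1 / x) = - (LINT s|\<nu>. indicator {1 / x<..} s * \<theta> s)"
  shows "remainder (1 / 4) x = (kernel_integral x + kernel_integral (- x)) / (4 * pi * x)"
proof -
  have i: "integrable \<nu> (\<lambda>s. of_real (2 * pi * x * trig_primitive (1 / 4) x s) * \<theta> s)"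
    "integrable \<nu> (\<lambda>s. indicator {1 / x<..} s * \<theta> s)"
  proof -
    have "\<bar>2 * pi * x * trig_primitive (1 / 4) x s\<bar> \<le> 2" for s
    proof -
      have "2 * pi * x * \<bar>trig_primitive (1 / 4) x s\<bar> \<le> 2 * pi * x * (1 / (pi * x))"
        using x by (intro mult_left_mono abs_trig_primitive) auto
      then show ?thesis using x by (simp add: abs_mult)
    qed
    then show "integrable \<nu> (\<lambda>s. of_real (2 * pi * x * trig_primitive (1 / 4) x s) * \<theta> s)"
      by (intro integrable_mult_theta[where M = 2]) (measurable, simp only: norm_of_real)
    show "integrable \<nu> (\<lambda>s. indicator {1 / x<..} s * \<theta> s)"
      by (intro integrable_mult_theta[where M = 1]) (auto simp: indicator_def)
  qed
  have "(kernel_integral x + kernel_integral (- x)) / 2 =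
      (LINT s|\<nu>. (indicator {0<..} s * trig_kernel x s * \<theta> s + indicator {0<..} s * trig_kernel (- x) s * \<theta> s) / 2)"
    unfolding kernel_integral_def using integrable_kernel by simp
  also have "\<dots> = (LINT s|\<nu>. indicator {1 / x<..} s * \<theta> s - of_real (2 * pi * x * trig_primitive (1 / 4) x s) * \<theta> s)"
  proof (intro Bochner_Integration.integral_cong refl)
    fix s
    have p: "2 * pi * x * trig_primitive (1 / 4) x s = 1 - cos (2 * pi * x * s)"
    proof -
      have "sin (2 * pi * (x * s - 1 / 4)) = - cos (2 * pi * x * s)"
        by (simp add: right_diff_distrib sin_diff mult.assoc)
      then show ?thesis using x by (simp add: trig_primitive_def)
    qed
    consider "s < 0" | "s = 0" | "0 < s" by linarith
    then show "(indicator {0<..} s * trig_kernel x s * \<theta> s + indicator {0<..} s * trig_kernel (- x) s * \<theta> s) / 2 =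
        indicator {1 / x<..} s * \<theta> s - of_real (2 * pi * x * trig_primitive (1 / 4) x s) * \<theta> s"
    proof cases
      case 3
      have "(trig_kernel x s + trig_kernel (- x) s) / 2 = of_real (cos (2 * pi * x * s)) - indicator {t. t * x \<le> 1} s"
        using x by (simp add: trig_kernel_def complex_eq_iff)
      moreover have "indicator {1 / x<..} s = (1 :: complex) - indicator {t. t * x \<le> 1} s"
        using x by (simp add: indicator_def field_simps)
      ultimately have "(trig_kernel x s + trig_kernel (- x) s) / 2 =
          indicator {1 / x<..} s - of_real (2 * pi * x * trig_primitive (1 / 4) x s)"
        unfolding p by simp
      from arg_cong[OF this, of "\<lambda>z. z * \<theta> s"] show ?thesis
        using 3 by (simp only: left_diff_distrib) (simp add: distrib_right add_divide_distrib)
    next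
      case 2
      then have "trig_primitive (1 / 4) x s = 0" using p x by simp
      then show ?thesis using 2 x by (simp add: indicator_def)
    qed (simp add: theta_neg)
  qed
  also have "\<dots> = (LINT s|\<nu>. indicator {1 / x<..} s * \<theta> s) - (LINT s|\<nu>. of_real (2 * pi * x) * (of_real (trig_primitive (1 / 4) x s) * \<theta> s))"
    using i by (subst Bochner_Integration.integral_diff) (simp_all add: mult.assoc)
  also have "\<dots> = - f (1 / x) - of_real (2 * pi * x) * (LINT s|\<nu>. of_real (trig_primitive (1 / 4) x s) * \<theta> s)"
    unfolding integral_mult_right_zero f by simp
  finally have "(kernel_integral x + kernel_integral (- x)) / 2 =
      - f (1 / x) - of_real (2 * pi * x) * (LINT s|\<nu>. of_real (trig_primitive (1 / 4) x s) * \<theta> s)" .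
  then have "(kernel_integral x + kernel_integral (- x)) / 2 / of_real (2 * pi * x) =
      - f (1 / x) / of_real (2 * pi * x) - (LINT s|\<nu>. of_real (trig_primitive (1 / 4) x s) * \<theta> s)"
    using x by (simp add: diff_divide_distrib)
  moreover have "sin (2 * pi * (1 / 4)) = 1" by simp
  moreover have "(kernel_integral x + kernel_integral (- x)) / 2 / of_real (2 * pi * x) =
      (kernel_integral x + kernel_integral (- x)) / (4 * pi * x)" by simp
  ultimately show ?thesis unfolding remainder_def by (subst minus_diff_commute) simp
qed

text \<open>The cutoff is even in \<open>x\<close> and cancels in the odd part of the kernel, and
  \<open>sin 0 = 0\<close> removes the term with \<open>f (1 / x)\<close>; hence no exceptional
  points.\<close>

lemma remainder_cosine:
  assumes x: "0 < x"
  shows "remainder 0 x = (kernel_integral (- x) - kernel_integral x) / (4 * pi * \<i> * x)"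
proof -
  have "(kernel_integral x - kernel_integral (- x)) / (2 * \<i>) =
      (LINT s|\<nu>. (indicator {0<..} s * trig_kernel x s * \<theta> s - indicator {0<..} s * trig_kernel (- x) s * \<theta> s) / (2 * \<i>))"
    unfolding kernel_integral_def using integrable_kernel by simp
  also have "\<dots> = (LINT s|\<nu>. of_real (2 * pi * x) * (of_real (trig_primitive 0 x s) * \<theta> s))"
  proof (intro Bochner_Integration.integral_cong refl)
    fix s
    have p: "2 * pi * x * trig_primitive 0 x s = sin (2 * pi * x * s)"
      using x by (simp add: trig_primitive_def mult.assoc)
    consider "s < 0" | "s = 0" | "0 < s" by linarith
    then show "(indicator {0<..} s * trig_kernel x s * \<theta> s - indicator {0<..} s * trig_kernel (- x) s * \<theta> s) / (2 * \<i>) =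
        of_real (2 * pi * x) * (of_real (trig_primitive 0 x s) * \<theta> s)"
    proof cases
      case 3
      have "(trig_kernel x s - trig_kernel (- x) s) / (2 * \<i>) = of_real (2 * pi * x * trig_primitive 0 x s)"
        unfolding p by (simp add: trig_kernel_def complex_eq_iff Re_divide Im_divide)
      from arg_cong[OF this, of "\<lambda>z. z * \<theta> s"] show ?thesis
        using 3 by (simp add: left_diff_distrib diff_divide_distrib mult.assoc)
    qed (use x in \<open>simp_all add: theta_neg trig_primitive_def\<close>)
  qed
  also have "\<dots> = of_real (2 * pi * x) * (LINT s|\<nu>. of_real (trig_primitive 0 x s) * \<theta> s)"
    by (rule integral_mult_right_zero)
  finally show ?thesis
    using x unfolding remainder_def by (simp add: field_simps)
qed

end

section \<open>Averaging over dyadic intervals\<close>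

lemma has_bochner_integral_inverse:
  fixes s :: real
  assumes "0 < s"
  shows "has_bochner_integral lborel (\<lambda>a. indicator {s / 2..s} a / a) (ln 2)"
proof -
  have "has_bochner_integral lborel (\<lambda>a. 1 / a * indicator {s / 2..s} a) (ln s - ln (s / 2))"
  proof (rule has_bochner_integral_FTC_Icc_real)
    show "(ln has_real_derivative 1 / a) (at a)" "isCont (\<lambda>a. 1 / a) a" if "s / 2 \<le> a" "a \<le> s" for a
      using assms that by (auto intro!: derivative_eq_intros continuous_intros)
  qed (use assms in auto)
  then show ?thesis using assms by (simp add: ln_div)
qed

context bv_function
begin

definition dyadic_integral :: "real \<Rightarrow> real \<Rightarrow> complex" where
  "dyadic_integral a x = (LINT s|\<nu>. trig_kernel x s * (indicator {a<..<2 * a} s *\<^sub>R \<theta> s))"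

lemma measurable_dyadic_integral [measurable]:
  "(\<lambda>(a, x). dyadic_integral a x) \<in> borel_measurable (borel \<Otimes>\<^sub>M borel)"
proof -
  interpret nu: sigma_finite_measure \<nu> by (rule sigma_finite)
  show ?thesis
    unfolding dyadic_integral_def indicator_def greaterThanLessThan_iff case_prod_beta by measurable
qed

lemma measurable_kernel_integral [measurable]: "kernel_integral \<in> borel_measurable borel"
proof -
  interpret nu: sigma_finite_measure \<nu> by (rule sigma_finite)
  show ?thesis unfolding kernel_integral_def[abs_def] by measurable
qed

text \<open>Every \<open>s > 0\<close> lies in \<open>(a, 2a)\<close> for a set of \<open>a\<close> of logarithmic measure \<open>ln 2\<close>.\<close>

lemma kernel_integral_average:
  "ennreal (ln 2 * cmod (kernel_integral x)) \<le>
    (\<integral>\<^sup>+a. ennreal (indicator {0<..} a / a * cmod (dyadic_integral a x)) \<partial>lborel)"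
proof -
  interpret nu: sigma_finite_measure \<nu> by (rule sigma_finite)
  interpret NL: pair_sigma_finite \<nu> lborel
    by (intro pair_sigma_finite.intro sigma_finite lborel.sigma_finite_measure_axioms)
  let ?w = "\<lambda>s a. indicator {0<..} a / a * indicator {a<..<2 * a} s :: real"
  let ?k = "\<lambda>s a. of_real (?w s a) * (trig_kernel x s * \<theta> s)"
  have w: "has_bochner_integral lborel (?w s) (if 0 < s then ln 2 else 0)" for s
  proof (cases "0 < s")
    case True
    have "AE a in lborel. ?w s a = indicator {s / 2..s} a / a"
      using AE_lborel_singleton[of s] AE_lborel_singleton[of "s / 2"]
      by eventually_elim (use True in \<open>auto simp: indicator_def\<close>)
    then have "has_bochner_integral lborel (?w s) (ln 2) \<longleftrightarrow>
        has_bochner_integral lborel (\<lambda>a. indicator {s / 2..s} a / a) (ln 2)"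
      by (intro has_bochner_integral_cong_AE) (simp_all add: indicator_def)
    then show ?thesis using True has_bochner_integral_inverse[OF True] by simp
  next
    case False
    then have "?w s = (\<lambda>_. 0)" by (auto simp: fun_eq_iff indicator_def)
    then show ?thesis using False by (simp add: has_bochner_integral_zero)
  qed
  have kmeas: "case_prod ?k \<in> borel_measurable (\<nu> \<Otimes>\<^sub>M lborel)"
    unfolding indicator_def greaterThanLessThan_iff greaterThan_iff by measurable
  have w0: "0 \<le> ?w s a" for s a by (auto simp: indicator_def)
  have i: "integrable (\<nu> \<Otimes>\<^sub>M lborel) (case_prod ?k)"
  proof (rule NL.Fubini_integrable[OF kmeas])
    have "(LINT a|lborel. norm (?k s a)) = (if 0 < s then ln 2 else 0) * (cmod (trig_kernel x s) * cmod (\<theta> s))" for s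
    proof -
      have "norm (?k s a) = ?w s a * (cmod (trig_kernel x s) * cmod (\<theta> s))" for a
        using w0[of a s] by (simp only: norm_mult norm_of_real abs_of_nonneg)
      then show ?thesis
        using has_bochner_integral_integral_eq[OF w[of s]] by (simp only: integral_mult_left_zero)
    qed
    moreover have "integrable \<nu> (\<lambda>s. (if 0 < s then ln 2 else 0) * (cmod (trig_kernel x s) * cmod (\<theta> s)))"
    proof (rule Bochner_Integration.integrable_bound[OF integrable_mult_right[OF integrable_norm[OF integrable_theta], of "ln 2 * 2"]])
      show "AE s in \<nu>. norm ((if 0 < s then ln 2 else 0) * (cmod (trig_kernel x s) * cmod (\<theta> s))) \<le> norm (ln 2 * 2 * cmod (\<theta> s))"
        using norm_trig_kernel[of x] by (intro AE_I2) (auto simp: abs_mult intro!: mult_right_mono)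
    qed measurable
    ultimately show "integrable \<nu> (\<lambda>s. LINT a|lborel. norm (case (s, a) of (s, a) \<Rightarrow> ?k s a))"
      by simp
    show "AE s in \<nu>. integrable lborel (\<lambda>a. case (s, a) of (s, a) \<Rightarrow> ?k s a)"
      using has_bochner_integral_iff[THEN iffD1, OF w] by (intro AE_I2) (simp del: of_real_mult of_real_divide)
  qed
  have "of_real (ln 2) * kernel_integral x = (LINT s|\<nu>. LINT a|lborel. ?k s a)"
  proof -
    have "(LINT a|lborel. ?k s a) = of_real (ln 2) * (indicator {0<..} s * trig_kernel x s * \<theta> s)" for s
      unfolding integral_mult_left_zero integral_complex_of_real has_bochner_integral_integral_eq[OF w[of s]]
      by (simp add: indicator_def)
    then show ?thesis by (simp add: kernel_integral_def)
  qed
  also have "\<dots> = (LINT a|lborel. LINT s|\<nu>. ?k s a)" by (rule NL.Fubini_integral[OF i, symmetric])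
  also have "\<dots> = (LINT a|lborel. of_real (indicator {0<..} a / a) * dyadic_integral a x)"
  proof (intro Bochner_Integration.integral_cong refl)
    fix a
    have "(LINT s|\<nu>. ?k s a) = (LINT s|\<nu>. of_real (indicator {0<..} a / a) * (trig_kernel x s * (indicator {a<..<2 * a} s *\<^sub>R \<theta> s)))"
      by (intro Bochner_Integration.integral_cong refl) (simp add: scaleR_conv_of_real mult_ac)
    then show "(LINT s|\<nu>. ?k s a) = of_real (indicator {0<..} a / a) * dyadic_integral a x"
      unfolding integral_mult_right_zero dyadic_integral_def .
  qed
  finally have eq: "of_real (ln 2) * kernel_integral x = (LINT a|lborel. of_real (indicator {0<..} a / a) * dyadic_integral a x)" .
  have "ennreal (ln 2 * cmod (kernel_integral x)) = ennreal (cmod (of_real (ln 2) * kernel_integral x))"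
    by (simp add: norm_mult)
  also have "\<dots> \<le> (\<integral>\<^sup>+a. ennreal (cmod (of_real (indicator {0<..} a / a) * dyadic_integral a x)) \<partial>lborel)"
    unfolding eq
  \<comment> \<open>Without integrability the Bochner integral has the default value 0, and the
    inequality is trivial.\<close>
  proof (cases "integrable lborel (\<lambda>a. of_real (indicator {0<..} a / a) * dyadic_integral a x)")
    case True
    then show "ennreal (cmod (LINT a|lborel. of_real (indicator {0<..} a / a) * dyadic_integral a x)) \<le>
      (\<integral>\<^sup>+a. ennreal (cmod (of_real (indicator {0<..} a / a) * dyadic_integral a x)) \<partial>lborel)"
      by (rule integral_norm_bound_ennreal)
  qed (simp add: not_integrable_integral_eq)
  also have "\<dots> = (\<integral>\<^sup>+a. ennreal (indicator {0<..} a / a * cmod (dyadic_integral a x)) \<partial>lborel)"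
    by (intro nn_integral_cong) (auto simp: norm_mult norm_divide indicator_def)
  finally show ?thesis .
qed

text \<open>After Tonelli the integral over \<open>x\<close> at fixed \<open>a\<close> is controlled
  by \<open>dyadic_bound\<close>. The factor \<open>1 / a\<close> from the averaging turns
  \<open>a powr (1 - 1 / p)\<close> into the weight of \<open>Vstar_norm\<close>, and
  \<open>1 / ln 2\<close> undoes the logarithmic mass.\<close>

lemma kernel_integral_bound:
  assumes p: "1 < p" and eq: "stieltjes f = (\<nu>, \<theta>)"
  shows "(\<integral>\<^sup>+x. ennreal (cmod (kernel_integral x) / \<bar>x\<bar>) \<partial>lborel) \<le>
    ennreal (100 * decay_const p / ln 2) * Vstar_norm p f"
proof -
  let ?D = "\<lambda>a. \<integral>\<^sup>+x. ennreal (cmod (dyadic_integral a x) / \<bar>x\<bar>) \<partial>lborel"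
  let ?I = "\<lambda>a. indicator {0<..} a / a :: real"
  \<comment> \<open>The constant is divided out before integrating in \<open>a\<close>, since the integrand of \<open>Vstar_norm\<close> need
    not be measurable.\<close>
  define c where "c = 100 * decay_const p"
  have c: "0 < c" using decay_const_pos[OF p] by (simp add: c_def)
  have D: "?D a \<le> ennreal (c * a powr (1 - enn2real (inverse p))) * star_norm p \<nu> (\<lambda>t. indicator {a<..<2 * a} t *\<^sub>R \<theta> t)"
    if a: "0 < a" for a
  proof -
    interpret dyadic_measure p a \<nu> "\<lambda>t. indicator {a<..<2 * a} t *\<^sub>R \<theta> t"
    proof
      show "integrable \<nu> (\<lambda>t. indicator {a<..<2 * a} t *\<^sub>R \<theta> t)"
        by (intro integrable_mult_indicator integrable_theta) simp
    qed (use p a sigma_finite in \<open>auto simp: sigma_finite_measure_def\<close>)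
    have "?D a \<le> 100 * weight"
      using dyadic_bound by (simp add: dyadic_integral_def)
    also have "\<dots> = ennreal (c * a powr (1 - enn2real (inverse p))) * star_norm p \<nu> (\<lambda>t. indicator {a<..<2 * a} t *\<^sub>R \<theta> t)"
      unfolding weight_def c_def using decay_const_pos[OF p]
      by (simp add: ennreal_mult mult.assoc)
    finally show ?thesis .
  qed
  have "(\<integral>\<^sup>+x. ennreal (cmod (kernel_integral x) / \<bar>x\<bar>) \<partial>lborel) \<le>
      (\<integral>\<^sup>+x. \<integral>\<^sup>+a. ennreal (1 / ln 2) * (ennreal (?I a) * ennreal (cmod (dyadic_integral a x) / \<bar>x\<bar>)) \<partial>lborel \<partial>lborel)"
  proof (rule nn_integral_mono)
    fix x :: real
    have "ennreal (cmod (kernel_integral x) / \<bar>x\<bar>) = ennreal (1 / (ln 2 * \<bar>x\<bar>)) * ennreal (ln 2 * cmod (kernel_integral x))"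
      by (subst ennreal_mult[symmetric]) auto
    also have "\<dots> \<le> ennreal (1 / (ln 2 * \<bar>x\<bar>)) * (\<integral>\<^sup>+a. ennreal (?I a * cmod (dyadic_integral a x)) \<partial>lborel)"
      by (intro mult_left_mono kernel_integral_average) simp
    also have "\<dots> = (\<integral>\<^sup>+a. ennreal (1 / (ln 2 * \<bar>x\<bar>)) * ennreal (?I a * cmod (dyadic_integral a x)) \<partial>lborel)"
      by (rule nn_integral_cmult[symmetric]) measurable
    also have "\<dots> = (\<integral>\<^sup>+a. ennreal (1 / ln 2) * (ennreal (?I a) * ennreal (cmod (dyadic_integral a x) / \<bar>x\<bar>)) \<partial>lborel)"
      by (intro nn_integral_cong) (auto simp: indicator_def simp flip: ennreal_mult)
    finally show "ennreal (cmod (kernel_integral x) / \<bar>x\<bar>) \<le>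
        (\<integral>\<^sup>+a. ennreal (1 / ln 2) * (ennreal (?I a) * ennreal (cmod (dyadic_integral a x) / \<bar>x\<bar>)) \<partial>lborel)" .
  qed
  also have "\<dots> = (\<integral>\<^sup>+a. \<integral>\<^sup>+x. ennreal (1 / ln 2) * (ennreal (?I a) * ennreal (cmod (dyadic_integral a x) / \<bar>x\<bar>)) \<partial>lborel \<partial>lborel)"
    by (rule lborel_pair.Fubini') measurable
  also have "\<dots> = (\<integral>\<^sup>+a. ennreal (c / ln 2) * (ennreal (1 / c) * (ennreal (?I a) * ?D a)) \<partial>lborel)"
  proof (intro nn_integral_cong)
    fix a :: real
    have "(\<integral>\<^sup>+x. ennreal (1 / ln 2) * (ennreal (?I a) * ennreal (cmod (dyadic_integral a x) / \<bar>x\<bar>)) \<partial>lborel) =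
        ennreal (1 / ln 2) * (ennreal (?I a) * ?D a)"
      by (subst nn_integral_cmult, measurable, subst nn_integral_cmult, measurable)
    also have "\<dots> = ennreal (c / ln 2) * (ennreal (1 / c) * (ennreal (?I a) * ?D a))"
    proof -
      have "ennreal (1 / ln 2) = ennreal (c / ln 2) * ennreal (1 / c)"
        using c by (subst ennreal_mult[symmetric]) auto
      then show ?thesis by (simp only: mult.assoc)
    qed
    finally show "(\<integral>\<^sup>+x. ennreal (1 / ln 2) * (ennreal (?I a) * ennreal (cmod (dyadic_integral a x) / \<bar>x\<bar>)) \<partial>lborel) =
        ennreal (c / ln 2) * (ennreal (1 / c) * (ennreal (?I a) * ?D a))" .
  qed
  also have "\<dots> = ennreal (c / ln 2) * (\<integral>\<^sup>+a. ennreal (1 / c) * (ennreal (?I a) * ?D a) \<partial>lborel)"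
    by (rule nn_integral_cmult) measurable
  also have "\<dots> \<le> ennreal (c / ln 2) * Vstar_norm p f"
    unfolding Vstar_norm_def eq fst_conv snd_conv
  proof (intro mult_left_mono nn_integral_mono)
    fix a :: real
    let ?S = "star_norm p \<nu> (\<lambda>t. indicator {a<..<2 * a} t *\<^sub>R \<theta> t)"
    let ?q = "enn2real (inverse p)"
    show "ennreal (1 / c) * (ennreal (?I a) * ?D a) \<le> ennreal (a powr - ?q) * ?S * indicator {0<..} a"
    proof (cases "0 < a")
      case True
      have "ennreal (1 / c) * (ennreal (?I a) * ?D a) \<le>
          ennreal (1 / c) * (ennreal (?I a) * (ennreal (c * a powr (1 - ?q)) * ?S))"
        by (intro mult_left_mono D True) auto
      also have "\<dots> = ennreal (1 / c * (1 / a) * (c * a powr (1 - ?q))) * ?S"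
      proof -
        have "ennreal (1 / c * (1 / a) * z) = ennreal (1 / c) * (ennreal (1 / a) * ennreal z)" if "0 \<le> z" for z
          using True c that by (simp flip: ennreal_mult)
        from this[of "c * a powr (1 - ?q)"] have "ennreal (1 / c * (1 / a) * (c * a powr (1 - ?q))) =
            ennreal (1 / c) * (ennreal (1 / a) * ennreal (c * a powr (1 - ?q)))" using c by simp
        then show ?thesis using True by (simp only: mult.assoc) (simp only: indicator_simps greaterThan_iff)
      qed
      also have "1 / c * (1 / a) * (c * a powr (1 - ?q)) = a powr - ?q"
        using True c by (simp add: powr_diff powr_minus field_simps)
      finally show ?thesis using True by simp
    qed simp
  qed simp
  finally show ?thesis by (simp add: c_def)
qed

text \<open>The sine case requires \<open>1 / x\<close> to avoid the countable set of
  \<open>tail_representation\<close>; the reciprocals of that set are countable, hence null. The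
  factor \<open>1 / (4 * pi)\<close> is bounded by 1.\<close>

lemma norm_remainder_AE:
  assumes "\<gamma> = 0 \<or> \<gamma> = 1 / 4"
  shows "AE x in lborel. 0 < x \<longrightarrow> cmod (remainder \<gamma> x) \<le> cmod (kernel_integral x) / \<bar>x\<bar> + cmod (kernel_integral (- x)) / \<bar>x\<bar>"
proof -
  obtain N where N: "countable N"
      "\<And>t. 0 < t \<Longrightarrow> t \<notin> N \<Longrightarrow> f t = - (LINT s|\<nu>. indicator {t<..} s * \<theta> s)"
    using tail_representation by blast
  have "(\<lambda>t. 1 / t) ` N \<in> null_sets lborel"
    using N(1) by (intro countable_imp_null_set_lborel) auto
  then have "AE x in lborel. x \<notin> (\<lambda>t. 1 / t) ` N" by (rule AE_not_in)
  then show ?thesis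
  proof (eventually_elim, intro impI)
    fix x :: real assume xN: "x \<notin> (\<lambda>t. 1 / t) ` N" and x: "0 < x"
    have "1 / x \<notin> N" using xN by (force intro: image_eqI[of _ _ "1 / x"])
    then have f: "f (1 / x) = - (LINT s|\<nu>. indicator {1 / x<..} s * \<theta> s)" using x by (intro N(2)) auto
    have "cmod (remainder \<gamma> x) \<le> (cmod (kernel_integral x) + cmod (kernel_integral (- x))) / (4 * pi * x)"
      using assms
    proof
      assume "\<gamma> = 0"
      then have "cmod (remainder \<gamma> x) = cmod (kernel_integral (- x) - kernel_integral x) / (4 * pi * x)"
        using x by (simp add: remainder_cosine[OF x] norm_divide norm_mult)
      also have "\<dots> \<le> (cmod (kernel_integral x) + cmod (kernel_integral (- x))) / (4 * pi * x)"
        using x norm_triangle_ineq4[of "kernel_integral (- x)" "kernel_integral x"]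
        by (intro divide_right_mono) auto
      finally show ?thesis .
    next
      assume \<gamma>: "\<gamma> = 1 / 4"
      have "cmod (remainder \<gamma> x) = cmod (kernel_integral x + kernel_integral (- x)) / (4 * pi * x)"
        unfolding \<gamma> remainder_sine[OF x f] using x by (simp add: norm_divide norm_mult)
      also have "\<dots> \<le> (cmod (kernel_integral x) + cmod (kernel_integral (- x))) / (4 * pi * x)"
        using x norm_triangle_ineq[of "kernel_integral x" "kernel_integral (- x)"]
        by (intro divide_right_mono) auto
      finally show ?thesis .
    qed
    also have "\<dots> \<le> (cmod (kernel_integral x) + cmod (kernel_integral (- x))) / x"
      using x pi_gt3 by (intro divide_left_mono mult_pos_pos add_nonneg_nonneg) auto
    finally show "cmod (remainder \<gamma> x) \<le> cmod (kernel_integral x) / \<bar>x\<bar> + cmod (kernel_integral (- x)) / \<bar>x\<bar>"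
      using x by (simp add: add_divide_distrib)
  qed
qed

lemma measurable_remainder: "(\<lambda>x. indicator {0<..} x *\<^sub>R remainder \<gamma> x) \<in> borel_measurable borel"
proof -
  interpret nu: sigma_finite_measure \<nu> by (rule sigma_finite)
  have [measurable]: "(\<lambda>t. indicator {0..} t *\<^sub>R f t) \<in> borel_measurable borel"
    by (rule bounded_variation_regularity(3)[OF bv])
  \<comment> \<open>Inserting an indicator at \<open>1 / x\<close> replaces \<open>f\<close> by its
    restriction to the half-line, the only version of \<open>f\<close> known to be
    measurable.\<close>
  have eq: "(\<lambda>x. indicator {0<..} x *\<^sub>R remainder \<gamma> x) = (\<lambda>x. indicator {0<..} x *\<^sub>R
     (- (LINT s|\<nu>. of_real (trig_primitive \<gamma> x s) * \<theta> s) -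
      1 / (2 * pi * x) * (indicator {0..} (1 / x) *\<^sub>R f (1 / x)) * sin (2 * pi * \<gamma>)))"
    by (auto simp: fun_eq_iff remainder_def indicator_def)
  have [measurable]: "(\<lambda>x. indicator {0..} (1 / x) *\<^sub>R f (1 / x)) \<in> borel_measurable borel"
    by (rule measurable_compose[of "\<lambda>x::real. 1 / x" _ borel "\<lambda>t. indicator {0..} t *\<^sub>R f t"]) measurable
  show ?thesis unfolding eq by measurable
qed

text \<open>The frequencies \<open>x\<close> and \<open>- x\<close> both enter the bound on the
  remainder, and reflection makes their integrals equal, hence twice the constant of
  \<open>kernel_integral_bound\<close>.\<close>

lemma remainder_bound:
  assumes p: "1 < p" and eq: "stieltjes f = (\<nu>, \<theta>)" and \<gamma>: "\<gamma> = 0 \<or> \<gamma> = 1 / 4"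
  shows "(\<integral>\<^sup>+x\<in>{0<..}. ennreal (cmod (remainder \<gamma> x)) \<partial>lborel) \<le> ennreal (200 * decay_const p / ln 2) * Vstar_norm p f"
proof -
  let ?J = "\<integral>\<^sup>+x. ennreal (cmod (kernel_integral x) / \<bar>x\<bar>) \<partial>lborel"
  have "(\<integral>\<^sup>+x\<in>{0<..}. ennreal (cmod (remainder \<gamma> x)) \<partial>lborel) \<le>
      (\<integral>\<^sup>+x. ennreal (cmod (kernel_integral x) / \<bar>x\<bar>) + ennreal (cmod (kernel_integral (- x)) / \<bar>x\<bar>) \<partial>lborel)"
  proof (intro nn_integral_mono_AE, use norm_remainder_AE[OF \<gamma>] in eventually_elim)
    case (elim x)
    then show ?case
      by (cases "0 < x") (auto simp flip: ennreal_plus intro!: ennreal_leI)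
  qed
  also have "\<dots> = ?J + (\<integral>\<^sup>+x. ennreal (cmod (kernel_integral (- x)) / \<bar>x\<bar>) \<partial>lborel)"
    by (rule nn_integral_add) measurable
  also have "(\<integral>\<^sup>+x. ennreal (cmod (kernel_integral (- x)) / \<bar>x\<bar>) \<partial>lborel) = ?J"
    by (subst (2) nn_integral_real_affine[where c = "-1" and t = 0]) auto
  also have "?J + ?J \<le> ennreal (100 * decay_const p / ln 2) * Vstar_norm p f + ennreal (100 * decay_const p / ln 2) * Vstar_norm p f"
    by (intro add_mono kernel_integral_bound p eq)
  also have "\<dots> = ennreal (200 * decay_const p / ln 2) * Vstar_norm p f"
    using decay_const_pos[OF p] by (simp add: distrib_right[symmetric] flip: ennreal_plus)
  finally show ?thesis .
qed

end

theorem theorem10: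
  fixes p :: ennreal
  assumes "1 < p"
  shows "\<exists>C::real. \<forall>(f :: real \<Rightarrow> complex) (\<gamma>::real).
           bounded_variation_on {0..} f \<longrightarrow>
           (f \<longlongrightarrow> 0) at_top \<longrightarrow>
           \<gamma> = 0 \<or> \<gamma> = 1 / 4 \<longrightarrow>
           Vstar_norm p f < \<infinity> \<longrightarrow>
           (\<exists>\<Gamma> :: real \<Rightarrow> complex.
              (\<forall>x>0. has_trig_transform \<gamma> f x
                 (1 / (2 * pi * x) * f (1 / x) * sin (2 * pi * \<gamma>) + \<Gamma> x)) \<and>
              set_integrable lborel {0<..} \<Gamma> \<and>
              (\<integral>\<^sup>+x\<in>{0<..}. ennreal (cmod (\<Gamma> x)) \<partial>lborel) \<le> ennreal C * Vstar_norm p f)"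
proof (intro exI[of _ "200 * decay_const p / ln 2"] allI impI)
  fix f :: "real \<Rightarrow> complex" and \<gamma> :: real
  assume bv: "bounded_variation_on {0..} f" and f0: "(f \<longlongrightarrow> 0) at_top" and \<gamma>: "\<gamma> = 0 \<or> \<gamma> = 1 / 4"
    and fin: "Vstar_norm p f < \<infinity>"
  \<comment> \<open>Working with the very pair selected by \<open>stieltjes\<close> spares a proof
    that \<open>star_norm\<close> depends on the represented measure alone.\<close>
  obtain \<nu> \<theta> where eq: "stieltjes f = (\<nu>, \<theta>)" by (cases "stieltjes f")
  interpret bv_function f \<nu> \<theta>
    using bv f0 is_stieltjes_stieltjes[OF bv] by unfold_locales (simp_all add: eq)
  have le: "(\<integral>\<^sup>+x\<in>{0<..}. ennreal (cmod (remainder \<gamma> x)) \<partial>lborel) \<le> ennreal (200 * decay_const p / ln 2) * Vstar_norm p f"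
    by (rule remainder_bound[OF assms eq \<gamma>])
  have "set_integrable lborel {0<..} (remainder \<gamma>)"
    unfolding set_integrable_def
  proof (rule integrableI_bounded)
    have "(\<integral>\<^sup>+x. ennreal (norm (indicat_real {0<..} x *\<^sub>R remainder \<gamma> x)) \<partial>lborel) =
        (\<integral>\<^sup>+x\<in>{0<..}. ennreal (cmod (remainder \<gamma> x)) \<partial>lborel)"
      by (intro nn_integral_cong) (auto simp: indicator_def)
    also have "\<dots> < \<infinity>"
      using le fin by (auto simp: ennreal_mult_less_top intro: le_less_trans)
    finally show "(\<integral>\<^sup>+x. ennreal (norm (indicat_real {0<..} x *\<^sub>R remainder \<gamma> x)) \<partial>lborel) < \<infinity>" .
  qed (use measurable_remainder[of \<gamma>] in simp)
  moreover have "has_trig_transform \<gamma> f x (1 / (2 * pi * x) * f (1 / x) * sin (2 * pi * \<gamma>) + remainder \<gamma> x)"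
    if "0 < x" for x
    using trig_transform[OF that, of \<gamma>] by (simp add: remainder_def)
  ultimately show "\<exists>\<Gamma> :: real \<Rightarrow> complex.
      (\<forall>x>0. has_trig_transform \<gamma> f x
         (1 / (2 * pi * x) * f (1 / x) * sin (2 * pi * \<gamma>) + \<Gamma> x)) \<and>
      set_integrable lborel {0<..} \<Gamma> \<and>
      (\<integral>\<^sup>+x\<in>{0<..}. ennreal (cmod (\<Gamma> x)) \<partial>lborel) \<le> ennreal (200 * decay_const p / ln 2) * Vstar_norm p f"
    using le by blast
qed

end
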